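(* Let $\langle \mathcal{M},\otimes,i\rangle$ be a monoidal category with coequalizers and such that $\otimes$ preserves coequalizers in both arguments. If $\langle \mathcal{C},\Box,e\rangle$ is a monoidal category and $G\colon\mathcal{C}\to\mathcal{M}$ is a monoidal functor, then there is a monoid $\langle R,\mu^R,\eta^R\rangle$ in $\mathcal{M}$ and a strictly unital monoidal functor $U\colon\mathcal{C}\to{}_R\mathcal{M}_R$ such that: (1) $G$, as a monoidal functor, can be factorized as $\Gamma^R U$, i.e. $$G=\Gamma^R U,\qquad G_{a,b}=\Gamma^R U_{a,b}\circ\Gamma^R_{Ua,Ub}\ \ (a,b\in\mathcal{C}),\qquad G_0=\Gamma^R U_0\circ\Gamma^R_0 .$$ (2) If $S$ is a monoid in $\mathcal{M}$ and $V\colon\mathcal{C}\to{}_S\mathcal{M}_S$ is a monoidal functor such that $G=\Gamma^S V$ as monoidal functors, then there exists a unique monoid morphism $\sigma\colon S\to R$ such that $V=\Gamma^\sigma U$ (as monoidal functors).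
   Context: Monoidal functor means lax monoidal functor: a functor $G$ with a natural transformation $G_{a,b}\colon Ga\otimes Gb\to G(a\,\Box\,b)$ and an arrow $G_0\colon i\to Ge$ satisfying the usual associativity and unit coherence conditions (no invertibility is assumed). It is strictly unital if $G_0$ is an identity arrow. Monoidal functors are composed in the usual way, and equality "as monoidal functors" means equality of the functors and of their structure arrows. For a monoid $m$ in $\mathcal{M}$, ${}_m\mathcal{M}_m$ is the category of $m$-$m$-bimodules $\langle x,\lambda,\rho\rangle$ in $\mathcal{M}$. Under the stated hypotheses on $\mathcal{M}$ it is monoidal with unit the regular bimodule $m$ and product $x\otimes_m y$, a chosen coequalizer $x\otimes y\to x\otimes_m y$ of the two arrows $x\otimes(m\otimes y)\to x\otimes y$ given by $x\otimes\lambda_y$ and by the composite of the associativity isomorphism $x\otimes(m\otimes y)\cong(x\otimes m)\otimes y$ with $\rho_x\otimes y$. The forgetful functor $\Gamma^m\colon{}_m\mathcal{M}_m\to\mathcal{M}$, $\langle x,\lambda,\rho\rangle\mapsto x$, is monoidal: $\Gamma^m_{x,y}\colon x\otimes y\to x\otimes_m y$ is the chosen coequalizer and $\Gamma^m_0\colon i\to m$ is the unit of the monoid $m$. For a monoid morphism $\sigma\colon m\to n$, the functor $\Gamma^\sigma\colon{}_n\mathcal{M}_n\to{}_m\mathcal{M}_m$ sends $\langle x,\lambda,\rho\rangle$ to $\langle x,\lambda\circ(\sigma\otimes x),\rho\circ(x\otimes\sigma)\rangle$ and is the identity on underlying arrows. It is monoidal: $\Gamma^\sigma_{x,y}\colon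 x\otimes_m y\to x\otimes_n y$ is the unique arrow through which $\Gamma^n_{x,y}$ factors via $\Gamma^m_{x,y}$, and $\Gamma^\sigma_0\colon m\to n$ is $\sigma$ (as a morphism of $m$-$m$-bimodules). Thus $\Gamma^m\Gamma^\sigma=\Gamma^n$ as monoidal functors. *)

theory Defs
  imports Main
begin

section \<open>Categories and coequalizers\<close>

text \<open>
  Categories are given by a set of objects and a set of arrows inside two types. Composition is
  written in the classical order: \<open>g \<cdot> f\<close> is \<open>g\<close> after \<open>f\<close>, constrained only when
  \<open>Cod f = Dom g\<close>.
\<close>

record ('o, 'a) cat =
  Obj :: "'o set"
  Arr :: "'a set"
  Dom :: "'a \<Rightarrow> 'o"
  Cod :: "'a \<Rightarrow> 'o"
  Ident :: "'o \<Rightarrow> 'a"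
  Comp :: "'a \<Rightarrow> 'a \<Rightarrow> 'a"  (infixr "\<cdot>\<index>" 70)

definition Hom :: "('o, 'a, 'more) cat_scheme \<Rightarrow> 'o \<Rightarrow> 'o \<Rightarrow> 'a set" where
  "Hom C x y = {f \<in> Arr C. Dom C f = x \<and> Cod C f = y}"

locale category =
  fixes C :: "('o, 'a, 'more) cat_scheme" (structure)
  assumes Dom_in: "f \<in> Arr C \<Longrightarrow> Dom C f \<in> Obj C"
    and Cod_in: "f \<in> Arr C \<Longrightarrow> Cod C f \<in> Obj C"
    and Ident_in: "x \<in> Obj C \<Longrightarrow> Ident C x \<in> Hom C x x"
    and Comp_in: "\<lbrakk>f \<in> Hom C x y; g \<in> Hom C y z\<rbrakk> \<Longrightarrow> g \<cdot> f \<in> Hom C x z"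
    and Comp_Ident: "f \<in> Hom C x y \<Longrightarrow> f \<cdot> Ident C x = f"
    and Ident_Comp: "f \<in> Hom C x y \<Longrightarrow> Ident C y \<cdot> f = f"
    and Comp_assoc:
      "\<lbrakk>f \<in> Hom C x y; g \<in> Hom C y z; h \<in> Hom C z w\<rbrakk> \<Longrightarrow> (h \<cdot> g) \<cdot> f = h \<cdot> (g \<cdot> f)"

context
  fixes C :: "('o, 'a, 'more) cat_scheme" (structure)
begin

definition iso :: "'a \<Rightarrow> bool" where
  "iso f \<longleftrightarrow> f \<in> Arr C \<and>
     (\<exists>g \<in> Hom C (Cod C f) (Dom C f). g \<cdot> f = Ident C (Dom C f) \<and> f \<cdot> g = Ident C (Cod C f))"

definition parallel :: "'a \<Rightarrow> 'a \<Rightarrow> bool" where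
  "parallel f g \<longleftrightarrow> f \<in> Arr C \<and> g \<in> Arr C \<and> Dom C f = Dom C g \<and> Cod C f = Cod C g"

definition coequalizer :: "'a \<Rightarrow> 'a \<Rightarrow> 'a \<Rightarrow> bool" where
  "coequalizer f g p \<longleftrightarrow> parallel f g \<and> p \<in> Arr C \<and> Dom C p = Cod C f \<and> p \<cdot> f = p \<cdot> g \<and>
     (\<forall>h \<in> Arr C. Dom C h = Cod C f \<and> h \<cdot> f = h \<cdot> g \<longrightarrow>
        (\<exists>!k. k \<in> Hom C (Cod C p) (Cod C h) \<and> k \<cdot> p = h))"

definition has_coequalizers :: bool where
  "has_coequalizers \<longleftrightarrow> (\<forall>f g. parallel f g \<longrightarrow> (\<exists>p. coequalizer f g p))"

end


section \<open>Monoidal categories\<close>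

text \<open>
  The associator \<open>Assoc x y z\<close> goes from \<open>x \<otimes> (y \<otimes> z)\<close> to \<open>(x \<otimes> y) \<otimes> z\<close>.
\<close>

record ('o, 'a) moncat = "('o, 'a) cat" +
  TensO :: "'o \<Rightarrow> 'o \<Rightarrow> 'o"  (infixr "\<otimes>\<^sub>o\<index>" 75)
  TensA :: "'a \<Rightarrow> 'a \<Rightarrow> 'a"  (infixr "\<otimes>\<^sub>a\<index>" 75)
  Unit :: 'o
  Assoc :: "'o \<Rightarrow> 'o \<Rightarrow> 'o \<Rightarrow> 'a"
  LUnit :: "'o \<Rightarrow> 'a"
  RUnit :: "'o \<Rightarrow> 'a"

locale monoidal_category = category M
  for M :: "('o, 'a) moncat" (structure) +
  assumes TensO_in: "\<lbrakk>x \<in> Obj M; y \<in> Obj M\<rbrakk> \<Longrightarrow> x \<otimes>\<^sub>o y \<in> Obj M"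
    and TensA_in: "\<lbrakk>f \<in> Hom M x x'; g \<in> Hom M y y'\<rbrakk>
      \<Longrightarrow> f \<otimes>\<^sub>a g \<in> Hom M (x \<otimes>\<^sub>o y) (x' \<otimes>\<^sub>o y')"
    and Tens_Ident: "\<lbrakk>x \<in> Obj M; y \<in> Obj M\<rbrakk>
      \<Longrightarrow> Ident M x \<otimes>\<^sub>a Ident M y = Ident M (x \<otimes>\<^sub>o y)"
    and Tens_Comp:
      "\<lbrakk>f \<in> Hom M x x'; f' \<in> Hom M x' x''; g \<in> Hom M y y'; g' \<in> Hom M y' y''\<rbrakk>
      \<Longrightarrow> (f' \<cdot> f) \<otimes>\<^sub>a (g' \<cdot> g) = (f' \<otimes>\<^sub>a g') \<cdot> (f \<otimes>\<^sub>a g)"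
    and Unit_in: "Unit M \<in> Obj M"
    and Assoc_in: "\<lbrakk>x \<in> Obj M; y \<in> Obj M; z \<in> Obj M\<rbrakk>
      \<Longrightarrow> Assoc M x y z \<in> Hom M (x \<otimes>\<^sub>o (y \<otimes>\<^sub>o z)) ((x \<otimes>\<^sub>o y) \<otimes>\<^sub>o z)"
    and Assoc_iso: "\<lbrakk>x \<in> Obj M; y \<in> Obj M; z \<in> Obj M\<rbrakk> \<Longrightarrow> iso M (Assoc M x y z)"
    and Assoc_natural: "\<lbrakk>f \<in> Hom M x x'; g \<in> Hom M y y'; h \<in> Hom M z z'\<rbrakk>
      \<Longrightarrow> Assoc M x' y' z' \<cdot> (f \<otimes>\<^sub>a (g \<otimes>\<^sub>a h)) = ((f \<otimes>\<^sub>a g) \<otimes>\<^sub>a h) \<cdot> Assoc M x y z"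
    and LUnit_in: "x \<in> Obj M \<Longrightarrow> LUnit M x \<in> Hom M (Unit M \<otimes>\<^sub>o x) x"
    and LUnit_iso: "x \<in> Obj M \<Longrightarrow> iso M (LUnit M x)"
    and LUnit_natural: "f \<in> Hom M x y
      \<Longrightarrow> LUnit M y \<cdot> (Ident M (Unit M) \<otimes>\<^sub>a f) = f \<cdot> LUnit M x"
    and RUnit_in: "x \<in> Obj M \<Longrightarrow> RUnit M x \<in> Hom M (x \<otimes>\<^sub>o Unit M) x"
    and RUnit_iso: "x \<in> Obj M \<Longrightarrow> iso M (RUnit M x)"
    and RUnit_natural: "f \<in> Hom M x y
      \<Longrightarrow> RUnit M y \<cdot> (f \<otimes>\<^sub>a Ident M (Unit M)) = f \<cdot> RUnit M x"
    and pentagon: "\<lbrakk>x \<in> Obj M; y \<in> Obj M; z \<in> Obj M; w \<in> Obj M\<rbrakk>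
      \<Longrightarrow> Assoc M (x \<otimes>\<^sub>o y) z w \<cdot> Assoc M x y (z \<otimes>\<^sub>o w)
        = (Assoc M x y z \<otimes>\<^sub>a Ident M w) \<cdot> Assoc M x (y \<otimes>\<^sub>o z) w \<cdot> (Ident M x \<otimes>\<^sub>a Assoc M y z w)"
    and triangle: "\<lbrakk>x \<in> Obj M; y \<in> Obj M\<rbrakk>
      \<Longrightarrow> (RUnit M x \<otimes>\<^sub>a Ident M y) \<cdot> Assoc M x (Unit M) y = Ident M x \<otimes>\<^sub>a LUnit M y"

definition tensor_preserves_coequalizers :: "('o, 'a) moncat \<Rightarrow> bool" where
  "tensor_preserves_coequalizers M \<longleftrightarrow>
     (\<forall>f g p z. coequalizer M f g p \<and> z \<in> Obj M \<longrightarrow>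
        coequalizer M (Ident M z \<otimes>\<^sub>a\<^bsub>M\<^esub> f) (Ident M z \<otimes>\<^sub>a\<^bsub>M\<^esub> g) (Ident M z \<otimes>\<^sub>a\<^bsub>M\<^esub> p) \<and>
        coequalizer M (f \<otimes>\<^sub>a\<^bsub>M\<^esub> Ident M z) (g \<otimes>\<^sub>a\<^bsub>M\<^esub> Ident M z) (p \<otimes>\<^sub>a\<^bsub>M\<^esub> Ident M z))"


section \<open>Lax monoidal functors\<close>

record ('c, 'd, 'o, 'a) mfun =
  FunO :: "'c \<Rightarrow> 'o"
  FunA :: "'d \<Rightarrow> 'a"
  Fun2 :: "'c \<Rightarrow> 'c \<Rightarrow> 'a"
  Fun0 :: 'a

locale monoidal_functor = source: monoidal_category C + target: monoidal_category D
  for C :: "('c, 'd) moncat" and D :: "('o, 'a) moncat" +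
  fixes F :: "('c, 'd, 'o, 'a) mfun"
  assumes FunO_in: "x \<in> Obj C \<Longrightarrow> FunO F x \<in> Obj D"
    and FunA_in: "f \<in> Hom C x y \<Longrightarrow> FunA F f \<in> Hom D (FunO F x) (FunO F y)"
    and Fun_Ident: "x \<in> Obj C \<Longrightarrow> FunA F (Ident C x) = Ident D (FunO F x)"
    and Fun_Comp: "\<lbrakk>f \<in> Hom C x y; g \<in> Hom C y z\<rbrakk>
      \<Longrightarrow> FunA F (g \<cdot>\<^bsub>C\<^esub> f) = FunA F g \<cdot>\<^bsub>D\<^esub> FunA F f"
    and Fun2_in: "\<lbrakk>x \<in> Obj C; y \<in> Obj C\<rbrakk>
      \<Longrightarrow> Fun2 F x y \<in> Hom D (FunO F x \<otimes>\<^sub>o\<^bsub>D\<^esub> FunO F y) (FunO F (x \<otimes>\<^sub>o\<^bsub>C\<^esub> y))"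
    and Fun0_in: "Fun0 F \<in> Hom D (Unit D) (FunO F (Unit C))"
    and Fun2_natural: "\<lbrakk>f \<in> Hom C x x'; g \<in> Hom C y y'\<rbrakk>
      \<Longrightarrow> FunA F (f \<otimes>\<^sub>a\<^bsub>C\<^esub> g) \<cdot>\<^bsub>D\<^esub> Fun2 F x y = Fun2 F x' y' \<cdot>\<^bsub>D\<^esub> (FunA F f \<otimes>\<^sub>a\<^bsub>D\<^esub> FunA F g)"
    and Fun_Assoc: "\<lbrakk>x \<in> Obj C; y \<in> Obj C; z \<in> Obj C\<rbrakk>
      \<Longrightarrow> FunA F (Assoc C x y z) \<cdot>\<^bsub>D\<^esub> Fun2 F x (y \<otimes>\<^sub>o\<^bsub>C\<^esub> z) \<cdot>\<^bsub>D\<^esub> (Ident D (FunO F x) \<otimes>\<^sub>a\<^bsub>D\<^esub> Fun2 F y z)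
        = Fun2 F (x \<otimes>\<^sub>o\<^bsub>C\<^esub> y) z \<cdot>\<^bsub>D\<^esub> (Fun2 F x y \<otimes>\<^sub>a\<^bsub>D\<^esub> Ident D (FunO F z))
          \<cdot>\<^bsub>D\<^esub> Assoc D (FunO F x) (FunO F y) (FunO F z)"
    and Fun_LUnit: "x \<in> Obj C
      \<Longrightarrow> FunA F (LUnit C x) \<cdot>\<^bsub>D\<^esub> Fun2 F (Unit C) x \<cdot>\<^bsub>D\<^esub> (Fun0 F \<otimes>\<^sub>a\<^bsub>D\<^esub> Ident D (FunO F x))
        = LUnit D (FunO F x)"
    and Fun_RUnit: "x \<in> Obj C
      \<Longrightarrow> FunA F (RUnit C x) \<cdot>\<^bsub>D\<^esub> Fun2 F x (Unit C) \<cdot>\<^bsub>D\<^esub> (Ident D (FunO F x) \<otimes>\<^sub>a\<^bsub>D\<^esub> Fun0 F)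
        = RUnit D (FunO F x)"

definition strictly_unital :: "('o, 'a) moncat \<Rightarrow> ('c, 'd, 'o, 'a) mfun \<Rightarrow> bool" where
  "strictly_unital D F \<longleftrightarrow> (\<exists>x \<in> Obj D. Fun0 F = Ident D x)"

text \<open>
  The composite \<open>G F\<close>, where \<open>E\<close> is the target of \<open>G\<close>.
\<close>

definition mfun_comp ::
  "('e, 'f) moncat \<Rightarrow> ('o, 'a, 'e, 'f) mfun \<Rightarrow> ('c, 'd, 'o, 'a) mfun \<Rightarrow> ('c, 'd, 'e, 'f) mfun" where
  "mfun_comp E G F =
     \<lparr>FunO = (\<lambda>x. FunO G (FunO F x)),
      FunA = (\<lambda>f. FunA G (FunA F f)),
      Fun2 = (\<lambda>x y. FunA G (Fun2 F x y) \<cdot>\<^bsub>E\<^esub> Fun2 G (FunO F x) (FunO F y)),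
      Fun0 = FunA G (Fun0 F) \<cdot>\<^bsub>E\<^esub> Fun0 G\<rparr>"

text \<open>
  Equality of monoidal functors on \<open>C\<close>; values outside the carriers of \<open>C\<close> are irrelevant.
\<close>

definition mfun_eq ::
  "('c, 'd) moncat \<Rightarrow> ('c, 'd, 'o, 'a) mfun \<Rightarrow> ('c, 'd, 'o, 'a) mfun \<Rightarrow> bool" where
  "mfun_eq C F G \<longleftrightarrow>
     (\<forall>x \<in> Obj C. FunO F x = FunO G x) \<and>
     (\<forall>f \<in> Arr C. FunA F f = FunA G f) \<and>
     (\<forall>x \<in> Obj C. \<forall>y \<in> Obj C. Fun2 F x y = Fun2 G x y) \<and>
     Fun0 F = Fun0 G"


section \<open>Monoids and bimodules\<close>

datatype ('o, 'a) mon = Mon (mobj: 'o) (mult: 'a) (unt: 'a)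

datatype ('o, 'a) bimod = Bimod (carr: 'o) (lact: 'a) (ract: 'a)

text \<open>
  An arrow of bimodules records its source and target, since the same arrow of the base category
  may be a morphism between several pairs of bimodules.
\<close>

datatype ('o, 'a) bimod_arr =
  BArr (bdom: "('o, 'a) bimod") (barr: 'a) (bcod: "('o, 'a) bimod")

context
  fixes M :: "('o, 'a) moncat" (structure)
begin

definition monoid_in :: "('o, 'a) mon \<Rightarrow> bool" where
  "monoid_in m \<longleftrightarrow>
     mobj m \<in> Obj M \<and>
     mult m \<in> Hom M (mobj m \<otimes>\<^sub>o mobj m) (mobj m) \<and>
     unt m \<in> Hom M (Unit M) (mobj m) \<and>
     mult m \<cdot> (mult m \<otimes>\<^sub>a Ident M (mobj m)) \<cdot> Assoc M (mobj m) (mobj m) (mobj m)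
       = mult m \<cdot> (Ident M (mobj m) \<otimes>\<^sub>a mult m) \<and>
     mult m \<cdot> (unt m \<otimes>\<^sub>a Ident M (mobj m)) = LUnit M (mobj m) \<and>
     mult m \<cdot> (Ident M (mobj m) \<otimes>\<^sub>a unt m) = RUnit M (mobj m)"

definition monoid_hom :: "('o, 'a) mon \<Rightarrow> ('o, 'a) mon \<Rightarrow> 'a \<Rightarrow> bool" where
  "monoid_hom m n \<sigma> \<longleftrightarrow>
     \<sigma> \<in> Hom M (mobj m) (mobj n) \<and>
     \<sigma> \<cdot> mult m = mult n \<cdot> (\<sigma> \<otimes>\<^sub>a \<sigma>) \<and>
     \<sigma> \<cdot> unt m = unt n"

definition bimodule :: "('o, 'a) mon \<Rightarrow> ('o, 'a) bimod \<Rightarrow> bool" where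
  "bimodule m x \<longleftrightarrow>
     carr x \<in> Obj M \<and>
     lact x \<in> Hom M (mobj m \<otimes>\<^sub>o carr x) (carr x) \<and>
     ract x \<in> Hom M (carr x \<otimes>\<^sub>o mobj m) (carr x) \<and>
     lact x \<cdot> (mult m \<otimes>\<^sub>a Ident M (carr x)) \<cdot> Assoc M (mobj m) (mobj m) (carr x)
       = lact x \<cdot> (Ident M (mobj m) \<otimes>\<^sub>a lact x) \<and>
     lact x \<cdot> (unt m \<otimes>\<^sub>a Ident M (carr x)) = LUnit M (carr x) \<and>
     ract x \<cdot> (ract x \<otimes>\<^sub>a Ident M (mobj m)) \<cdot> Assoc M (carr x) (mobj m) (mobj m)
       = ract x \<cdot> (Ident M (carr x) \<otimes>\<^sub>a mult m) \<and>
     ract x \<cdot> (Ident M (carr x) \<otimes>\<^sub>a unt m) = RUnit M (carr x) \<and>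
     ract x \<cdot> (lact x \<otimes>\<^sub>a Ident M (mobj m)) \<cdot> Assoc M (mobj m) (carr x) (mobj m)
       = lact x \<cdot> (Ident M (mobj m) \<otimes>\<^sub>a ract x)"

definition bimodule_hom :: "('o, 'a) mon \<Rightarrow> ('o, 'a) bimod \<Rightarrow> 'a \<Rightarrow> ('o, 'a) bimod \<Rightarrow> bool" where
  "bimodule_hom m x f y \<longleftrightarrow>
     bimodule m x \<and> bimodule m y \<and>
     f \<in> Hom M (carr x) (carr y) \<and>
     f \<cdot> lact x = lact y \<cdot> (Ident M (mobj m) \<otimes>\<^sub>a f) \<and>
     f \<cdot> ract x = ract y \<cdot> (f \<otimes>\<^sub>a Ident M (mobj m))"

definition regular :: "('o, 'a) mon \<Rightarrow> ('o, 'a) bimod" where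
  "regular m = Bimod (mobj m) (mult m) (mult m)"

text \<open>
  A choice of coequalizers: \<open>q m x y\<close> is the chosen arrow from \<open>x \<otimes> y\<close> to \<open>x \<otimes>\<^sub>m y\<close>.
\<close>

definition coequalizer_choice ::
  "(('o, 'a) mon \<Rightarrow> ('o, 'a) bimod \<Rightarrow> ('o, 'a) bimod \<Rightarrow> 'a) \<Rightarrow> bool" where
  "coequalizer_choice q \<longleftrightarrow>
     (\<forall>m x y. monoid_in m \<and> bimodule m x \<and> bimodule m y \<longrightarrow>
        coequalizer M
          (Ident M (carr x) \<otimes>\<^sub>a lact y)
          ((ract x \<otimes>\<^sub>a Ident M (carr y)) \<cdot> Assoc M (carr x) (mobj m) (carr y))
          (q m x y))"

end


section \<open>The monoidal category of bimodules\<close>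

text \<open>
  The tensor product and its constraints are determined by the universal property of the chosen coequalizers, and stated
  by a definite description; \<open>\<otimes>\<close> has to preserve coequalizers for these descriptions to denote.
\<close>

context
  fixes M :: "('o, 'a) moncat" (structure)
    and q :: "('o, 'a) mon \<Rightarrow> ('o, 'a) bimod \<Rightarrow> ('o, 'a) bimod \<Rightarrow> 'a"
    and m :: "('o, 'a) mon"
begin

text \<open>
  The actions on \<open>x \<otimes>\<^sub>m y\<close> are induced by the left action on \<open>x\<close> and the right action on \<open>y\<close>.
\<close>

definition bimod_tensO :: "('o, 'a) bimod \<Rightarrow> ('o, 'a) bimod \<Rightarrow> ('o, 'a) bimod" where
  "bimod_tensO x y =
     (let t = Cod M (q m x y) in
      Bimod t
        (THE l. l \<in> Hom M (mobj m \<otimes>\<^sub>o t) t \<and>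
           l \<cdot> (Ident M (mobj m) \<otimes>\<^sub>a q m x y)
           = q m x y \<cdot> (lact x \<otimes>\<^sub>a Ident M (carr y)) \<cdot> Assoc M (mobj m) (carr x) (carr y))
        (THE r. r \<in> Hom M (t \<otimes>\<^sub>o mobj m) t \<and>
           r \<cdot> (q m x y \<otimes>\<^sub>a Ident M (mobj m)) \<cdot> Assoc M (carr x) (carr y) (mobj m)
           = q m x y \<cdot> (Ident M (carr x) \<otimes>\<^sub>a ract y)))"

definition bimod_tensA :: "('o, 'a) bimod_arr \<Rightarrow> ('o, 'a) bimod_arr \<Rightarrow> ('o, 'a) bimod_arr" where
  "bimod_tensA f g =
     (let x = bimod_tensO (bdom f) (bdom g); y = bimod_tensO (bcod f) (bcod g) in
      BArr x
        (THE h. h \<in> Hom M (carr x) (carr y) \<and>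
           h \<cdot> q m (bdom f) (bdom g) = q m (bcod f) (bcod g) \<cdot> (barr f \<otimes>\<^sub>a barr g))
        y)"

definition bimod_assoc ::
  "('o, 'a) bimod \<Rightarrow> ('o, 'a) bimod \<Rightarrow> ('o, 'a) bimod \<Rightarrow> ('o, 'a) bimod_arr" where
  "bimod_assoc x y z =
     (let s = bimod_tensO x (bimod_tensO y z); t = bimod_tensO (bimod_tensO x y) z in
      BArr s
        (THE h. h \<in> Hom M (carr s) (carr t) \<and>
           h \<cdot> q m x (bimod_tensO y z) \<cdot> (Ident M (carr x) \<otimes>\<^sub>a q m y z)
           = q m (bimod_tensO x y) z \<cdot> (q m x y \<otimes>\<^sub>a Ident M (carr z))
               \<cdot> Assoc M (carr x) (carr y) (carr z))
        t)"

definition bimod_lunit :: "('o, 'a) bimod \<Rightarrow> ('o, 'a) bimod_arr" where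
  "bimod_lunit x =
     (let s = bimod_tensO (regular m) x in
      BArr s (THE h. h \<in> Hom M (carr s) (carr x) \<and> h \<cdot> q m (regular m) x = lact x) x)"

definition bimod_runit :: "('o, 'a) bimod \<Rightarrow> ('o, 'a) bimod_arr" where
  "bimod_runit x =
     (let s = bimod_tensO x (regular m) in
      BArr s (THE h. h \<in> Hom M (carr s) (carr x) \<and> h \<cdot> q m x (regular m) = ract x) x)"

definition bimod_cat :: "(('o, 'a) bimod, ('o, 'a) bimod_arr) moncat" where
  "bimod_cat =
     \<lparr>Obj = {x. bimodule M m x},
      Arr = {f. bimodule_hom M m (bdom f) (barr f) (bcod f)},
      Dom = bdom,
      Cod = bcod,
      Ident = (\<lambda>x. BArr x (Ident M (carr x)) x),
      Comp = (\<lambda>g f. BArr (bdom f) (barr g \<cdot> barr f) (bcod g)),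
      TensO = bimod_tensO,
      TensA = bimod_tensA,
      Unit = regular m,
      Assoc = bimod_assoc,
      LUnit = bimod_lunit,
      RUnit = bimod_runit\<rparr>"

text \<open>
  The forgetful functor \<open>\<Gamma>\<^sup>m\<close> from \<open>m\<close>-\<open>m\<close>-bimodules to \<open>M\<close>.
\<close>

definition forget :: "(('o, 'a) bimod, ('o, 'a) bimod_arr, 'o, 'a) mfun" where
  "forget = \<lparr>FunO = carr, FunA = barr, Fun2 = q m, Fun0 = unt m\<rparr>"

end

text \<open>
  For a monoid morphism \<open>\<sigma>\<close> from \<open>m\<close> to \<open>n\<close>, the functor \<open>\<Gamma>\<^sup>\<sigma>\<close> from \<open>n\<close>-\<open>n\<close>-bimodules to
  \<open>m\<close>-\<open>m\<close>-bimodules (restriction along \<open>\<sigma>\<close>).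
\<close>

definition restrict_bimod ::
  "('o, 'a) moncat \<Rightarrow> 'a \<Rightarrow> ('o, 'a) bimod \<Rightarrow> ('o, 'a) bimod" where
  "restrict_bimod M \<sigma> x =
     Bimod (carr x)
       (lact x \<cdot>\<^bsub>M\<^esub> (\<sigma> \<otimes>\<^sub>a\<^bsub>M\<^esub> Ident M (carr x)))
       (ract x \<cdot>\<^bsub>M\<^esub> (Ident M (carr x) \<otimes>\<^sub>a\<^bsub>M\<^esub> \<sigma>))"

definition restrict ::
  "('o, 'a) moncat \<Rightarrow> (('o, 'a) mon \<Rightarrow> ('o, 'a) bimod \<Rightarrow> ('o, 'a) bimod \<Rightarrow> 'a)
   \<Rightarrow> ('o, 'a) mon \<Rightarrow> ('o, 'a) mon \<Rightarrow> 'a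
   \<Rightarrow> (('o, 'a) bimod, ('o, 'a) bimod_arr, ('o, 'a) bimod, ('o, 'a) bimod_arr) mfun" where
  "restrict M q m n \<sigma> =
     \<lparr>FunO = restrict_bimod M \<sigma>,
      FunA = (\<lambda>f. BArr (restrict_bimod M \<sigma> (bdom f)) (barr f) (restrict_bimod M \<sigma> (bcod f))),
      Fun2 = (\<lambda>x y.
        let s = bimod_tensO M q m (restrict_bimod M \<sigma> x) (restrict_bimod M \<sigma> y);
            t = restrict_bimod M \<sigma> (bimod_tensO M q n x y) in
        BArr s
          (THE k. k \<in> Hom M (carr s) (carr t) \<and>
             k \<cdot>\<^bsub>M\<^esub> q m (restrict_bimod M \<sigma> x) (restrict_bimod M \<sigma> y) = q n x y)
          t),
      Fun0 = BArr (regular m) \<sigma> (restrict_bimod M \<sigma> (regular n))\<rparr>"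

end

theory Submission
  imports Defs
begin

text \<open>
  Write \<open>e\<close> for the unit of \<open>C\<close>. The monoid is \<open>R = G e\<close>, whose multiplication is \<open>G\<^sub>2 e e\<close> followed by
  the image of \<open>e \<box> e \<rightarrow> e\<close>, and every \<open>G x\<close> becomes an \<open>R\<close>-bimodule through \<open>G\<^sub>2 e x\<close> and \<open>G\<^sub>2 x e\<close>.
  The triangle identity makes \<open>G\<^sub>2 x y\<close> balanced, so it factors through the tensor product over \<open>R\<close>.
  If \<open>G\<close> also factors through \<open>S\<close>-bimodules by \<open>V\<close>, then the morphism is the unit constraint
  \<open>\<sigma> = V\<^sub>0\<close>: the unit coherence of \<open>V\<close> says exactly that \<open>S\<close> acts on \<open>V x\<close> through \<open>\<sigma>\<close>.

  Equations in \<open>M\<close> are proved by rewriting composites of whiskered arrows, associated to the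
  right: right whiskers move to the left of left whiskers, associators move to the right, and equations
  between maps out of a tensor product of bimodules are tested on the chosen coequalizers.
\<close>

section \<open>Calculating in categories\<close>

text \<open>The claim that \<open>U\<close> is a monoidal functor includes that its target is a
  monoidal category, so the bimodules over a monoid have to be shown to form one. Their tensor
  product, associator and unit constraints are definite descriptions; nothing can be said about any
  of them until the described arrow is known to exist and to be unique. Preservation of coequalizers
  is what makes this possible: a whiskered chosen coequalizer is again a coequalizer, so arrows out
  of z \<otimes> (x tensored over m with y) can be both induced and compared.

  A second obstacle is an asymmetry of the monoid: its multiplication uses the left unit constraint
  of \<open>C\<close> at the unit object, the right action on G e uses the right one. The regular
  bimodule is G e because the two constraints agree there, which is one of the coherence laws that
  the axioms do not list.

  Uniqueness costs little: the unit constraint of U is an identity, so the unit constraint of the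
  composite with restriction along \<sigma> is \<sigma> itself. The substance of the second claim is
  that this forced arrow is a monoid morphism and reproduces all of V.\<close>

context category
begin

lemma arrI:
  assumes "f \<in> Hom C x y"
  shows "f \<in> Arr C" and "Dom C f = x" and "Cod C f = y"
  using assms by (auto simp: Hom_def)

lemma HomI: "\<lbrakk>f \<in> Arr C; Dom C f = x; Cod C f = y\<rbrakk> \<Longrightarrow> f \<in> Hom C x y"
  by (simp add: Hom_def)

lemma Dom_obj [simp]: "f \<in> Arr C \<Longrightarrow> Dom C f \<in> Obj C"
  by (rule Dom_in)

lemma Cod_obj [simp]: "f \<in> Arr C \<Longrightarrow> Cod C f \<in> Obj C"
  by (rule Cod_in)

lemma Ident_arr [simp]:
  assumes "x \<in> Obj C"
  shows "Ident C x \<in> Arr C" and "Dom C (Ident C x) = x" and "Cod C (Ident C x) = x"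
  using Ident_in[OF assms] by (auto simp: Hom_def)

lemma comp_arr [simp]:
  assumes "f \<in> Arr C" and "g \<in> Arr C" and "Cod C f = Dom C g"
  shows "g \<cdot> f \<in> Arr C" and "Dom C (g \<cdot> f) = Dom C f" and "Cod C (g \<cdot> f) = Cod C g"
  using Comp_in[of f "Dom C f" "Cod C f" g "Cod C g"] assms by (auto simp: Hom_def)

lemma comp_ident [simp]: "\<lbrakk>f \<in> Arr C; Dom C f = x\<rbrakk> \<Longrightarrow> f \<cdot> Ident C x = f"
  using Comp_Ident[of f x "Cod C f"] by (auto simp: Hom_def)

lemma ident_comp [simp]: "\<lbrakk>f \<in> Arr C; Cod C f = x\<rbrakk> \<Longrightarrow> Ident C x \<cdot> f = f"
  using Ident_Comp[of f "Dom C f" x] by (auto simp: Hom_def)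

lemma comp_assoc [simp]:
  "\<lbrakk>f \<in> Arr C; g \<in> Arr C; h \<in> Arr C; Cod C f = Dom C g; Cod C g = Dom C h\<rbrakk>
    \<Longrightarrow> (h \<cdot> g) \<cdot> f = h \<cdot> (g \<cdot> f)"
  using Comp_assoc[of f "Dom C f" "Cod C f" g "Cod C g" h "Cod C h"] by (auto simp: Hom_def)

text \<open>In a right-nested composite \<open>g \<cdot> (f \<cdot> t)\<close> the redex
  \<open>g \<cdot> f\<close> is not a subterm. With \<open>THEN\<close> this rule turns an equation
  for the pair into one that rewrites in front of a tail.\<close>

lemma comp2_tail:
  "\<lbrakk>g \<cdot> f = h; g \<in> Arr C; f \<in> Arr C; Cod C f = Dom C g; t \<in> Arr C; Cod C t = Dom C f\<rbrakk>
    \<Longrightarrow> g \<cdot> (f \<cdot> t) = h \<cdot> t"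
  using comp_assoc[of t f g] by simp

lemma comp3_tail:
  assumes "g \<cdot> (f \<cdot> k) = h" and "g \<in> Arr C" "f \<in> Arr C" "k \<in> Arr C" "t \<in> Arr C"
    and "Cod C f = Dom C g" "Cod C k = Dom C f" "Cod C t = Dom C k"
  shows "g \<cdot> (f \<cdot> (k \<cdot> t)) = h \<cdot> t"
  using assms(2-) by (simp flip: assms(1))

section \<open>Epimorphisms, inverses and coequalizers\<close>

definition epi :: "'a \<Rightarrow> bool" where
  "epi e \<longleftrightarrow> e \<in> Arr C \<and>
     (\<forall>k \<in> Arr C. \<forall>k' \<in> Arr C. Dom C k = Cod C e \<and> Dom C k' = Cod C e \<and> k \<cdot> e = k' \<cdot> e \<longrightarrow> k = k')"

lemma epiD:
  "\<lbrakk>epi e; k \<cdot> e = k' \<cdot> e; k \<in> Arr C; k' \<in> Arr C; Dom C k = Cod C e; Dom C k' = Cod C e\<rbrakk> \<Longrightarrow> k = k'"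
  unfolding epi_def by blast

lemma epi_comp [simp]:
  assumes "epi f" and "epi g" and "Cod C f = Dom C g"
  shows "epi (g \<cdot> f)"
proof -
  have [simp]: "f \<in> Arr C" "g \<in> Arr C"
    using assms by (auto simp: epi_def)
  show ?thesis
    unfolding epi_def
  proof (intro conjI ballI impI)
    fix k k'
    assume "k \<in> Arr C" "k' \<in> Arr C"
      and "Dom C k = Cod C (g \<cdot> f) \<and> Dom C k' = Cod C (g \<cdot> f) \<and> k \<cdot> g \<cdot> f = k' \<cdot> g \<cdot> f"
    moreover from this have "k \<cdot> g = k' \<cdot> g"
      by (intro epiD[OF assms(1), of "k \<cdot> g"]) (use assms in auto)
    ultimately show "k = k'"
      by (intro epiD[OF assms(2), of k]) (use assms in auto)
  qed (use assms in simp)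
qed

text \<open>Two-sided inverses are unique, so the choice operator is harmless; a named inverse lets
  isomorphisms be cancelled by rewriting.\<close>

definition inv_arr :: "'a \<Rightarrow> 'a" where
  "inv_arr f = (SOME g. g \<in> Hom C (Cod C f) (Dom C f) \<and> g \<cdot> f = Ident C (Dom C f) \<and>
     f \<cdot> g = Ident C (Cod C f))"

lemma inv_arr [simp]:
  assumes "iso C f"
  shows "inv_arr f \<in> Arr C" and "Dom C (inv_arr f) = Cod C f" and "Cod C (inv_arr f) = Dom C f"
    and "inv_arr f \<cdot> f = Ident C (Dom C f)" and "f \<cdot> inv_arr f = Ident C (Cod C f)"
proof -
  have "inv_arr f \<in> Hom C (Cod C f) (Dom C f) \<and> inv_arr f \<cdot> f = Ident C (Dom C f) \<and>
     f \<cdot> inv_arr f = Ident C (Cod C f)"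
    unfolding inv_arr_def by (rule someI_ex) (use assms in \<open>auto simp: iso_def\<close>)
  then show "inv_arr f \<in> Arr C" and "Dom C (inv_arr f) = Cod C f" and "Cod C (inv_arr f) = Dom C f"
    and "inv_arr f \<cdot> f = Ident C (Dom C f)" and "f \<cdot> inv_arr f = Ident C (Cod C f)"
    by (auto simp: Hom_def)
qed

lemma iso_arr: "iso C f \<Longrightarrow> f \<in> Arr C"
  by (simp add: iso_def)

lemma isoI:
  "\<lbrakk>f \<in> Arr C; g \<in> Arr C; Dom C g = Cod C f; Cod C g = Dom C f;
    g \<cdot> f = Ident C (Dom C f); f \<cdot> g = Ident C (Cod C f)\<rbrakk> \<Longrightarrow> iso C f"
  unfolding iso_def Hom_def by blast

lemma inv_arr_comp [simp]:
  assumes "iso C f" and "t \<in> Arr C"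
  shows "Cod C t = Dom C f \<Longrightarrow> inv_arr f \<cdot> (f \<cdot> t) = t"
    and "Cod C t = Cod C f \<Longrightarrow> f \<cdot> (inv_arr f \<cdot> t) = t"
  using assms by (simp_all add: iso_arr flip: comp_assoc)

lemma iso_epi [simp]:
  assumes "iso C f"
  shows "epi f"
  unfolding epi_def
proof (intro conjI ballI impI)
  fix k k'
  assume k: "k \<in> Arr C" "k' \<in> Arr C"
    and *: "Dom C k = Cod C f \<and> Dom C k' = Cod C f \<and> k \<cdot> f = k' \<cdot> f"
  have "k = (k \<cdot> f) \<cdot> inv_arr f"
    using k conjunct1[OF *] assms by (simp add: iso_arr)
  also have "\<dots> = (k' \<cdot> f) \<cdot> inv_arr f"
    using * by simp
  also have "\<dots> = k'"
    using k * assms by (simp add: iso_arr)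
  finally show "k = k'" .
qed (use assms iso_arr in simp)

lemma iso_monoD:
  assumes "iso C f" and "f \<cdot> k = f \<cdot> k'"
    and "k \<in> Arr C" "k' \<in> Arr C" "Cod C k = Dom C f" "Cod C k' = Dom C f"
  shows "k = k'"
proof -
  have "inv_arr f \<cdot> (f \<cdot> k) = inv_arr f \<cdot> (f \<cdot> k')"
    using assms(2) by simp
  then show ?thesis
    using assms(1,3-) by simp
qed

lemma coequalizer_arr:
  assumes "coequalizer C f g p"
  shows "p \<in> Arr C" and "Dom C p = Cod C f" and "p \<cdot> f = p \<cdot> g"
  using assms by (auto simp: coequalizer_def)

text \<open>The codomains are variables tied by equations, so that the rule unifies with goals in
  which a codomain is already written as the carrier of a tensor product.\<close>

lemma coequalizer_ex1:
  "\<lbrakk>coequalizer C f g p; h \<in> Arr C; Dom C h = Cod C f; h \<cdot> f = h \<cdot> g; Cod C p = t; Cod C h = z\<rbrakk>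
    \<Longrightarrow> \<exists>!k. k \<in> Hom C t z \<and> k \<cdot> p = h"
  unfolding coequalizer_def by blast

text \<open>Two arrows with the same composite \<open>k \<cdot> p\<close> are both mediating arrows
  for that composite, and the mediating arrow is unique.\<close>

lemma coequalizer_epi:
  assumes "coequalizer C f g p"
  shows "epi p"
  unfolding epi_def
proof (intro conjI ballI impI)
  have p: "parallel C f g"
    using assms by (simp add: coequalizer_def)
  fix k k'
  assume k: "k \<in> Arr C" "k' \<in> Arr C"
    and *: "Dom C k = Cod C p \<and> Dom C k' = Cod C p \<and> k \<cdot> p = k' \<cdot> p"
  \<comment> \<open>Uniqueness of the mediating arrow speaks of one codomain at a time; that the
    codomains agree is read off from the equal composites.\<close>
  have [simp]: "Cod C k' = Cod C k"
    using k * coequalizer_arr(1)[OF assms] comp_arr(3)[of p k] comp_arr(3)[of p k'] by simp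
  have "\<exists>!j. j \<in> Hom C (Cod C p) (Cod C k) \<and> j \<cdot> p = k \<cdot> p"
    by (rule coequalizer_ex1[OF assms])
      (use k * p coequalizer_arr[OF assms] in \<open>auto simp: parallel_def\<close>)
  moreover have "k \<in> Hom C (Cod C p) (Cod C k)" "k' \<in> Hom C (Cod C p) (Cod C k)"
    using k * by (simp_all add: HomI)
  moreover have "k' \<cdot> p = k \<cdot> p"
    using * by simp
  ultimately show "k = k'"
    by blast
qed (rule coequalizer_arr[OF assms])

end


section \<open>Calculating in monoidal categories\<close>

abbreviation lwhisker :: "('o, 'a) moncat \<Rightarrow> 'o \<Rightarrow> 'a \<Rightarrow> 'a" (infixr "\<triangleleft>\<index>" 75) where
  "x \<triangleleft>\<^bsub>M\<^esub> f \<equiv> Ident M x \<otimes>\<^sub>a\<^bsub>M\<^esub> f"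

abbreviation rwhisker :: "('o, 'a) moncat \<Rightarrow> 'a \<Rightarrow> 'o \<Rightarrow> 'a" (infixr "\<triangleright>\<index>" 75) where
  "f \<triangleright>\<^bsub>M\<^esub> x \<equiv> f \<otimes>\<^sub>a\<^bsub>M\<^esub> Ident M x"

context monoidal_category
begin

abbreviation \<alpha> :: "'o \<Rightarrow> 'o \<Rightarrow> 'o \<Rightarrow> 'a" where "\<alpha> \<equiv> Assoc M"
abbreviation I :: 'o where "I \<equiv> Unit M"

lemma tens_obj [simp]: "\<lbrakk>x \<in> Obj M; y \<in> Obj M\<rbrakk> \<Longrightarrow> x \<otimes>\<^sub>o y \<in> Obj M"
  by (rule TensO_in)

lemma unit_obj [simp]: "I \<in> Obj M"
  by (rule Unit_in)

lemma tens_arr [simp]: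
  assumes "f \<in> Arr M" and "g \<in> Arr M"
  shows "f \<otimes>\<^sub>a g \<in> Arr M" and "Dom M (f \<otimes>\<^sub>a g) = Dom M f \<otimes>\<^sub>o Dom M g"
    and "Cod M (f \<otimes>\<^sub>a g) = Cod M f \<otimes>\<^sub>o Cod M g"
  using TensA_in[of f "Dom M f" "Cod M f" g "Dom M g" "Cod M g"] assms by (auto simp: Hom_def)

lemma tens_ident [simp]: "\<lbrakk>x \<in> Obj M; y \<in> Obj M\<rbrakk> \<Longrightarrow> x \<triangleleft> Ident M y = Ident M (x \<otimes>\<^sub>o y)"
  by (rule Tens_Ident)

lemma tens_comp:
  "\<lbrakk>f \<in> Arr M; f' \<in> Arr M; g \<in> Arr M; g' \<in> Arr M; Cod M f = Dom M f'; Cod M g = Dom M g'\<rbrakk>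
    \<Longrightarrow> (f' \<otimes>\<^sub>a g') \<cdot> (f \<otimes>\<^sub>a g) = (f' \<cdot> f) \<otimes>\<^sub>a (g' \<cdot> g)"
  using Tens_Comp[of f "Dom M f" "Cod M f" f' "Cod M f'" g "Dom M g" "Cod M g" g' "Cod M g'"]
  by (auto simp: Hom_def)

lemma lwhisker_comp [simp]:
  "\<lbrakk>x \<in> Obj M; f \<in> Arr M; g \<in> Arr M; Cod M f = Dom M g\<rbrakk> \<Longrightarrow> x \<triangleleft> (g \<cdot> f) = (x \<triangleleft> g) \<cdot> (x \<triangleleft> f)"
  by (simp add: tens_comp)

lemma rwhisker_comp [simp]:
  "\<lbrakk>x \<in> Obj M; f \<in> Arr M; g \<in> Arr M; Cod M f = Dom M g\<rbrakk> \<Longrightarrow> (g \<cdot> f) \<triangleright> x = (g \<triangleright> x) \<cdot> (f \<triangleright> x)"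
  by (simp add: tens_comp)

text \<open>As a rewrite rule this would loop, because whiskers are tensors of arrows themselves; it
  is supplied at explicit instances instead.\<close>

lemma tens_whisker:
  "\<lbrakk>f \<in> Arr M; g \<in> Arr M\<rbrakk> \<Longrightarrow> f \<otimes>\<^sub>a g = (f \<triangleright> Cod M g) \<cdot> (Dom M f \<triangleleft> g)"
  by (simp add: tens_comp)

lemma exchange [simp]:
  assumes "f \<in> Arr M" "g \<in> Arr M" "Cod M f = x" "Dom M g = y"
  shows "(x \<triangleleft> g) \<cdot> (f \<triangleright> y) = (f \<triangleright> Cod M g) \<cdot> (Dom M f \<triangleleft> g)"
  using assms by (auto simp: tens_comp)

lemmas exchange_tail [simp] = exchange[THEN comp2_tail]

text \<open>Named in order to be switched off: balancing needs an action on the right factor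
  directly behind a chosen coequalizer, and the exchange rules carry it away from there.\<close>

lemmas exch = exchange exchange_tail

text \<open>
  Consequences of an equation between composites, for its whiskered form and for an occurrence
  in front of further factors; used with \<open>THEN\<close> to obtain rewrite rules for right-nested composites.
\<close>

lemma lwhisker2:
  "\<lbrakk>g \<cdot> f = h; f \<in> Arr M; g \<in> Arr M; Cod M f = Dom M g; x \<in> Obj M\<rbrakk>
    \<Longrightarrow> (x \<triangleleft> g) \<cdot> (x \<triangleleft> f) = x \<triangleleft> h"
  using lwhisker_comp[of x f g] by simp

lemma rwhisker2:
  "\<lbrakk>g \<cdot> f = h; f \<in> Arr M; g \<in> Arr M; Cod M f = Dom M g; x \<in> Obj M\<rbrakk>
    \<Longrightarrow> (g \<triangleright> x) \<cdot> (f \<triangleright> x) = h \<triangleright> x"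
  using rwhisker_comp[of x f g] by simp

lemma lwhisker3:
  assumes "g \<cdot> (f \<cdot> k) = h" and "f \<in> Arr M" "g \<in> Arr M" "k \<in> Arr M"
    and "Cod M f = Dom M g" "Cod M k = Dom M f" "x \<in> Obj M"
  shows "(x \<triangleleft> g) \<cdot> ((x \<triangleleft> f) \<cdot> (x \<triangleleft> k)) = x \<triangleleft> h"
  using assms(2-) by (simp flip: assms(1))

lemma rwhisker3:
  assumes "g \<cdot> (f \<cdot> k) = h" and "f \<in> Arr M" "g \<in> Arr M" "k \<in> Arr M"
    and "Cod M f = Dom M g" "Cod M k = Dom M f" "x \<in> Obj M"
  shows "(g \<triangleright> x) \<cdot> ((f \<triangleright> x) \<cdot> (k \<triangleright> x)) = h \<triangleright> x"
  using assms(2-) by (simp flip: assms(1))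

lemma lwhisker2_tail:
  assumes "g \<cdot> f = h" and "f \<in> Arr M" "g \<in> Arr M" "Cod M f = Dom M g" "x \<in> Obj M"
    and "t \<in> Arr M" "Cod M t = x \<otimes>\<^sub>o Dom M f"
  shows "(x \<triangleleft> g) \<cdot> ((x \<triangleleft> f) \<cdot> t) = (x \<triangleleft> h) \<cdot> t"
  using assms(2-) by (simp flip: assms(1))

lemma rwhisker2_tail:
  assumes "g \<cdot> f = h" and "f \<in> Arr M" "g \<in> Arr M" "Cod M f = Dom M g" "x \<in> Obj M"
    and "t \<in> Arr M" "Cod M t = Dom M f \<otimes>\<^sub>o x"
  shows "(g \<triangleright> x) \<cdot> ((f \<triangleright> x) \<cdot> t) = (h \<triangleright> x) \<cdot> t"
  using assms(2-) by (simp flip: assms(1))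

lemma lwhisker3_tail:
  assumes "g \<cdot> (f \<cdot> k) = h" and "f \<in> Arr M" "g \<in> Arr M" "k \<in> Arr M"
    and "Cod M f = Dom M g" "Cod M k = Dom M f" "x \<in> Obj M"
    and "t \<in> Arr M" "Cod M t = x \<otimes>\<^sub>o Dom M k"
  shows "(x \<triangleleft> g) \<cdot> ((x \<triangleleft> f) \<cdot> ((x \<triangleleft> k) \<cdot> t)) = (x \<triangleleft> h) \<cdot> t"
  using assms(2-) by (simp flip: assms(1))

lemma rwhisker3_tail:
  assumes "g \<cdot> (f \<cdot> k) = h" and "f \<in> Arr M" "g \<in> Arr M" "k \<in> Arr M"
    and "Cod M f = Dom M g" "Cod M k = Dom M f" "x \<in> Obj M"
    and "t \<in> Arr M" "Cod M t = Dom M k \<otimes>\<^sub>o x"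
  shows "(g \<triangleright> x) \<cdot> ((f \<triangleright> x) \<cdot> ((k \<triangleright> x) \<cdot> t)) = (h \<triangleright> x) \<cdot> t"
  using assms(2-) by (simp flip: assms(1))

lemma assoc_arr [simp]:
  assumes "x \<in> Obj M" "y \<in> Obj M" "z \<in> Obj M"
  shows "\<alpha> x y z \<in> Arr M" and "Dom M (\<alpha> x y z) = x \<otimes>\<^sub>o (y \<otimes>\<^sub>o z)"
    and "Cod M (\<alpha> x y z) = (x \<otimes>\<^sub>o y) \<otimes>\<^sub>o z" and "iso M (\<alpha> x y z)"
  using Assoc_in[OF assms] Assoc_iso[OF assms] by (auto simp: Hom_def)

lemma lunit_arr [simp]:
  assumes "x \<in> Obj M"
  shows "LUnit M x \<in> Arr M" and "Dom M (LUnit M x) = I \<otimes>\<^sub>o x" and "Cod M (LUnit M x) = x"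
    and "iso M (LUnit M x)"
  using LUnit_in[OF assms] LUnit_iso[OF assms] by (auto simp: Hom_def)

lemma runit_arr [simp]:
  assumes "x \<in> Obj M"
  shows "RUnit M x \<in> Arr M" and "Dom M (RUnit M x) = x \<otimes>\<^sub>o I" and "Cod M (RUnit M x) = x"
    and "iso M (RUnit M x)"
  using RUnit_in[OF assms] RUnit_iso[OF assms] by (auto simp: Hom_def)

lemma assoc_natural:
  assumes "f \<in> Arr M" "g \<in> Arr M" "h \<in> Arr M"
  shows "\<alpha> (Cod M f) (Cod M g) (Cod M h) \<cdot> (f \<otimes>\<^sub>a (g \<otimes>\<^sub>a h))
    = ((f \<otimes>\<^sub>a g) \<otimes>\<^sub>a h) \<cdot> \<alpha> (Dom M f) (Dom M g) (Dom M h)"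
  using Assoc_natural[of f "Dom M f" "Cod M f" g "Dom M g" "Cod M g" h "Dom M h" "Cod M h"] assms
  by (simp add: Hom_def)

lemma assoc_natural3 [simp]:
  "\<lbrakk>x \<in> Obj M; y \<in> Obj M; h \<in> Arr M; Cod M h = z\<rbrakk>
    \<Longrightarrow> \<alpha> x y z \<cdot> (x \<triangleleft> y \<triangleleft> h) = ((x \<otimes>\<^sub>o y) \<triangleleft> h) \<cdot> \<alpha> x y (Dom M h)"
  using assoc_natural[of "Ident M x" "Ident M y" h] by simp

lemma assoc_natural2 [simp]:
  "\<lbrakk>x \<in> Obj M; z \<in> Obj M; h \<in> Arr M; Cod M h = y\<rbrakk>
    \<Longrightarrow> \<alpha> x y z \<cdot> (x \<triangleleft> (h \<triangleright> z)) = ((x \<triangleleft> h) \<triangleright> z) \<cdot> \<alpha> x (Dom M h) z"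
  using assoc_natural[of "Ident M x" h "Ident M z"] by simp

lemma assoc_natural1 [simp]:
  "\<lbrakk>y \<in> Obj M; z \<in> Obj M; h \<in> Arr M; Cod M h = x\<rbrakk>
    \<Longrightarrow> \<alpha> x y z \<cdot> (h \<triangleright> (y \<otimes>\<^sub>o z)) = ((h \<triangleright> y) \<triangleright> z) \<cdot> \<alpha> (Dom M h) y z"
  using assoc_natural[of h "Ident M y" "Ident M z"] by simp

lemmas assoc_natural_tail [simp] =
  assoc_natural1[THEN comp2_tail] assoc_natural2[THEN comp2_tail] assoc_natural3[THEN comp2_tail]

lemmas assoc_nat = assoc_natural1 assoc_natural2 assoc_natural3 assoc_natural_tail

lemma pentagon' [simp]:
  "\<lbrakk>x \<in> Obj M; y \<in> Obj M; z \<in> Obj M; w \<in> Obj M\<rbrakk>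
    \<Longrightarrow> (\<alpha> x y z \<triangleright> w) \<cdot> (\<alpha> x (y \<otimes>\<^sub>o z) w \<cdot> (x \<triangleleft> \<alpha> y z w))
      = \<alpha> (x \<otimes>\<^sub>o y) z w \<cdot> \<alpha> x y (z \<otimes>\<^sub>o w)"
  by (simp add: pentagon)

lemmas pentagon_tail [simp] = pentagon'[THEN comp3_tail]

lemmas pent = pentagon' pentagon_tail

lemma lunit_natural [simp]:
  "\<lbrakk>f \<in> Arr M; Cod M f = y\<rbrakk> \<Longrightarrow> LUnit M y \<cdot> (I \<triangleleft> f) = f \<cdot> LUnit M (Dom M f)"
  using LUnit_natural[of f "Dom M f" y] by (simp add: Hom_def)

lemma runit_natural [simp]:
  "\<lbrakk>f \<in> Arr M; Cod M f = y\<rbrakk> \<Longrightarrow> RUnit M y \<cdot> (f \<triangleright> I) = f \<cdot> RUnit M (Dom M f)"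
  using RUnit_natural[of f "Dom M f" y] by (simp add: Hom_def)

lemmas unit_natural_tail [simp] =
  lunit_natural[THEN comp2_tail] runit_natural[THEN comp2_tail]

lemma lwhisker_iso [simp]:
  assumes "x \<in> Obj M" and "iso M f"
  shows "iso M (x \<triangleleft> f)"
  by (rule isoI[of _ "x \<triangleleft> inv_arr f"])
    (use assms in \<open>simp_all add: iso_arr del: lwhisker_comp flip: lwhisker_comp\<close>)

lemma rwhisker_iso [simp]:
  assumes "x \<in> Obj M" and "iso M f"
  shows "iso M (f \<triangleright> x)"
  by (rule isoI[of _ "inv_arr f \<triangleright> x"])
    (use assms in \<open>simp_all add: iso_arr del: rwhisker_comp flip: rwhisker_comp\<close>)

section \<open>Coherence of the unit constraints\<close>

lemma lwhisker_unit_faithful: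
  assumes "I \<triangleleft> f = I \<triangleleft> g" and [simp]: "f \<in> Arr M" "g \<in> Arr M" "Dom M f = Dom M g" "Cod M f = Cod M g"
  shows "f = g"
proof -
  have "f \<cdot> LUnit M (Dom M g) = g \<cdot> LUnit M (Dom M g)"
    using lunit_natural[of f "Cod M f"] lunit_natural[of g "Cod M g"] assms(1) by simp
  then show ?thesis
    by (rule epiD[rotated]) simp_all
qed

lemma rwhisker_unit_faithful:
  assumes "f \<triangleright> I = g \<triangleright> I" and [simp]: "f \<in> Arr M" "g \<in> Arr M" "Dom M f = Dom M g" "Cod M f = Cod M g"
  shows "f = g"
proof -
  have "f \<cdot> RUnit M (Dom M g) = g \<cdot> RUnit M (Dom M g)"
    using runit_natural[of f "Cod M f"] runit_natural[of g "Cod M g"] assms(1) by simp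
  then show ?thesis
    by (rule epiD[rotated]) simp_all
qed

lemma triangle' [simp]:
  "\<lbrakk>x \<in> Obj M; y \<in> Obj M\<rbrakk> \<Longrightarrow> (RUnit M x \<triangleright> y) \<cdot> \<alpha> x I y = x \<triangleleft> LUnit M y"
  by (rule triangle)

lemmas triangle_whisker =
  triangle'[THEN comp2_tail] triangle'[THEN lwhisker2] triangle'[THEN rwhisker2]
  triangle'[THEN lwhisker2_tail] triangle'[THEN rwhisker2_tail]

text \<open>
  Kelly's redundant coherence conditions: whiskering with the unit is faithful, and the whiskered
  equations follow from the pentagon and the triangle.
\<close>

lemma lunit_tens [simp]:
  assumes [simp]: "x \<in> Obj M" "y \<in> Obj M"
  shows "(LUnit M x \<triangleright> y) \<cdot> \<alpha> I x y = LUnit M (x \<otimes>\<^sub>o y)"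
proof (rule lwhisker_unit_faithful)
  have "\<alpha> I x y \<cdot> (I \<triangleleft> ((LUnit M x \<triangleright> y) \<cdot> \<alpha> I x y))
      = ((I \<triangleleft> LUnit M x) \<triangleright> y) \<cdot> \<alpha> I (I \<otimes>\<^sub>o x) y \<cdot> (I \<triangleleft> \<alpha> I x y)"
    by simp
  also have "\<dots> = ((RUnit M I \<triangleright> x) \<triangleright> y) \<cdot> (\<alpha> I I x \<triangleright> y) \<cdot> \<alpha> I (I \<otimes>\<^sub>o x) y \<cdot> (I \<triangleleft> \<alpha> I x y)"
    by (simp add: triangle_whisker del: pentagon' pentagon_tail)
  also have "\<dots> = \<alpha> I x y \<cdot> (RUnit M I \<triangleright> (x \<otimes>\<^sub>o y)) \<cdot> \<alpha> I I (x \<otimes>\<^sub>o y)"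
    by (simp del: triangle')
  also have "\<dots> = \<alpha> I x y \<cdot> (I \<triangleleft> LUnit M (x \<otimes>\<^sub>o y))"
    by (simp del: assoc_natural_tail)
  finally show "I \<triangleleft> ((LUnit M x \<triangleright> y) \<cdot> \<alpha> I x y) = I \<triangleleft> LUnit M (x \<otimes>\<^sub>o y)"
    by (rule iso_monoD[rotated]) simp_all
qed simp_all

lemma runit_tens [simp]:
  assumes [simp]: "x \<in> Obj M" "y \<in> Obj M"
  shows "RUnit M (x \<otimes>\<^sub>o y) \<cdot> \<alpha> x y I = x \<triangleleft> RUnit M y"
proof (rule rwhisker_unit_faithful)
  \<comment> \<open>The appended isomorphism completes one side of the pentagon for x, y, I, I. Two
    uses of the triangle then bring both arrows to \<open>\<alpha> x y I\<close> after
    \<open>x \<triangleleft> (y \<triangleleft> LUnit M I)\<close>.\<close>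
  have "((RUnit M (x \<otimes>\<^sub>o y) \<cdot> \<alpha> x y I) \<triangleright> I) \<cdot> \<alpha> x (y \<otimes>\<^sub>o I) I \<cdot> (x \<triangleleft> \<alpha> y I I)
      = (RUnit M (x \<otimes>\<^sub>o y) \<triangleright> I) \<cdot> \<alpha> (x \<otimes>\<^sub>o y) I I \<cdot> \<alpha> x y (I \<otimes>\<^sub>o I)"
    by simp
  also have "\<dots> = \<alpha> x y I \<cdot> (x \<triangleleft> (y \<triangleleft> LUnit M I))"
    by (simp add: triangle_whisker)
  also have "\<dots> = \<alpha> x y I \<cdot> (x \<triangleleft> (RUnit M y \<triangleright> I)) \<cdot> (x \<triangleleft> \<alpha> y I I)"
    by (simp add: triangle_whisker del: assoc_natural2 assoc_natural_tail assoc_natural3)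
  also have "\<dots> = ((x \<triangleleft> RUnit M y) \<triangleright> I) \<cdot> \<alpha> x (y \<otimes>\<^sub>o I) I \<cdot> (x \<triangleleft> \<alpha> y I I)"
    by simp
  finally show "(RUnit M (x \<otimes>\<^sub>o y) \<cdot> \<alpha> x y I) \<triangleright> I = (x \<triangleleft> RUnit M y) \<triangleright> I"
    by (rule epiD[rotated]) simp_all
qed simp_all

text \<open>Naturality of the left unit constraint at \<open>LUnit M I\<close>, with that
  isomorphism cancelled, identifies \<open>LUnit M (I \<otimes>\<^sub>o I)\<close> with
  \<open>I \<triangleleft> LUnit M I\<close>. The first is
  \<open>LUnit M I \<triangleright> I\<close> after the associator, the second is
  \<open>RUnit M I \<triangleright> I\<close> after it, by the triangle.\<close>

lemma lunit_eq_runit: "LUnit M I = RUnit M I"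
proof (rule rwhisker_unit_faithful)
  have "LUnit M (I \<otimes>\<^sub>o I) = I \<triangleleft> LUnit M I"
    by (rule iso_monoD[of "LUnit M I"]) simp_all
  then have "(LUnit M I \<triangleright> I) \<cdot> \<alpha> I I I = (RUnit M I \<triangleright> I) \<cdot> \<alpha> I I I"
    by simp
  then show "LUnit M I \<triangleright> I = RUnit M I \<triangleright> I"
    by (rule epiD[rotated]) simp_all
qed simp_all


section \<open>The tensor product of bimodules\<close>

context
  fixes m :: "('o, 'a) mon"
begin

lemma bimodule_arr [simp]:
  assumes "bimodule M m x"
  shows "carr x \<in> Obj M"
    and "lact x \<in> Arr M" and "Dom M (lact x) = mobj m \<otimes>\<^sub>o carr x" and "Cod M (lact x) = carr x"
    and "ract x \<in> Arr M" and "Dom M (ract x) = carr x \<otimes>\<^sub>o mobj m" and "Cod M (ract x) = carr x"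
  using assms by (auto simp: bimodule_def Hom_def)

lemma lact_unit: "bimodule M m x \<Longrightarrow> lact x \<cdot> (unt m \<triangleright> carr x) = LUnit M (carr x)"
  and ract_unit: "bimodule M m x \<Longrightarrow> ract x \<cdot> (carr x \<triangleleft> unt m) = RUnit M (carr x)"
  and lact_lact: "bimodule M m x \<Longrightarrow> lact x \<cdot> (mobj m \<triangleleft> lact x)
    = lact x \<cdot> (mult m \<triangleright> carr x) \<cdot> \<alpha> (mobj m) (mobj m) (carr x)"
  and ract_mult: "bimodule M m x \<Longrightarrow> ract x \<cdot> (carr x \<triangleleft> mult m)
    = ract x \<cdot> (ract x \<triangleright> mobj m) \<cdot> \<alpha> (carr x) (mobj m) (mobj m)"
  and lact_ract: "bimodule M m x \<Longrightarrow> lact x \<cdot> (mobj m \<triangleleft> ract x)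
    = ract x \<cdot> (lact x \<triangleright> mobj m) \<cdot> \<alpha> (mobj m) (carr x) (mobj m)"
  by (simp_all add: bimodule_def)

lemma bimodule_hom_arr:
  assumes "bimodule_hom M m x f y"
  shows "f \<in> Arr M" and "Dom M f = carr x" and "Cod M f = carr y"
  using assms by (auto simp: bimodule_hom_def Hom_def)

lemma bimodule_hom_act:
  assumes "bimodule_hom M m x f y"
  shows "f \<cdot> lact x = lact y \<cdot> (mobj m \<triangleleft> f)" and "f \<cdot> ract x = ract y \<cdot> (f \<triangleright> mobj m)"
  using assms by (auto simp: bimodule_hom_def)

lemma bimodule_hom_comp:
  assumes f: "bimodule_hom M m x f y" and g: "bimodule_hom M m y g z" and [simp]: "mobj m \<in> Obj M"
  shows "bimodule_hom M m x (g \<cdot> f) z"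
proof -
  have xyz [simp]: "bimodule M m x" "bimodule M m y" "bimodule M m z"
    using f g by (auto simp: bimodule_hom_def)
  show ?thesis
    using bimodule_hom_act[OF f] bimodule_hom_act[OF g] bimodule_hom_arr[OF f] bimodule_hom_arr[OF g]
      bimodule_hom_act[OF g, THEN comp2_tail]
    unfolding bimodule_hom_def[of _ _ x _ z] by (simp add: Hom_def)
qed

lemma bimodule_hom_ident:
  "\<lbrakk>bimodule M m x; mobj m \<in> Obj M\<rbrakk> \<Longrightarrow> bimodule_hom M m x (Ident M (carr x)) x"
  by (simp add: bimodule_hom_def Hom_def)

text \<open>Inserting \<open>f \<cdot> g\<close> next to an action of \<open>y\<close> lets the
  linearity of \<open>f\<close> carry that action over to \<open>x\<close>, where
  \<open>g \<cdot> f\<close> cancels. Isomorphisms of bimodules can therefore be recognised in the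
  base category.\<close>

lemma bimodule_hom_inverse:
  assumes f: "bimodule_hom M m x f y" and [simp]: "g \<in> Arr M" "Dom M g = carr y" "Cod M g = carr x"
    and gf: "g \<cdot> f = Ident M (carr x)" and fg: "f \<cdot> g = Ident M (carr y)"
    and [simp]: "mobj m \<in> Obj M"
  shows "bimodule_hom M m y g x"
proof -
  have xy [simp]: "bimodule M m x" "bimodule M m y"
    using f by (auto simp: bimodule_hom_def)
  note [simp] = bimodule_hom_arr[OF f]
  have "g \<cdot> lact y = g \<cdot> lact y \<cdot> (mobj m \<triangleleft> (f \<cdot> g))"
    by (simp add: fg del: lwhisker_comp)
  also have "\<dots> = g \<cdot> (f \<cdot> lact x) \<cdot> (mobj m \<triangleleft> g)"
    by (simp add: bimodule_hom_act[OF f])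
  also have "\<dots> = lact x \<cdot> (mobj m \<triangleleft> g)"
    by (simp add: gf[THEN comp2_tail])
  finally have l: "g \<cdot> lact y = lact x \<cdot> (mobj m \<triangleleft> g)" .
  have "g \<cdot> ract y = g \<cdot> ract y \<cdot> ((f \<cdot> g) \<triangleright> mobj m)"
    by (simp add: fg del: rwhisker_comp)
  also have "\<dots> = g \<cdot> (f \<cdot> ract x) \<cdot> (g \<triangleright> mobj m)"
    by (simp add: bimodule_hom_act[OF f])
  also have "\<dots> = ract x \<cdot> (g \<triangleright> mobj m)"
    by (simp add: gf[THEN comp2_tail])
  finally show ?thesis
    using l by (simp add: bimodule_hom_def Hom_def)
qed

end

end


text \<open>The monoid \<open>m\<close> is a parameter while \<open>q\<close> chooses coequalizers
  for all monoids at once; the locale is later used at two monoids, with the same choice.\<close>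

locale bimodules = monoidal_category M for M :: "('o, 'a) moncat" (structure) +
  fixes q :: "('o, 'a) mon \<Rightarrow> ('o, 'a) bimod \<Rightarrow> ('o, 'a) bimod \<Rightarrow> 'a"
    and m :: "('o, 'a) mon"
  assumes preserve: "tensor_preserves_coequalizers M"
    and choice: "coequalizer_choice M q"
    and monoid: "monoid_in M m"
begin

abbreviation A :: 'o where "A \<equiv> mobj m"
abbreviation \<mu> :: 'a where "\<mu> \<equiv> mult m"
abbreviation \<eta> :: 'a where "\<eta> \<equiv> unt m"
abbreviation Q :: "('o, 'a) bimod \<Rightarrow> ('o, 'a) bimod \<Rightarrow> 'a" where "Q \<equiv> q m"
abbreviation bim :: "('o, 'a) bimod \<Rightarrow> bool" where "bim \<equiv> bimodule M m"
abbreviation T :: "('o, 'a) bimod \<Rightarrow> ('o, 'a) bimod \<Rightarrow> ('o, 'a) bimod" where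
  "T \<equiv> bimod_tensO M q m"

lemma monoid_arr [simp]:
  "A \<in> Obj M"
  "\<mu> \<in> Arr M" "Dom M \<mu> = A \<otimes>\<^sub>o A" "Cod M \<mu> = A"
  "\<eta> \<in> Arr M" "Dom M \<eta> = I" "Cod M \<eta> = A"
  using monoid by (auto simp: monoid_in_def Hom_def)

lemma bimodule_regular [simp]: "bim (regular m)"
  using monoid by (auto simp: monoid_in_def bimodule_def regular_def)

lemma regular_simps [simp]:
  "carr (regular m) = A" "lact (regular m) = \<mu>" "ract (regular m) = \<mu>"
  by (simp_all add: regular_def)

declare bimodule_arr[of m, simp]

lemmas lact_unit_rules [simp] =
  lact_unit[of m] lact_unit[of m, THEN comp2_tail]
  lact_unit[of m, THEN lwhisker2] lact_unit[of m, THEN lwhisker2_tail]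
  lact_unit[of m, THEN rwhisker2] lact_unit[of m, THEN rwhisker2_tail]

lemmas ract_unit_rules [simp] =
  ract_unit[of m] ract_unit[of m, THEN comp2_tail]
  ract_unit[of m, THEN lwhisker2] ract_unit[of m, THEN lwhisker2_tail]
  ract_unit[of m, THEN rwhisker2] ract_unit[of m, THEN rwhisker2_tail]

lemmas lact_lact_rules [simp] =
  lact_lact[of m] lact_lact[of m, THEN comp2_tail]
  lact_lact[of m, THEN lwhisker2] lact_lact[of m, THEN lwhisker2_tail]
  lact_lact[of m, THEN rwhisker2] lact_lact[of m, THEN rwhisker2_tail]

lemmas ract_mult_rules [simp] =
  ract_mult[of m] ract_mult[of m, THEN comp2_tail]
  ract_mult[of m, THEN lwhisker2] ract_mult[of m, THEN lwhisker2_tail]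
  ract_mult[of m, THEN rwhisker2] ract_mult[of m, THEN rwhisker2_tail]

lemmas lact_ract_rules [simp] =
  lact_ract[of m] lact_ract[of m, THEN comp2_tail]
  lact_ract[of m, THEN lwhisker2] lact_ract[of m, THEN lwhisker2_tail]
  lact_ract[of m, THEN rwhisker2] lact_ract[of m, THEN rwhisker2_tail]

section \<open>Chosen coequalizers and descent along them\<close>

lemma Q_coequalizer:
  "\<lbrakk>bim x; bim y\<rbrakk> \<Longrightarrow> coequalizer M (carr x \<triangleleft> lact y)
    ((ract x \<triangleright> carr y) \<cdot> \<alpha> (carr x) A (carr y)) (Q x y)"
  using choice monoid unfolding coequalizer_choice_def by blast

lemma carr_T: "carr (T x y) = Cod M (Q x y)"
  by (simp add: bimod_tensO_def Let_def)

lemma Q_arr [simp]: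
  assumes "bim x" "bim y"
  shows "Q x y \<in> Arr M" and "Dom M (Q x y) = carr x \<otimes>\<^sub>o carr y" and "Cod M (Q x y) = carr (T x y)"
    and "carr (T x y) \<in> Obj M"
  using coequalizer_arr[OF Q_coequalizer[OF assms]] assms by (auto simp: carr_T)

lemma Q_balanced:
  assumes "bim x" "bim y"
  shows "Q x y \<cdot> (carr x \<triangleleft> lact y) = Q x y \<cdot> (ract x \<triangleright> carr y) \<cdot> \<alpha> (carr x) A (carr y)"
  using coequalizer_arr[OF Q_coequalizer[OF assms]] by simp

lemmas Q_bal =
  Q_balanced Q_balanced[THEN comp2_tail]
  Q_balanced[THEN lwhisker2] Q_balanced[THEN lwhisker2_tail]
  Q_balanced[THEN rwhisker2] Q_balanced[THEN rwhisker2_tail]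

lemma lwhisker_coequalizer:
  "\<lbrakk>coequalizer M f g p; z \<in> Obj M\<rbrakk> \<Longrightarrow> coequalizer M (z \<triangleleft> f) (z \<triangleleft> g) (z \<triangleleft> p)"
  and rwhisker_coequalizer:
  "\<lbrakk>coequalizer M f g p; z \<in> Obj M\<rbrakk> \<Longrightarrow> coequalizer M (f \<triangleright> z) (g \<triangleright> z) (p \<triangleright> z)"
  using preserve unfolding tensor_preserves_coequalizers_def by blast+

text \<open>Preservation of coequalizers makes every whiskered chosen coequalizer a coequalizer,
  hence epi. Two nested whiskers cover the action laws and the threefold and fourfold tensor
  products.\<close>

lemma Q_epi [simp]:
  assumes "bim x" "bim y"
  shows "epi (Q x y)"
    and "z \<in> Obj M \<Longrightarrow> epi (z \<triangleleft> Q x y)"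
    and "z \<in> Obj M \<Longrightarrow> epi (Q x y \<triangleright> z)"
    and "\<lbrakk>z \<in> Obj M; w \<in> Obj M\<rbrakk> \<Longrightarrow> epi (z \<triangleleft> (w \<triangleleft> Q x y))"
    and "\<lbrakk>z \<in> Obj M; w \<in> Obj M\<rbrakk> \<Longrightarrow> epi (z \<triangleleft> (Q x y \<triangleright> w))"
    and "\<lbrakk>z \<in> Obj M; w \<in> Obj M\<rbrakk> \<Longrightarrow> epi ((z \<triangleleft> Q x y) \<triangleright> w)"
    and "\<lbrakk>z \<in> Obj M; w \<in> Obj M\<rbrakk> \<Longrightarrow> epi ((Q x y \<triangleright> z) \<triangleright> w)"
  using Q_coequalizer[OF assms]
  by (blast intro: coequalizer_epi lwhisker_coequalizer rwhisker_coequalizer)+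

lemma Q_desc:
  assumes [simp]: "bim x" "bim y" "h \<in> Arr M" "Dom M h = carr x \<otimes>\<^sub>o carr y" "Cod M h = t"
    and "h \<cdot> (carr x \<triangleleft> lact y) = h \<cdot> (ract x \<triangleright> carr y) \<cdot> \<alpha> (carr x) A (carr y)"
  shows "\<exists>!k. k \<in> Hom M (carr (T x y)) t \<and> k \<cdot> Q x y = h"
  by (rule coequalizer_ex1[OF Q_coequalizer]) (use assms(6) in simp_all)

lemma lwhisker_Q_desc:
  assumes [simp]: "bim x" "bim y" "z \<in> Obj M"
    "h \<in> Arr M" "Dom M h = z \<otimes>\<^sub>o (carr x \<otimes>\<^sub>o carr y)" "Cod M h = t"
    and "h \<cdot> (z \<triangleleft> (carr x \<triangleleft> lact y)) = h \<cdot> (z \<triangleleft> ((ract x \<triangleright> carr y) \<cdot> \<alpha> (carr x) A (carr y)))"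
  shows "\<exists>!k. k \<in> Hom M (z \<otimes>\<^sub>o carr (T x y)) t \<and> k \<cdot> (z \<triangleleft> Q x y) = h"
  by (rule coequalizer_ex1[OF lwhisker_coequalizer[OF Q_coequalizer]]) (use assms(7) in simp_all)

lemma rwhisker_Q_desc:
  assumes [simp]: "bim x" "bim y" "z \<in> Obj M"
    "h \<in> Arr M" "Dom M h = (carr x \<otimes>\<^sub>o carr y) \<otimes>\<^sub>o z" "Cod M h = t"
    and "h \<cdot> ((carr x \<triangleleft> lact y) \<triangleright> z) = h \<cdot> (((ract x \<triangleright> carr y) \<cdot> \<alpha> (carr x) A (carr y)) \<triangleright> z)"
  shows "\<exists>!k. k \<in> Hom M (carr (T x y) \<otimes>\<^sub>o z) t \<and> k \<cdot> (Q x y \<triangleright> z) = h"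
  by (rule coequalizer_ex1[OF rwhisker_coequalizer[OF Q_coequalizer]]) (use assms(7) in simp_all)

text \<open>The left action on \<open>x\<close> commutes with its right action by the bimodule law,
  and with the action on \<open>y\<close> by exchange; so acting on \<open>x\<close> from the left
  keeps \<open>Q x y\<close> balanced.\<close>

lemma lact_T_ex1:
  assumes [simp]: "bim x" "bim y"
  shows "\<exists>!l. l \<in> Hom M (A \<otimes>\<^sub>o carr (T x y)) (carr (T x y)) \<and>
    l \<cdot> (A \<triangleleft> Q x y) = Q x y \<cdot> (lact x \<triangleright> carr y) \<cdot> \<alpha> A (carr x) (carr y)"
proof (rule lwhisker_Q_desc)
  have "(Q x y \<cdot> (lact x \<triangleright> carr y) \<cdot> \<alpha> A (carr x) (carr y)) \<cdot> (A \<triangleleft> (carr x \<triangleleft> lact y))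
    = Q x y \<cdot> (carr x \<triangleleft> lact y) \<cdot> (lact x \<triangleright> (A \<otimes>\<^sub>o carr y)) \<cdot> \<alpha> A (carr x) (A \<otimes>\<^sub>o carr y)"
    by simp
  \<comment> \<open>Without the exchange rules \<open>lact y\<close> stays directly behind
    \<open>Q x y\<close>, where balancing applies.\<close>
  also have "\<dots> = Q x y \<cdot> (ract x \<triangleright> carr y) \<cdot> \<alpha> (carr x) A (carr y) \<cdot>
      (lact x \<triangleright> (A \<otimes>\<^sub>o carr y)) \<cdot> \<alpha> A (carr x) (A \<otimes>\<^sub>o carr y)"
    by (simp add: Q_bal del: exch)
  also have "\<dots> = (Q x y \<cdot> (lact x \<triangleright> carr y) \<cdot> \<alpha> A (carr x) (carr y)) \<cdot>
      (A \<triangleleft> ((ract x \<triangleright> carr y) \<cdot> \<alpha> (carr x) A (carr y)))"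
    by simp
  finally show "(Q x y \<cdot> (lact x \<triangleright> carr y) \<cdot> \<alpha> A (carr x) (carr y)) \<cdot> (A \<triangleleft> (carr x \<triangleleft> lact y))
    = (Q x y \<cdot> (lact x \<triangleright> carr y) \<cdot> \<alpha> A (carr x) (carr y)) \<cdot>
      (A \<triangleleft> ((ract x \<triangleright> carr y) \<cdot> \<alpha> (carr x) A (carr y)))" .
qed simp_all

text \<open>The arrow \<open>Q x y \<triangleright> A\<close> starts at the left bracketing, while
  the right action on \<open>y\<close> lives on the right one. The inverse associator mediates, so
  that the universal property can be applied to \<open>Q x y \<triangleright> A\<close>
  itself.\<close>

lemma ract_T_ex1:
  assumes [simp]: "bim x" "bim y"
  shows "\<exists>!r. r \<in> Hom M (carr (T x y) \<otimes>\<^sub>o A) (carr (T x y)) \<and>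
    r \<cdot> (Q x y \<triangleright> A) = Q x y \<cdot> (carr x \<triangleleft> ract y) \<cdot> inv_arr (\<alpha> (carr x) (carr y) A)"
    (is "\<exists>!r. _ \<and> _ = ?h")
proof (rule rwhisker_Q_desc)
  have h: "?h \<cdot> \<alpha> (carr x) (carr y) A = Q x y \<cdot> (carr x \<triangleleft> ract y)"
    by simp
  \<comment> \<open>Keeping \<open>h\<close> opaque prevents the inverse associator from being
    pushed around; only the equation for \<open>h\<close> after the associator is used.\<close>
  obtain h where h_def: "h = ?h" by blast
  have [simp]: "h \<in> Arr M" "Dom M h = (carr x \<otimes>\<^sub>o carr y) \<otimes>\<^sub>o A" "Cod M h = carr (T x y)"
    by (simp_all add: h_def)
  note h' = h[folded h_def] h[folded h_def, THEN comp2_tail]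
  \<comment> \<open>The appended associators form an isomorphism out of the fully right-bracketed
    product. They make \<open>h\<close> meet an associator, and are cancelled at the end.\<close>
  have "(h \<cdot> ((carr x \<triangleleft> lact y) \<triangleright> A)) \<cdot> \<alpha> (carr x) (A \<otimes>\<^sub>o carr y) A \<cdot> (carr x \<triangleleft> \<alpha> A (carr y) A)
     = h \<cdot> \<alpha> (carr x) (carr y) A \<cdot> (carr x \<triangleleft> (lact y \<triangleright> A)) \<cdot> (carr x \<triangleleft> \<alpha> A (carr y) A)"
    by simp
  also have "\<dots> = Q x y \<cdot> (carr x \<triangleleft> (ract y \<cdot> (lact y \<triangleright> A) \<cdot> \<alpha> A (carr y) A))"
    by (simp add: h' del: assoc_natural_tail)
  also have "\<dots> = Q x y \<cdot> (carr x \<triangleleft> lact y) \<cdot> (carr x \<triangleleft> (A \<triangleleft> ract y))"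
    by simp
  also have "\<dots> = Q x y \<cdot> (ract x \<triangleright> carr y) \<cdot> \<alpha> (carr x) A (carr y) \<cdot> (carr x \<triangleleft> (A \<triangleleft> ract y))"
    by (simp add: Q_bal del: exch lact_ract_rules assoc_natural3 assoc_natural_tail)
  also have "\<dots> = Q x y \<cdot> (carr x \<triangleleft> ract y) \<cdot> (ract x \<triangleright> (carr y \<otimes>\<^sub>o A)) \<cdot>
      \<alpha> (carr x) A (carr y \<otimes>\<^sub>o A)"
    by simp
  also have "\<dots> = h \<cdot> \<alpha> (carr x) (carr y) A \<cdot> (ract x \<triangleright> (carr y \<otimes>\<^sub>o A)) \<cdot>
      \<alpha> (carr x) A (carr y \<otimes>\<^sub>o A)"
    by (simp add: h' del: exch assoc_natural_tail)
  also have "\<dots> = (h \<cdot> (((ract x \<triangleright> carr y) \<cdot> \<alpha> (carr x) A (carr y)) \<triangleright> A)) \<cdot>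
      \<alpha> (carr x) (A \<otimes>\<^sub>o carr y) A \<cdot> (carr x \<triangleleft> \<alpha> A (carr y) A)"
    by simp
  finally have "h \<cdot> ((carr x \<triangleleft> lact y) \<triangleright> A) = h \<cdot> (((ract x \<triangleright> carr y) \<cdot> \<alpha> (carr x) A (carr y)) \<triangleright> A)"
    by (rule epiD[rotated]) simp_all
  then show "?h \<cdot> ((carr x \<triangleleft> lact y) \<triangleright> A) = ?h \<cdot> (((ract x \<triangleright> carr y) \<cdot> \<alpha> (carr x) A (carr y)) \<triangleright> A)"
    by (simp only: h_def)
qed simp_all

lemma lact_T_eq: "lact (T x y) = (THE l. l \<in> Hom M (A \<otimes>\<^sub>o carr (T x y)) (carr (T x y)) \<and>
    l \<cdot> (A \<triangleleft> Q x y) = Q x y \<cdot> (lact x \<triangleright> carr y) \<cdot> \<alpha> A (carr x) (carr y))"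
  and ract_T_eq: "ract (T x y) = (THE r. r \<in> Hom M (carr (T x y) \<otimes>\<^sub>o A) (carr (T x y)) \<and>
    r \<cdot> (Q x y \<triangleright> A) \<cdot> \<alpha> (carr x) (carr y) A = Q x y \<cdot> (carr x \<triangleleft> ract y))"
  by (simp_all add: bimod_tensO_def Let_def)

lemma T_lact:
  assumes [simp]: "bim x" "bim y"
  shows "lact (T x y) \<in> Arr M" and "Dom M (lact (T x y)) = A \<otimes>\<^sub>o carr (T x y)"
    and "Cod M (lact (T x y)) = carr (T x y)"
    and "lact (T x y) \<cdot> (A \<triangleleft> Q x y) = Q x y \<cdot> (lact x \<triangleright> carr y) \<cdot> \<alpha> A (carr x) (carr y)"
proof -
  have "lact (T x y) \<in> Hom M (A \<otimes>\<^sub>o carr (T x y)) (carr (T x y)) \<and>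
    lact (T x y) \<cdot> (A \<triangleleft> Q x y) = Q x y \<cdot> (lact x \<triangleright> carr y) \<cdot> \<alpha> A (carr x) (carr y)"
    unfolding lact_T_eq by (rule theI'[OF lact_T_ex1[OF assms]])
  then show "lact (T x y) \<in> Arr M" and "Dom M (lact (T x y)) = A \<otimes>\<^sub>o carr (T x y)"
    and "Cod M (lact (T x y)) = carr (T x y)"
    and "lact (T x y) \<cdot> (A \<triangleleft> Q x y) = Q x y \<cdot> (lact x \<triangleright> carr y) \<cdot> \<alpha> A (carr x) (carr y)"
    by (auto simp: Hom_def)
qed

lemma T_ract:
  assumes [simp]: "bim x" "bim y"
  shows "ract (T x y) \<in> Arr M" and "Dom M (ract (T x y)) = carr (T x y) \<otimes>\<^sub>o A"
    and "Cod M (ract (T x y)) = carr (T x y)"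
    and "ract (T x y) \<cdot> (Q x y \<triangleright> A) \<cdot> \<alpha> (carr x) (carr y) A = Q x y \<cdot> (carr x \<triangleleft> ract y)"
proof -
  \<comment> \<open>Cancelling the associator identifies the equation in the definition of the right
    action with the one just solved, so the two descriptions denote the same arrow.\<close>
  have *: "r \<cdot> (Q x y \<triangleright> A) \<cdot> \<alpha> (carr x) (carr y) A = Q x y \<cdot> (carr x \<triangleleft> ract y) \<longleftrightarrow>
      r \<cdot> (Q x y \<triangleright> A) = Q x y \<cdot> (carr x \<triangleleft> ract y) \<cdot> inv_arr (\<alpha> (carr x) (carr y) A)"
    (is "?P \<longleftrightarrow> ?Q") if "r \<in> Hom M (carr (T x y) \<otimes>\<^sub>o A) (carr (T x y))" for r
  proof -
    note [simp] = arrI[OF that]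
    have "?P \<longleftrightarrow> (r \<cdot> (Q x y \<triangleright> A)) \<cdot> \<alpha> (carr x) (carr y) A
        = (Q x y \<cdot> (carr x \<triangleleft> ract y) \<cdot> inv_arr (\<alpha> (carr x) (carr y) A)) \<cdot> \<alpha> (carr x) (carr y) A"
      by simp
    also have "\<dots> \<longleftrightarrow> ?Q"
      by (rule iffI, rule epiD[of "\<alpha> (carr x) (carr y) A"], simp_all del: comp_assoc)
    finally show ?thesis .
  qed
  have "ract (T x y) = (THE r. r \<in> Hom M (carr (T x y) \<otimes>\<^sub>o A) (carr (T x y)) \<and>
      r \<cdot> (Q x y \<triangleright> A) \<cdot> \<alpha> (carr x) (carr y) A = Q x y \<cdot> (carr x \<triangleleft> ract y))"
    by (rule ract_T_eq)
  also have "\<dots> = (THE r. r \<in> Hom M (carr (T x y) \<otimes>\<^sub>o A) (carr (T x y)) \<and>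
      r \<cdot> (Q x y \<triangleright> A) = Q x y \<cdot> (carr x \<triangleleft> ract y) \<cdot> inv_arr (\<alpha> (carr x) (carr y) A))"
    by (intro arg_cong[where f = The] ext conj_cong refl *)
  finally have "ract (T x y) \<in> Hom M (carr (T x y) \<otimes>\<^sub>o A) (carr (T x y)) \<and>
      ract (T x y) \<cdot> (Q x y \<triangleright> A) \<cdot> \<alpha> (carr x) (carr y) A = Q x y \<cdot> (carr x \<triangleleft> ract y)"
    using theI'[OF ract_T_ex1[OF assms]] * by simp
  then show "ract (T x y) \<in> Arr M" and "Dom M (ract (T x y)) = carr (T x y) \<otimes>\<^sub>o A"
    and "Cod M (ract (T x y)) = carr (T x y)"
    and "ract (T x y) \<cdot> (Q x y \<triangleright> A) \<cdot> \<alpha> (carr x) (carr y) A = Q x y \<cdot> (carr x \<triangleleft> ract y)"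
    by (auto simp: Hom_def)
qed

section \<open>Bimodule laws for the tensor product\<close>

lemmas T_lact_rules =
  T_lact(4) T_lact(4)[THEN comp2_tail]
  T_lact(4)[THEN lwhisker2] T_lact(4)[THEN lwhisker2_tail]
  T_lact(4)[THEN rwhisker2] T_lact(4)[THEN rwhisker2_tail]

lemmas T_ract_rules =
  T_ract(4) T_ract(4)[THEN comp3_tail]
  T_ract(4)[THEN lwhisker3] T_ract(4)[THEN lwhisker3_tail]
  T_ract(4)[THEN rwhisker3] T_ract(4)[THEN rwhisker3_tail]

text \<open>On \<open>I \<triangleleft> Q x y\<close> the law becomes the unit law of
  \<open>x\<close>, by the coherence law that expresses the left unit constraint of a product
  through that of its left factor.\<close>

lemma T_lact_unit:
  assumes [simp]: "bim x" "bim y"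
  shows "lact (T x y) \<cdot> (\<eta> \<triangleright> carr (T x y)) = LUnit M (carr (T x y))"
proof -
  note [simp] = T_lact(1-3)
  have "(lact (T x y) \<cdot> (\<eta> \<triangleright> carr (T x y))) \<cdot> (I \<triangleleft> Q x y)
      = lact (T x y) \<cdot> (A \<triangleleft> Q x y) \<cdot> (\<eta> \<triangleright> (carr x \<otimes>\<^sub>o carr y))"
    by simp
  also have "\<dots> = Q x y \<cdot> (lact x \<triangleright> carr y) \<cdot> \<alpha> A (carr x) (carr y) \<cdot> (\<eta> \<triangleright> (carr x \<otimes>\<^sub>o carr y))"
    by (simp add: T_lact_rules del: exch assoc_nat)
  also have "\<dots> = LUnit M (carr (T x y)) \<cdot> (I \<triangleleft> Q x y)"
    by simp
  finally show ?thesis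
    by (rule epiD[rotated]) simp_all
qed

text \<open>The test arrow includes an associator because the equation for the right action does.
  What remains is the unit law of \<open>y\<close> and the coherence of the right unit constraint
  with the associator.\<close>

lemma T_ract_unit:
  assumes [simp]: "bim x" "bim y"
  shows "ract (T x y) \<cdot> (carr (T x y) \<triangleleft> \<eta>) = RUnit M (carr (T x y))"
proof -
  note [simp] = T_ract(1-3)
  have "(ract (T x y) \<cdot> (carr (T x y) \<triangleleft> \<eta>)) \<cdot> (Q x y \<triangleright> I) \<cdot> \<alpha> (carr x) (carr y) I
      = ract (T x y) \<cdot> (Q x y \<triangleright> A) \<cdot> \<alpha> (carr x) (carr y) A \<cdot> (carr x \<triangleleft> (carr y \<triangleleft> \<eta>))"
    by simp
  also have "\<dots> = Q x y \<cdot> (carr x \<triangleleft> ract y) \<cdot> (carr x \<triangleleft> (carr y \<triangleleft> \<eta>))"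
    by (simp add: T_ract_rules del: exch assoc_nat ract_unit_rules)
  also have "\<dots> = RUnit M (carr (T x y)) \<cdot> (Q x y \<triangleright> I) \<cdot> \<alpha> (carr x) (carr y) I"
    by simp
  finally show ?thesis
    by (rule epiD[rotated]) simp_all
qed

lemma T_lact_lact:
  assumes [simp]: "bim x" "bim y"
  shows "lact (T x y) \<cdot> (\<mu> \<triangleright> carr (T x y)) \<cdot> \<alpha> A A (carr (T x y)) = lact (T x y) \<cdot> (A \<triangleleft> lact (T x y))"
proof -
  note [simp] = T_lact(1-3)
  have "(lact (T x y) \<cdot> (\<mu> \<triangleright> carr (T x y)) \<cdot> \<alpha> A A (carr (T x y))) \<cdot> (A \<triangleleft> (A \<triangleleft> Q x y))
      = lact (T x y) \<cdot> (A \<triangleleft> Q x y) \<cdot> (\<mu> \<triangleright> (carr x \<otimes>\<^sub>o carr y)) \<cdot> \<alpha> A A (carr x \<otimes>\<^sub>o carr y)"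
    by simp
  also have "\<dots> = Q x y \<cdot> (lact x \<triangleright> carr y) \<cdot> \<alpha> A (carr x) (carr y) \<cdot> (\<mu> \<triangleright> (carr x \<otimes>\<^sub>o carr y)) \<cdot>
      \<alpha> A A (carr x \<otimes>\<^sub>o carr y)"
    by (simp add: T_lact_rules del: exch assoc_nat)
  also have "\<dots> = (lact (T x y) \<cdot> (A \<triangleleft> lact (T x y))) \<cdot> (A \<triangleleft> (A \<triangleleft> Q x y))"
    by (simp add: T_lact_rules)
  finally show ?thesis
    by (rule epiD[rotated]) simp_all
qed

lemma T_ract_mult:
  assumes [simp]: "bim x" "bim y"
  shows "ract (T x y) \<cdot> (ract (T x y) \<triangleright> A) \<cdot> \<alpha> (carr (T x y)) A A = ract (T x y) \<cdot> (carr (T x y) \<triangleleft> \<mu>)"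
proof -
  note [simp] = T_ract(1-3)
  let ?X = "carr x" and ?Y = "carr y" and ?r = "ract (T x y)"
  \<comment> \<open>Read backwards, the pentagon supplies the factor
    \<open>\<alpha> ?X ?Y A \<triangleright> A\<close> that the inner right action needs in order to
    pass through \<open>Q x y\<close>.\<close>
  have "(?r \<cdot> (?r \<triangleright> A) \<cdot> \<alpha> (carr (T x y)) A A) \<cdot> (Q x y \<triangleright> (A \<otimes>\<^sub>o A)) \<cdot> \<alpha> ?X ?Y (A \<otimes>\<^sub>o A)
     = ?r \<cdot> (?r \<triangleright> A) \<cdot> ((Q x y \<triangleright> A) \<triangleright> A) \<cdot> (\<alpha> ?X ?Y A \<triangleright> A) \<cdot> \<alpha> ?X (?Y \<otimes>\<^sub>o A) A \<cdot> (?X \<triangleleft> \<alpha> ?Y A A)"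
    by simp
  also have "\<dots> = ?r \<cdot> (Q x y \<triangleright> A) \<cdot> ((?X \<triangleleft> ract y) \<triangleright> A) \<cdot> \<alpha> ?X (?Y \<otimes>\<^sub>o A) A \<cdot> (?X \<triangleleft> \<alpha> ?Y A A)"
    by (simp add: T_ract_rules del: pentagon' pentagon_tail)
  also have "\<dots> = ?r \<cdot> (Q x y \<triangleright> A) \<cdot> \<alpha> ?X ?Y A \<cdot> (?X \<triangleleft> (ract y \<triangleright> A)) \<cdot> (?X \<triangleleft> \<alpha> ?Y A A)"
    by simp
  also have "\<dots> = Q x y \<cdot> (?X \<triangleleft> ract y) \<cdot> (?X \<triangleleft> (?Y \<triangleleft> \<mu>))"
    by (simp add: T_ract_rules del: assoc_nat)
  also have "\<dots> = ?r \<cdot> (Q x y \<triangleright> A) \<cdot> \<alpha> ?X ?Y A \<cdot> (?X \<triangleleft> (?Y \<triangleleft> \<mu>))"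
    by (simp add: T_ract_rules del: assoc_nat)
  also have "\<dots> = (?r \<cdot> (carr (T x y) \<triangleleft> \<mu>)) \<cdot> (Q x y \<triangleright> (A \<otimes>\<^sub>o A)) \<cdot> \<alpha> ?X ?Y (A \<otimes>\<^sub>o A)"
    by simp
  finally show ?thesis
    by (rule epiD[rotated]) simp_all
qed

text \<open>The left action touches only \<open>x\<close> and the right action only
  \<open>y\<close>, so after testing on the coequalizer the law is exchange together with the
  pentagon.\<close>

lemma T_lact_ract:
  assumes [simp]: "bim x" "bim y"
  shows "ract (T x y) \<cdot> (lact (T x y) \<triangleright> A) \<cdot> \<alpha> A (carr (T x y)) A = lact (T x y) \<cdot> (A \<triangleleft> ract (T x y))"
proof -
  note [simp] = T_ract(1-3) T_lact(1-3)
  let ?X = "carr x" and ?Y = "carr y" and ?r = "ract (T x y)" and ?l = "lact (T x y)"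
  have "(?r \<cdot> (?l \<triangleright> A) \<cdot> \<alpha> A (carr (T x y)) A) \<cdot> (A \<triangleleft> (Q x y \<triangleright> A)) \<cdot> (A \<triangleleft> \<alpha> ?X ?Y A)
     = ?r \<cdot> (Q x y \<triangleright> A) \<cdot> ((lact x \<triangleright> ?Y) \<triangleright> A) \<cdot> \<alpha> (A \<otimes>\<^sub>o ?X) ?Y A \<cdot> \<alpha> A ?X (?Y \<otimes>\<^sub>o A)"
    by (simp add: T_lact_rules)
  also have "\<dots> = ?r \<cdot> (Q x y \<triangleright> A) \<cdot> \<alpha> ?X ?Y A \<cdot> (lact x \<triangleright> (?Y \<otimes>\<^sub>o A)) \<cdot> \<alpha> A ?X (?Y \<otimes>\<^sub>o A)"
    by simp
  also have "\<dots> = Q x y \<cdot> (?X \<triangleleft> ract y) \<cdot> (lact x \<triangleright> (?Y \<otimes>\<^sub>o A)) \<cdot> \<alpha> A ?X (?Y \<otimes>\<^sub>o A)"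
    by (simp add: T_ract_rules del: assoc_nat exch)
  also have "\<dots> = ?l \<cdot> (A \<triangleleft> Q x y) \<cdot> (A \<triangleleft> (?X \<triangleleft> ract y))"
    by (simp add: T_lact_rules)
  also have "\<dots> = (?l \<cdot> (A \<triangleleft> ?r)) \<cdot> (A \<triangleleft> (Q x y \<triangleright> A)) \<cdot> (A \<triangleleft> \<alpha> ?X ?Y A)"
    by (simp add: T_ract_rules del: T_lact_rules)
  finally show ?thesis
    by (rule epiD[rotated]) simp_all
qed

lemma bimodule_T [simp]:
  assumes [simp]: "bim x" "bim y"
  shows "bim (T x y)"
  unfolding bimodule_def
  using T_lact(1-3)[OF assms] T_ract(1-3)[OF assms] T_lact_unit[OF assms] T_ract_unit[OF assms]
    T_lact_lact[OF assms] T_ract_mult[OF assms] T_lact_ract[OF assms]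
  by (simp add: Hom_def)


section \<open>Tensor product of bimodule morphisms\<close>

abbreviation hom :: "('o, 'a) bimod_arr \<Rightarrow> bool" where
  "hom f \<equiv> bimodule_hom M m (bdom f) (barr f) (bcod f)"
abbreviation TA :: "('o, 'a) bimod_arr \<Rightarrow> ('o, 'a) bimod_arr \<Rightarrow> ('o, 'a) bimod_arr" where
  "TA \<equiv> bimod_tensA M q m"
abbreviation assoc :: "('o, 'a) bimod \<Rightarrow> ('o, 'a) bimod \<Rightarrow> ('o, 'a) bimod \<Rightarrow> 'a" where
  "assoc x y z \<equiv> barr (bimod_assoc M q m x y z)"

lemma hom_arr [simp]:
  assumes "hom f"
  shows "bim (bdom f)" and "bim (bcod f)"
    and "barr f \<in> Arr M" and "Dom M (barr f) = carr (bdom f)" and "Cod M (barr f) = carr (bcod f)"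
  using assms by (auto simp: bimodule_hom_def Hom_def)

lemma hom_lact: "\<lbrakk>hom f; bdom f = x\<rbrakk> \<Longrightarrow> barr f \<cdot> lact x = lact (bcod f) \<cdot> (A \<triangleleft> barr f)"
  and hom_ract: "\<lbrakk>hom f; bdom f = x\<rbrakk> \<Longrightarrow> barr f \<cdot> ract x = ract (bcod f) \<cdot> (barr f \<triangleright> A)"
  using bimodule_hom_act by blast+

lemmas hom_act [simp] =
  hom_lact hom_lact[THEN comp2_tail] hom_lact[THEN lwhisker2] hom_lact[THEN lwhisker2_tail]
  hom_lact[THEN rwhisker2] hom_lact[THEN rwhisker2_tail]
  hom_ract hom_ract[THEN comp2_tail] hom_ract[THEN lwhisker2] hom_ract[THEN lwhisker2_tail]
  hom_ract[THEN rwhisker2] hom_ract[THEN rwhisker2_tail]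

lemma homI:
  "\<lbrakk>bim (bdom f); bim (bcod f); barr f \<in> Arr M; Dom M (barr f) = carr (bdom f);
    Cod M (barr f) = carr (bcod f);
    barr f \<cdot> lact (bdom f) = lact (bcod f) \<cdot> (A \<triangleleft> barr f);
    barr f \<cdot> ract (bdom f) = ract (bcod f) \<cdot> (barr f \<triangleright> A)\<rbrakk> \<Longrightarrow> hom f"
  unfolding bimodule_hom_def by (blast intro: HomI)

lemma bdom_bcod_TA [simp]:
  "bdom (TA f g) = T (bdom f) (bdom g)" "bcod (TA f g) = T (bcod f) (bcod g)"
  by (simp_all add: bimod_tensA_def Let_def)

text \<open>Balancing survives because \<open>g\<close> is linear for the left action,
  \<open>f\<close> is linear for the right action, and the target coequalizer is balanced in
  between.\<close>

lemma TA_ex1: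
  assumes [simp]: "hom f" "hom g"
  shows "\<exists>!h. h \<in> Hom M (carr (T (bdom f) (bdom g))) (carr (T (bcod f) (bcod g))) \<and>
    h \<cdot> Q (bdom f) (bdom g) = Q (bcod f) (bcod g) \<cdot> (barr f \<otimes>\<^sub>a barr g)"
proof (rule Q_desc)
  let ?f = "barr f" and ?g = "barr g" and ?Q = "Q (bcod f) (bcod g)"
  have fg: "?f \<otimes>\<^sub>a ?g = (?f \<triangleright> carr (bcod g)) \<cdot> (carr (bdom f) \<triangleleft> ?g)"
    by (simp add: tens_whisker[of ?f ?g])
  have "(?Q \<cdot> (?f \<otimes>\<^sub>a ?g)) \<cdot> (carr (bdom f) \<triangleleft> lact (bdom g))
    = ?Q \<cdot> (carr (bcod f) \<triangleleft> lact (bcod g)) \<cdot> (?f \<triangleright> (A \<otimes>\<^sub>o carr (bcod g))) \<cdot>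
      (carr (bdom f) \<triangleleft> (A \<triangleleft> ?g))"
    by (simp add: fg)
  also have "\<dots> = ?Q \<cdot> (ract (bcod f) \<triangleright> carr (bcod g)) \<cdot> \<alpha> (carr (bcod f)) A (carr (bcod g)) \<cdot>
      (?f \<triangleright> (A \<otimes>\<^sub>o carr (bcod g))) \<cdot> (carr (bdom f) \<triangleleft> (A \<triangleleft> ?g))"
    by (simp add: Q_bal del: exch assoc_nat)
  also have "\<dots> = (?Q \<cdot> (?f \<otimes>\<^sub>a ?g)) \<cdot> (ract (bdom f) \<triangleright> carr (bdom g)) \<cdot>
      \<alpha> (carr (bdom f)) A (carr (bdom g))"
    by (simp add: fg)
  finally show "(?Q \<cdot> (?f \<otimes>\<^sub>a ?g)) \<cdot> (carr (bdom f) \<triangleleft> lact (bdom g)) = (?Q \<cdot> (?f \<otimes>\<^sub>a ?g)) \<cdot>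
      (ract (bdom f) \<triangleright> carr (bdom g)) \<cdot> \<alpha> (carr (bdom f)) A (carr (bdom g))" .
qed simp_all

lemma TA_arr:
  assumes [simp]: "hom f" "hom g"
  shows "barr (TA f g) \<in> Arr M" and "Dom M (barr (TA f g)) = carr (T (bdom f) (bdom g))"
    and "Cod M (barr (TA f g)) = carr (T (bcod f) (bcod g))"
    and "\<lbrakk>bdom f = x; bdom g = y\<rbrakk> \<Longrightarrow> barr (TA f g) \<cdot> Q x y
      = Q (bcod f) (bcod g) \<cdot> (barr f \<triangleright> carr (bcod g)) \<cdot> (carr x \<triangleleft> barr g)"
  using theI'[OF TA_ex1[OF assms]] tens_whisker[of "barr f" "barr g"]
  by (auto simp: bimod_tensA_def Let_def Hom_def)

lemmas TA_rules =
  TA_arr(4) TA_arr(4)[THEN comp2_tail] TA_arr(4)[THEN lwhisker2] TA_arr(4)[THEN lwhisker2_tail]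
  TA_arr(4)[THEN rwhisker2] TA_arr(4)[THEN rwhisker2_tail]

lemma hom_TA:
  assumes [simp]: "hom f" "hom g"
  shows "hom (TA f g)"
proof (rule homI)
  note [simp] = TA_arr(1-3) TA_rules
  let ?f = "barr f" and ?g = "barr g" and ?Q = "Q (bdom f) (bdom g)" and ?Q' = "Q (bcod f) (bcod g)"
  let ?X = "carr (bdom f)" and ?Y = "carr (bdom g)" and ?X' = "carr (bcod f)" and ?Y' = "carr (bcod g)"
  let ?k = "barr (TA f g)"
  have "(?k \<cdot> lact (T (bdom f) (bdom g))) \<cdot> (A \<triangleleft> ?Q)
     = (lact (T (bcod f) (bcod g)) \<cdot> (A \<triangleleft> ?k)) \<cdot> (A \<triangleleft> ?Q)"
    by (simp add: T_lact_rules)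
  then show "?k \<cdot> lact (bdom (TA f g)) = lact (bcod (TA f g)) \<cdot> (A \<triangleleft> ?k)"
    by (intro epiD[of "A \<triangleleft> ?Q" "?k \<cdot> lact (bdom (TA f g))"]) simp_all
  have "(?k \<cdot> ract (T (bdom f) (bdom g))) \<cdot> (?Q \<triangleright> A) \<cdot> \<alpha> ?X ?Y A
     = ?Q' \<cdot> (?X' \<triangleleft> ract (bcod g)) \<cdot> (?f \<triangleright> (?Y' \<otimes>\<^sub>o A)) \<cdot> (?X \<triangleleft> (?g \<triangleright> A))"
    by (simp add: T_ract_rules)
  also have "\<dots> = ract (T (bcod f) (bcod g)) \<cdot> (?Q' \<triangleright> A) \<cdot> \<alpha> ?X' ?Y' A \<cdot> (?f \<triangleright> (?Y' \<otimes>\<^sub>o A)) \<cdot> (?X \<triangleleft> (?g \<triangleright> A))"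
    by (simp add: T_ract_rules del: assoc_nat exch)
  also have "\<dots> = (ract (T (bcod f) (bcod g)) \<cdot> (?k \<triangleright> A)) \<cdot> (?Q \<triangleright> A) \<cdot> \<alpha> ?X ?Y A"
    by simp
  finally have "?k \<cdot> ract (T (bdom f) (bdom g)) = ract (T (bcod f) (bcod g)) \<cdot> (?k \<triangleright> A)"
    by (rule epiD[rotated]) simp_all
  then show "?k \<cdot> ract (bdom (TA f g)) = ract (bcod (TA f g)) \<cdot> (?k \<triangleright> A)"
    by simp
qed (simp_all add: TA_arr)

text \<open>The simplifier normalises \<open>bdom (TA f g)\<close> and \<open>bcod (TA f g)\<close>
  first, so only the unfolded form of the rule can match.\<close>

declare hom_TA [unfolded bdom_bcod_TA, simp]
declare TA_arr(1-3) [simp]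

section \<open>The associator of bimodules\<close>

text \<open>
  Both triple tensor products classify the maps \<open>x \<otimes> (y \<otimes> z) \<rightarrow> t\<close> that are balanced in \<open>x, y\<close> and
  in \<open>y, z\<close>; this yields the associator and its inverse.
\<close>

definition trilinear :: "('o, 'a) bimod \<Rightarrow> ('o, 'a) bimod \<Rightarrow> ('o, 'a) bimod \<Rightarrow> 'a \<Rightarrow> 'o \<Rightarrow> bool" where
  "trilinear x y z b t \<longleftrightarrow> b \<in> Hom M (carr x \<otimes>\<^sub>o (carr y \<otimes>\<^sub>o carr z)) t \<and>
     b \<cdot> (carr x \<triangleleft> (carr y \<triangleleft> lact z))
       = b \<cdot> (carr x \<triangleleft> (ract y \<triangleright> carr z)) \<cdot> (carr x \<triangleleft> \<alpha> (carr y) A (carr z)) \<and>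
     b \<cdot> (carr x \<triangleleft> (lact y \<triangleright> carr z)) \<cdot> (carr x \<triangleleft> \<alpha> A (carr y) (carr z))
       = b \<cdot> (ract x \<triangleright> (carr y \<otimes>\<^sub>o carr z)) \<cdot> \<alpha> (carr x) A (carr y \<otimes>\<^sub>o carr z)"

text \<open>Balancing in \<open>y\<close>, \<open>z\<close> is that of the inner coequalizer.
  Balancing in \<open>x\<close>, \<open>y\<close> comes from the outer one, since the left action on
  \<open>T y z\<close> is induced by that on \<open>y\<close>.\<close>

lemma trilinear_right:
  assumes [simp]: "bim x" "bim y" "bim z"
  shows "trilinear x y z (Q x (T y z) \<cdot> (carr x \<triangleleft> Q y z)) (carr (T x (T y z)))"
proof -
  let ?X = "carr x" and ?Y = "carr y" and ?Z = "carr z"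
  have "Q x (T y z) \<cdot> (?X \<triangleleft> Q y z) \<cdot> (?X \<triangleleft> (lact y \<triangleright> ?Z)) \<cdot> (?X \<triangleleft> \<alpha> A ?Y ?Z)
    = Q x (T y z) \<cdot> (?X \<triangleleft> lact (T y z)) \<cdot> (?X \<triangleleft> (A \<triangleleft> Q y z))"
    by (simp add: T_lact_rules)
  also have "\<dots> = Q x (T y z) \<cdot> (ract x \<triangleright> carr (T y z)) \<cdot> \<alpha> ?X A (carr (T y z)) \<cdot> (?X \<triangleleft> (A \<triangleleft> Q y z))"
    by (simp add: Q_bal del: exch assoc_nat)
  also have "\<dots> = Q x (T y z) \<cdot> (?X \<triangleleft> Q y z) \<cdot> (ract x \<triangleright> (?Y \<otimes>\<^sub>o ?Z)) \<cdot> \<alpha> ?X A (?Y \<otimes>\<^sub>o ?Z)"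
    by simp
  finally show ?thesis
    by (simp add: trilinear_def Hom_def Q_bal del: exch assoc_nat)
qed

text \<open>The roles are exchanged: the inner coequalizer balances \<open>x\<close>,
  \<open>y\<close>, and the outer one balances \<open>y\<close>, \<open>z\<close> because the right
  action on \<open>T x y\<close> is induced by that on \<open>y\<close>.\<close>

lemma trilinear_left:
  assumes [simp]: "bim x" "bim y" "bim z"
  shows "trilinear x y z (Q (T x y) z \<cdot> (Q x y \<triangleright> carr z) \<cdot> \<alpha> (carr x) (carr y) (carr z)) (carr (T (T x y) z))"
proof -
  let ?X = "carr x" and ?Y = "carr y" and ?Z = "carr z" and ?Q = "Q (T x y) z"
  let ?b = "?Q \<cdot> (Q x y \<triangleright> ?Z) \<cdot> \<alpha> ?X ?Y ?Z"
  have "?b \<cdot> (?X \<triangleleft> (?Y \<triangleleft> lact z))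
     = ?Q \<cdot> (carr (T x y) \<triangleleft> lact z) \<cdot> (Q x y \<triangleright> (A \<otimes>\<^sub>o ?Z)) \<cdot> \<alpha> ?X ?Y (A \<otimes>\<^sub>o ?Z)"
    by simp
  also have "\<dots> = ?Q \<cdot> (ract (T x y) \<triangleright> ?Z) \<cdot> \<alpha> (carr (T x y)) A ?Z \<cdot> (Q x y \<triangleright> (A \<otimes>\<^sub>o ?Z)) \<cdot> \<alpha> ?X ?Y (A \<otimes>\<^sub>o ?Z)"
    by (simp add: Q_bal del: exch assoc_nat)
  also have "\<dots> = ?Q \<cdot> (ract (T x y) \<triangleright> ?Z) \<cdot> ((Q x y \<triangleright> A) \<triangleright> ?Z) \<cdot> (\<alpha> ?X ?Y A \<triangleright> ?Z) \<cdot>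
      \<alpha> ?X (?Y \<otimes>\<^sub>o A) ?Z \<cdot> (?X \<triangleleft> \<alpha> ?Y A ?Z)"
    by simp
  also have "\<dots> = ?Q \<cdot> (Q x y \<triangleright> ?Z) \<cdot> ((?X \<triangleleft> ract y) \<triangleright> ?Z) \<cdot> \<alpha> ?X (?Y \<otimes>\<^sub>o A) ?Z \<cdot> (?X \<triangleleft> \<alpha> ?Y A ?Z)"
    by (simp add: T_ract_rules del: pent)
  also have "\<dots> = ?b \<cdot> (?X \<triangleleft> (ract y \<triangleright> ?Z)) \<cdot> (?X \<triangleleft> \<alpha> ?Y A ?Z)"
    by simp
  finally have 1: "?b \<cdot> (?X \<triangleleft> (?Y \<triangleleft> lact z)) = \<dots>" .
  have 2: "?b \<cdot> (?X \<triangleleft> (lact y \<triangleright> ?Z)) \<cdot> (?X \<triangleleft> \<alpha> A ?Y ?Z)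
      = ?b \<cdot> (ract x \<triangleright> (?Y \<otimes>\<^sub>o ?Z)) \<cdot> \<alpha> ?X A (?Y \<otimes>\<^sub>o ?Z)"
    by (simp add: Q_bal)
  show ?thesis
    unfolding trilinear_def by (intro conjI 1 2 HomI) simp_all
qed

text \<open>Descent in two stages. Balancing in \<open>y\<close>, \<open>z\<close> gives an arrow
  \<open>k\<close> through the whiskered coequalizer; balancing in \<open>x\<close>,
  \<open>y\<close> then makes \<open>k\<close> balanced in \<open>x\<close> and
  \<open>T y z\<close>, as can be checked on the epi
  \<open>?X \<triangleleft> (A \<triangleleft> Q y z)\<close>. Uniqueness holds because a composite
  of epis is epi.\<close>

lemma trilinear_right_desc:
  assumes [simp]: "bim x" "bim y" "bim z" and b: "trilinear x y z b t"
  shows "\<exists>!h. h \<in> Hom M (carr (T x (T y z))) t \<and> h \<cdot> Q x (T y z) \<cdot> (carr x \<triangleleft> Q y z) = b"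
proof (rule ex_ex1I)
  let ?X = "carr x" and ?Y = "carr y" and ?Z = "carr z"
  have [simp]: "b \<in> Arr M" "Dom M b = ?X \<otimes>\<^sub>o (?Y \<otimes>\<^sub>o ?Z)" "Cod M b = t"
    and b1: "b \<cdot> (?X \<triangleleft> (?Y \<triangleleft> lact z)) = b \<cdot> (?X \<triangleleft> (ract y \<triangleright> ?Z)) \<cdot> (?X \<triangleleft> \<alpha> ?Y A ?Z)"
    and b2: "b \<cdot> (?X \<triangleleft> (lact y \<triangleright> ?Z)) \<cdot> (?X \<triangleleft> \<alpha> A ?Y ?Z)
      = b \<cdot> (ract x \<triangleright> (?Y \<otimes>\<^sub>o ?Z)) \<cdot> \<alpha> ?X A (?Y \<otimes>\<^sub>o ?Z)"
    using b by (auto simp: trilinear_def Hom_def)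
  have "\<exists>!k. k \<in> Hom M (?X \<otimes>\<^sub>o carr (T y z)) t \<and> k \<cdot> (?X \<triangleleft> Q y z) = b"
    by (rule lwhisker_Q_desc) (simp_all add: b1)
  then obtain k where k: "k \<in> Hom M (?X \<otimes>\<^sub>o carr (T y z)) t" and kb: "k \<cdot> (?X \<triangleleft> Q y z) = b"
    by blast
  note [simp] = arrI[OF k]
  note kb_rules = kb kb[THEN comp2_tail]
  have "(k \<cdot> (?X \<triangleleft> lact (T y z))) \<cdot> (?X \<triangleleft> (A \<triangleleft> Q y z))
     = b \<cdot> (?X \<triangleleft> (lact y \<triangleright> ?Z)) \<cdot> (?X \<triangleleft> \<alpha> A ?Y ?Z)"
    by (simp add: T_lact_rules kb_rules del: assoc_nat exch)
  also have "\<dots> = k \<cdot> (?X \<triangleleft> Q y z) \<cdot> (ract x \<triangleright> (?Y \<otimes>\<^sub>o ?Z)) \<cdot> \<alpha> ?X A (?Y \<otimes>\<^sub>o ?Z)"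
    by (simp add: kb_rules b2 del: assoc_nat exch)
  also have "\<dots> = (k \<cdot> (ract x \<triangleright> carr (T y z)) \<cdot> \<alpha> ?X A (carr (T y z))) \<cdot> (?X \<triangleleft> (A \<triangleleft> Q y z))"
    by simp
  finally have "k \<cdot> (?X \<triangleleft> lact (T y z)) = k \<cdot> (ract x \<triangleright> carr (T y z)) \<cdot> \<alpha> ?X A (carr (T y z))"
    by (rule epiD[rotated]) simp_all
  then have "\<exists>!h. h \<in> Hom M (carr (T x (T y z))) t \<and> h \<cdot> Q x (T y z) = k"
    by (intro Q_desc) simp_all
  then obtain h where h: "h \<in> Hom M (carr (T x (T y z))) t" and hk: "h \<cdot> Q x (T y z) = k"
    by blast
  then show "\<exists>h. h \<in> Hom M (carr (T x (T y z))) t \<and> h \<cdot> Q x (T y z) \<cdot> (?X \<triangleleft> Q y z) = b"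
    using kb arrI[OF h] by (intro exI[of _ h]) (simp add: hk[THEN comp2_tail])
  fix h h'
  assume "h \<in> Hom M (carr (T x (T y z))) t \<and> h \<cdot> Q x (T y z) \<cdot> (?X \<triangleleft> Q y z) = b"
    and "h' \<in> Hom M (carr (T x (T y z))) t \<and> h' \<cdot> Q x (T y z) \<cdot> (?X \<triangleleft> Q y z) = b"
  then show "h = h'"
    by (intro epiD[of "Q x (T y z) \<cdot> (?X \<triangleleft> Q y z)" h]) (simp_all add: Hom_def)
qed

lemma trilinear_left_desc:
  assumes [simp]: "bim x" "bim y" "bim z" and b: "trilinear x y z b t"
  shows "\<exists>!h. h \<in> Hom M (carr (T (T x y) z)) t \<and>
    h \<cdot> Q (T x y) z \<cdot> (Q x y \<triangleright> carr z) \<cdot> \<alpha> (carr x) (carr y) (carr z) = b"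
proof (rule ex_ex1I)
  let ?X = "carr x" and ?Y = "carr y" and ?Z = "carr z"
  have [simp]: "b \<in> Arr M" "Dom M b = ?X \<otimes>\<^sub>o (?Y \<otimes>\<^sub>o ?Z)" "Cod M b = t"
    and b1: "b \<cdot> (?X \<triangleleft> (?Y \<triangleleft> lact z)) = b \<cdot> (?X \<triangleleft> (ract y \<triangleright> ?Z)) \<cdot> (?X \<triangleleft> \<alpha> ?Y A ?Z)"
    and b2: "b \<cdot> (?X \<triangleleft> (lact y \<triangleright> ?Z)) \<cdot> (?X \<triangleleft> \<alpha> A ?Y ?Z)
      = b \<cdot> (ract x \<triangleright> (?Y \<otimes>\<^sub>o ?Z)) \<cdot> \<alpha> ?X A (?Y \<otimes>\<^sub>o ?Z)"
    using b by (auto simp: trilinear_def Hom_def)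
  \<comment> \<open>The map is moved to the left bracketing, since the first stage of descent is now
    along \<open>Q x y \<triangleright> ?Z\<close>.\<close>
  obtain c where c: "c = b \<cdot> inv_arr (\<alpha> ?X ?Y ?Z)"
    by blast
  then have [simp]: "c \<in> Arr M" "Dom M c = (?X \<otimes>\<^sub>o ?Y) \<otimes>\<^sub>o ?Z" "Cod M c = t" and cb: "c \<cdot> \<alpha> ?X ?Y ?Z = b"
    by simp_all
  note cb_rules = cb cb[THEN comp2_tail]
  have "(c \<cdot> ((?X \<triangleleft> lact y) \<triangleright> ?Z)) \<cdot> \<alpha> ?X (A \<otimes>\<^sub>o ?Y) ?Z \<cdot> (?X \<triangleleft> \<alpha> A ?Y ?Z)
      = c \<cdot> \<alpha> ?X ?Y ?Z \<cdot> (?X \<triangleleft> (lact y \<triangleright> ?Z)) \<cdot> (?X \<triangleleft> \<alpha> A ?Y ?Z)"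
    by simp
  also have "\<dots> = c \<cdot> \<alpha> ?X ?Y ?Z \<cdot> (ract x \<triangleright> (?Y \<otimes>\<^sub>o ?Z)) \<cdot> \<alpha> ?X A (?Y \<otimes>\<^sub>o ?Z)"
    by (simp add: cb_rules b2 del: assoc_nat exch)
  also have "\<dots> = (c \<cdot> (((ract x \<triangleright> ?Y) \<cdot> \<alpha> ?X A ?Y) \<triangleright> ?Z)) \<cdot> \<alpha> ?X (A \<otimes>\<^sub>o ?Y) ?Z \<cdot> (?X \<triangleleft> \<alpha> A ?Y ?Z)"
    by simp
  finally have "c \<cdot> ((?X \<triangleleft> lact y) \<triangleright> ?Z) = c \<cdot> (((ract x \<triangleright> ?Y) \<cdot> \<alpha> ?X A ?Y) \<triangleright> ?Z)"
    by (rule epiD[rotated]) simp_all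
  then have "\<exists>!k. k \<in> Hom M (carr (T x y) \<otimes>\<^sub>o ?Z) t \<and> k \<cdot> (Q x y \<triangleright> ?Z) = c"
    by (intro rwhisker_Q_desc) simp_all
  then obtain k where k: "k \<in> Hom M (carr (T x y) \<otimes>\<^sub>o ?Z) t" and kc: "k \<cdot> (Q x y \<triangleright> ?Z) = c"
    by blast
  note [simp] = arrI[OF k]
  have kb: "k \<cdot> (Q x y \<triangleright> ?Z) \<cdot> \<alpha> ?X ?Y ?Z = b"
    by (simp add: kc[THEN comp2_tail] cb)
  note kb_rules = kb kb[THEN comp3_tail]
  have "(k \<cdot> (carr (T x y) \<triangleleft> lact z)) \<cdot> (Q x y \<triangleright> (A \<otimes>\<^sub>o ?Z)) \<cdot> \<alpha> ?X ?Y (A \<otimes>\<^sub>o ?Z)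
     = k \<cdot> (Q x y \<triangleright> ?Z) \<cdot> \<alpha> ?X ?Y ?Z \<cdot> (?X \<triangleleft> (?Y \<triangleleft> lact z))"
    by simp
  also have "\<dots> = k \<cdot> (Q x y \<triangleright> ?Z) \<cdot> \<alpha> ?X ?Y ?Z \<cdot> (?X \<triangleleft> (ract y \<triangleright> ?Z)) \<cdot> (?X \<triangleleft> \<alpha> ?Y A ?Z)"
    by (simp add: kb_rules b1 del: assoc_nat exch)
  also have "\<dots> = k \<cdot> (Q x y \<triangleright> ?Z) \<cdot> ((?X \<triangleleft> ract y) \<triangleright> ?Z) \<cdot> \<alpha> ?X (?Y \<otimes>\<^sub>o A) ?Z \<cdot> (?X \<triangleleft> \<alpha> ?Y A ?Z)"
    by simp
  also have "\<dots> = k \<cdot> (ract (T x y) \<triangleright> ?Z) \<cdot> ((Q x y \<triangleright> A) \<triangleright> ?Z) \<cdot> (\<alpha> ?X ?Y A \<triangleright> ?Z) \<cdot>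
      \<alpha> ?X (?Y \<otimes>\<^sub>o A) ?Z \<cdot> (?X \<triangleleft> \<alpha> ?Y A ?Z)"
    by (simp add: T_ract_rules del: pent)
  also have "\<dots> = (k \<cdot> (ract (T x y) \<triangleright> ?Z) \<cdot> \<alpha> (carr (T x y)) A ?Z) \<cdot>
      (Q x y \<triangleright> (A \<otimes>\<^sub>o ?Z)) \<cdot> \<alpha> ?X ?Y (A \<otimes>\<^sub>o ?Z)"
    by simp
  finally have "k \<cdot> (carr (T x y) \<triangleleft> lact z) = k \<cdot> (ract (T x y) \<triangleright> ?Z) \<cdot> \<alpha> (carr (T x y)) A ?Z"
    by (rule epiD[rotated]) simp_all
  then have "\<exists>!h. h \<in> Hom M (carr (T (T x y) z)) t \<and> h \<cdot> Q (T x y) z = k"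
    by (intro Q_desc) simp_all
  then obtain h where h: "h \<in> Hom M (carr (T (T x y) z)) t" and hk: "h \<cdot> Q (T x y) z = k"
    by blast
  then show "\<exists>h. h \<in> Hom M (carr (T (T x y) z)) t \<and>
      h \<cdot> Q (T x y) z \<cdot> (Q x y \<triangleright> ?Z) \<cdot> \<alpha> ?X ?Y ?Z = b"
    using kb arrI[OF h] by (intro exI[of _ h]) (simp add: hk[THEN comp2_tail])
  fix h h'
  assume "h \<in> Hom M (carr (T (T x y) z)) t \<and> h \<cdot> Q (T x y) z \<cdot> (Q x y \<triangleright> ?Z) \<cdot> \<alpha> ?X ?Y ?Z = b"
    and "h' \<in> Hom M (carr (T (T x y) z)) t \<and> h' \<cdot> Q (T x y) z \<cdot> (Q x y \<triangleright> ?Z) \<cdot> \<alpha> ?X ?Y ?Z = b"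
  then show "h = h'"
    by (intro epiD[of "Q (T x y) z \<cdot> (Q x y \<triangleright> ?Z) \<cdot> \<alpha> ?X ?Y ?Z" h]) (simp_all add: Hom_def)
qed

lemma bdom_bcod_assoc [simp]:
  "bdom (bimod_assoc M q m x y z) = T x (T y z)" "bcod (bimod_assoc M q m x y z) = T (T x y) z"
  by (simp_all add: bimod_assoc_def Let_def)

lemma assoc_T:
  assumes [simp]: "bim x" "bim y" "bim z"
  shows "assoc x y z \<in> Arr M" and "Dom M (assoc x y z) = carr (T x (T y z))"
    and "Cod M (assoc x y z) = carr (T (T x y) z)"
    and "assoc x y z \<cdot> Q x (T y z) \<cdot> (carr x \<triangleleft> Q y z)
      = Q (T x y) z \<cdot> (Q x y \<triangleright> carr z) \<cdot> \<alpha> (carr x) (carr y) (carr z)"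
  using theI'[OF trilinear_right_desc[OF assms trilinear_left[OF assms]]]
  by (auto simp: bimod_assoc_def Let_def Hom_def)

lemmas assoc_T_rules =
  assoc_T(4) assoc_T(4)[THEN comp3_tail]
  assoc_T(4)[THEN lwhisker3] assoc_T(4)[THEN lwhisker3_tail]
  assoc_T(4)[THEN rwhisker3] assoc_T(4)[THEN rwhisker3_tail]

text \<open>On the threefold coequalizer the left action affects only \<open>x\<close> and the right
  action only \<open>z\<close>, so both laws reduce to naturality of the base associator and the
  pentagon.\<close>

lemma hom_assoc:
  assumes [simp]: "bim x" "bim y" "bim z"
  shows "hom (bimod_assoc M q m x y z)"
proof (rule homI)
  note [simp] = assoc_T(1-3)
  let ?X = "carr x" and ?Y = "carr y" and ?Z = "carr z" and ?a = "assoc x y z"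
  have "(?a \<cdot> lact (T x (T y z))) \<cdot> (A \<triangleleft> Q x (T y z)) \<cdot> (A \<triangleleft> (?X \<triangleleft> Q y z))
     = ?a \<cdot> Q x (T y z) \<cdot> (?X \<triangleleft> Q y z) \<cdot> (lact x \<triangleright> (?Y \<otimes>\<^sub>o ?Z)) \<cdot> \<alpha> A ?X (?Y \<otimes>\<^sub>o ?Z)"
    by (simp add: T_lact_rules)
  also have "\<dots> = Q (T x y) z \<cdot> (Q x y \<triangleright> ?Z) \<cdot> \<alpha> ?X ?Y ?Z \<cdot> (lact x \<triangleright> (?Y \<otimes>\<^sub>o ?Z)) \<cdot> \<alpha> A ?X (?Y \<otimes>\<^sub>o ?Z)"
    by (simp add: assoc_T_rules del: exch assoc_nat)
  also have "\<dots> = (lact (T (T x y) z) \<cdot> (A \<triangleleft> ?a)) \<cdot> (A \<triangleleft> Q x (T y z)) \<cdot> (A \<triangleleft> (?X \<triangleleft> Q y z))"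
    by (simp add: T_lact_rules assoc_T_rules)
  finally have "?a \<cdot> lact (T x (T y z)) = lact (T (T x y) z) \<cdot> (A \<triangleleft> ?a)"
    by (rule epiD[rotated]) simp_all
  then show "?a \<cdot> lact (bdom (bimod_assoc M q m x y z)) = lact (bcod (bimod_assoc M q m x y z)) \<cdot> (A \<triangleleft> ?a)"
    by simp
  have "(?a \<cdot> ract (T x (T y z))) \<cdot> (Q x (T y z) \<triangleright> A) \<cdot> ((?X \<triangleleft> Q y z) \<triangleright> A) \<cdot>
      \<alpha> ?X (?Y \<otimes>\<^sub>o ?Z) A \<cdot> (?X \<triangleleft> \<alpha> ?Y ?Z A)
     = ?a \<cdot> ract (T x (T y z)) \<cdot> (Q x (T y z) \<triangleright> A) \<cdot> \<alpha> ?X (carr (T y z)) A \<cdot>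
       (?X \<triangleleft> (Q y z \<triangleright> A)) \<cdot> (?X \<triangleleft> \<alpha> ?Y ?Z A)"
    by simp
  also have "\<dots> = Q (T x y) z \<cdot> (Q x y \<triangleright> ?Z) \<cdot> \<alpha> ?X ?Y ?Z \<cdot> (?X \<triangleleft> (?Y \<triangleleft> ract z))"
    by (simp add: T_ract_rules assoc_T_rules del: exch assoc_nat)
  \<comment> \<open>Exchange used backwards places \<open>ract z\<close> directly behind the outer
    coequalizer, where the equation for the induced right action can be read from right to
    left.\<close>
  also have "\<dots> = Q (T x y) z \<cdot> (carr (T x y) \<triangleleft> ract z) \<cdot> (Q x y \<triangleright> (?Z \<otimes>\<^sub>o A)) \<cdot> \<alpha> ?X ?Y (?Z \<otimes>\<^sub>o A)"
    by simp
  also have "\<dots> = ract (T (T x y) z) \<cdot> (Q (T x y) z \<triangleright> A) \<cdot> \<alpha> (carr (T x y)) ?Z A \<cdot>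
      (Q x y \<triangleright> (?Z \<otimes>\<^sub>o A)) \<cdot> \<alpha> ?X ?Y (?Z \<otimes>\<^sub>o A)"
    by (simp add: T_ract_rules del: exch assoc_nat)
  also have "\<dots> = (ract (T (T x y) z) \<cdot> (?a \<triangleright> A)) \<cdot> (Q x (T y z) \<triangleright> A) \<cdot> ((?X \<triangleleft> Q y z) \<triangleright> A) \<cdot>
      \<alpha> ?X (?Y \<otimes>\<^sub>o ?Z) A \<cdot> (?X \<triangleleft> \<alpha> ?Y ?Z A)"
    by (simp add: assoc_T_rules)
  finally have "?a \<cdot> ract (T x (T y z)) = ract (T (T x y) z) \<cdot> (?a \<triangleright> A)"
    by (rule epiD[rotated]) simp_all
  then show "?a \<cdot> ract (bdom (bimod_assoc M q m x y z)) = ract (bcod (bimod_assoc M q m x y z)) \<cdot> (?a \<triangleright> A)"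
    by simp
qed (simp_all add: assoc_T)

declare hom_assoc [unfolded bdom_bcod_assoc, simp]
declare assoc_T(1-3) [simp]

text \<open>Descent on the left bracketing, applied to the canonical map into the right one, yields
  the inverse; both composites are identities when tested on the threefold coequalizers.\<close>

lemma assoc_T_inverse:
  assumes [simp]: "bim x" "bim y" "bim z"
  shows "\<exists>b. b \<in> Hom M (carr (T (T x y) z)) (carr (T x (T y z))) \<and>
    b \<cdot> assoc x y z = Ident M (carr (T x (T y z))) \<and> assoc x y z \<cdot> b = Ident M (carr (T (T x y) z))"
proof -
  let ?X = "carr x" and ?Y = "carr y" and ?Z = "carr z" and ?a = "assoc x y z"
  obtain b where b: "b \<in> Hom M (carr (T (T x y) z)) (carr (T x (T y z)))"
    and bq: "b \<cdot> Q (T x y) z \<cdot> (Q x y \<triangleright> ?Z) \<cdot> \<alpha> ?X ?Y ?Z = Q x (T y z) \<cdot> (?X \<triangleleft> Q y z)"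
    using trilinear_left_desc[OF assms trilinear_right[OF assms]] by blast
  note [simp] = arrI[OF b]
  have "(b \<cdot> ?a) \<cdot> Q x (T y z) \<cdot> (?X \<triangleleft> Q y z)
      = Ident M (carr (T x (T y z))) \<cdot> Q x (T y z) \<cdot> (?X \<triangleleft> Q y z)"
    by (simp add: assoc_T_rules bq)
  then have "b \<cdot> ?a = Ident M (carr (T x (T y z)))"
    by (rule epiD[rotated]) simp_all
  moreover have "(?a \<cdot> b) \<cdot> Q (T x y) z \<cdot> (Q x y \<triangleright> ?Z) \<cdot> \<alpha> ?X ?Y ?Z
      = Ident M (carr (T (T x y) z)) \<cdot> Q (T x y) z \<cdot> (Q x y \<triangleright> ?Z) \<cdot> \<alpha> ?X ?Y ?Z"
    by (simp add: assoc_T_rules bq)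
  then have "?a \<cdot> b = Ident M (carr (T (T x y) z))"
    by (rule epiD[rotated]) simp_all
  ultimately show ?thesis
    using b by blast
qed

lemma assoc_T_natural:
  assumes [simp]: "hom f" "hom g" "hom h"
  shows "assoc (bcod f) (bcod g) (bcod h) \<cdot> barr (TA f (TA g h))
    = barr (TA (TA f g) h) \<cdot> assoc (bdom f) (bdom g) (bdom h)"
proof -
  let ?X = "carr (bdom f)" and ?Y = "carr (bdom g)" and ?Z = "carr (bdom h)"
  let ?X' = "carr (bcod f)" and ?Y' = "carr (bcod g)" and ?Z' = "carr (bcod h)"
  let ?a = "assoc (bdom f) (bdom g) (bdom h)" and ?a' = "assoc (bcod f) (bcod g) (bcod h)"
  let ?Q = "Q (bdom f) (T (bdom g) (bdom h))" and ?q = "Q (bdom g) (bdom h)"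
  have "(?a' \<cdot> barr (TA f (TA g h))) \<cdot> ?Q \<cdot> (?X \<triangleleft> ?q)
     = ?a' \<cdot> Q (bcod f) (T (bcod g) (bcod h)) \<cdot> (?X' \<triangleleft> Q (bcod g) (bcod h)) \<cdot>
       (barr f \<triangleright> (?Y' \<otimes>\<^sub>o ?Z')) \<cdot> (?X \<triangleleft> (barr g \<triangleright> ?Z')) \<cdot> (?X \<triangleleft> (?Y \<triangleleft> barr h))"
    by (simp add: TA_rules)
  also have "\<dots> = Q (T (bcod f) (bcod g)) (bcod h) \<cdot> (Q (bcod f) (bcod g) \<triangleright> ?Z') \<cdot> \<alpha> ?X' ?Y' ?Z' \<cdot>
       (barr f \<triangleright> (?Y' \<otimes>\<^sub>o ?Z')) \<cdot> (?X \<triangleleft> (barr g \<triangleright> ?Z')) \<cdot> (?X \<triangleleft> (?Y \<triangleleft> barr h))"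
    by (simp add: assoc_T_rules del: exch assoc_nat)
  also have "\<dots> = (barr (TA (TA f g) h) \<cdot> ?a) \<cdot> ?Q \<cdot> (?X \<triangleleft> ?q)"
    by (simp add: TA_rules assoc_T_rules)
  finally show ?thesis
    by (rule epiD[rotated]) simp_all
qed

abbreviation bident :: "('o, 'a) bimod \<Rightarrow> ('o, 'a) bimod_arr" where
  "bident x \<equiv> BArr x (Ident M (carr x)) x"

lemma bident_hom [simp]: "bim x \<Longrightarrow> bimodule_hom M m x (Ident M (carr x)) x"
  by (simp add: bimodule_hom_ident)

text \<open>The carrier of the regular bimodule is simplified to \<open>A\<close>, so the general
  rule for identities would no longer match this instance.\<close>

lemma bident_regular_hom [simp]: "bimodule_hom M m (regular m) (Ident M A) (regular m)"
  using bident_hom[OF bimodule_regular] by simp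

text \<open>Composed with the epi from the fourfold product in the base category, each induced
  associator becomes a base one, and the pentagon of the base category remains.\<close>

lemma assoc_T_pentagon:
  assumes [simp]: "bim x" "bim y" "bim z" "bim w"
  shows "assoc (T x y) z w \<cdot> assoc x y (T z w)
    = barr (TA (bimod_assoc M q m x y z) (bident w)) \<cdot> assoc x (T y z) w \<cdot>
      barr (TA (bident x) (bimod_assoc M q m y z w))"
proof -
  let ?X = "carr x" and ?Y = "carr y" and ?Z = "carr z" and ?W = "carr w"
  let ?e = "Q x (T y (T z w)) \<cdot> (?X \<triangleleft> Q y (T z w)) \<cdot> (?X \<triangleleft> (?Y \<triangleleft> Q z w))"
  have "(assoc (T x y) z w \<cdot> assoc x y (T z w)) \<cdot> ?e
     = assoc (T x y) z w \<cdot> Q (T x y) (T z w) \<cdot> (Q x y \<triangleright> carr (T z w)) \<cdot> \<alpha> ?X ?Y (carr (T z w)) \<cdot>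
       (?X \<triangleleft> (?Y \<triangleleft> Q z w))"
    by (simp add: assoc_T_rules del: exch assoc_nat)
  \<comment> \<open>\<open>Q z w\<close> has to pass \<open>Q x y\<close> before the equation of the
    second associator can match.\<close>
  also have "\<dots> = assoc (T x y) z w \<cdot> Q (T x y) (T z w) \<cdot> (carr (T x y) \<triangleleft> Q z w) \<cdot>
      (Q x y \<triangleright> (?Z \<otimes>\<^sub>o ?W)) \<cdot> \<alpha> ?X ?Y (?Z \<otimes>\<^sub>o ?W)"
    by simp
  also have "\<dots> = Q (T (T x y) z) w \<cdot> (Q (T x y) z \<triangleright> ?W) \<cdot> \<alpha> (carr (T x y)) ?Z ?W \<cdot>
      (Q x y \<triangleright> (?Z \<otimes>\<^sub>o ?W)) \<cdot> \<alpha> ?X ?Y (?Z \<otimes>\<^sub>o ?W)"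
    by (simp add: assoc_T_rules del: exch assoc_nat)
  also have "\<dots> = (barr (TA (bimod_assoc M q m x y z) (bident w)) \<cdot> assoc x (T y z) w \<cdot>
      barr (TA (bident x) (bimod_assoc M q m y z w))) \<cdot> ?e"
    by (simp add: assoc_T_rules TA_rules)
  finally show ?thesis
    by (rule epiD[rotated]) simp_all
qed

section \<open>The unit constraints of bimodules\<close>

lemma mult_unit: "\<mu> \<cdot> (\<eta> \<triangleright> A) = LUnit M A" "\<mu> \<cdot> (A \<triangleleft> \<eta>) = RUnit M A"
  using monoid by (simp_all add: monoid_in_def)

lemmas mult_unit_rules [simp] =
  mult_unit mult_unit[THEN comp2_tail] mult_unit[THEN lwhisker2] mult_unit[THEN lwhisker2_tail]
  mult_unit[THEN rwhisker2] mult_unit[THEN rwhisker2_tail]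

abbreviation lu :: "('o, 'a) bimod \<Rightarrow> 'a" where "lu x \<equiv> barr (bimod_lunit M q m x)"
abbreviation ru :: "('o, 'a) bimod \<Rightarrow> 'a" where "ru x \<equiv> barr (bimod_runit M q m x)"

lemma bdom_bcod_unit [simp]:
  "bdom (bimod_lunit M q m x) = T (regular m) x" "bcod (bimod_lunit M q m x) = x"
  "bdom (bimod_runit M q m x) = T x (regular m)" "bcod (bimod_runit M q m x) = x"
  by (simp_all add: bimod_lunit_def bimod_runit_def Let_def)

text \<open>That \<open>lact x\<close> coequalizes the pair for \<open>regular m\<close> and
  \<open>x\<close> is the associativity of the left action.\<close>

lemma lu_ex1:
  assumes [simp]: "bim x"
  shows "\<exists>!h. h \<in> Hom M (carr (T (regular m) x)) (carr x) \<and> h \<cdot> Q (regular m) x = lact x"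
  by (rule Q_desc) simp_all

lemma ru_ex1:
  assumes [simp]: "bim x"
  shows "\<exists>!h. h \<in> Hom M (carr (T x (regular m))) (carr x) \<and> h \<cdot> Q x (regular m) = ract x"
  by (rule Q_desc) simp_all

lemma lu_T:
  assumes [simp]: "bim x"
  shows "lu x \<in> Arr M" and "Dom M (lu x) = carr (T (regular m) x)" and "Cod M (lu x) = carr x"
    and "lu x \<cdot> Q (regular m) x = lact x"
  using theI'[OF lu_ex1[OF assms]] by (auto simp: bimod_lunit_def Let_def Hom_def)

lemma ru_T:
  assumes [simp]: "bim x"
  shows "ru x \<in> Arr M" and "Dom M (ru x) = carr (T x (regular m))" and "Cod M (ru x) = carr x"
    and "ru x \<cdot> Q x (regular m) = ract x"
  using theI'[OF ru_ex1[OF assms]] by (auto simp: bimod_runit_def Let_def Hom_def)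

lemmas lu_rules =
  lu_T(4) lu_T(4)[THEN comp2_tail] lu_T(4)[THEN lwhisker2] lu_T(4)[THEN lwhisker2_tail]
  lu_T(4)[THEN rwhisker2] lu_T(4)[THEN rwhisker2_tail]

lemmas ru_rules =
  ru_T(4) ru_T(4)[THEN comp2_tail] ru_T(4)[THEN lwhisker2] ru_T(4)[THEN lwhisker2_tail]
  ru_T(4)[THEN rwhisker2] ru_T(4)[THEN rwhisker2_tail]

lemma hom_lu:
  assumes [simp]: "bim x"
  shows "hom (bimod_lunit M q m x)"
proof (rule homI)
  note [simp] = lu_T(1-3)
  let ?Q = "Q (regular m) x"
  have "(lu x \<cdot> lact (T (regular m) x)) \<cdot> (A \<triangleleft> ?Q) = (lact x \<cdot> (A \<triangleleft> lu x)) \<cdot> (A \<triangleleft> ?Q)"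
    by (simp add: T_lact_rules lu_rules)
  then have "lu x \<cdot> lact (T (regular m) x) = lact x \<cdot> (A \<triangleleft> lu x)"
    by (rule epiD[rotated]) simp_all
  then show "lu x \<cdot> lact (bdom (bimod_lunit M q m x)) = lact (bcod (bimod_lunit M q m x)) \<cdot> (A \<triangleleft> lu x)"
    by simp
  have "(lu x \<cdot> ract (T (regular m) x)) \<cdot> (?Q \<triangleright> A) \<cdot> \<alpha> A (carr x) A
    = (ract x \<cdot> (lu x \<triangleright> A)) \<cdot> (?Q \<triangleright> A) \<cdot> \<alpha> A (carr x) A"
    using T_ract(4)[of "regular m" x] by (simp add: lu_rules)
  then have "lu x \<cdot> ract (T (regular m) x) = ract x \<cdot> (lu x \<triangleright> A)"
    by (rule epiD[rotated]) simp_all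
  then show "lu x \<cdot> ract (bdom (bimod_lunit M q m x)) = ract (bcod (bimod_lunit M q m x)) \<cdot> (lu x \<triangleright> A)"
    by simp
qed (simp_all add: lu_T)

declare hom_lu [unfolded bdom_bcod_unit, simp]
declare lu_T(1-3) [simp]

lemma hom_ru:
  assumes [simp]: "bim x"
  shows "hom (bimod_runit M q m x)"
proof (rule homI)
  note [simp] = ru_T(1-3)
  let ?Q = "Q x (regular m)"
  have "(ru x \<cdot> lact (T x (regular m))) \<cdot> (A \<triangleleft> ?Q) = (lact x \<cdot> (A \<triangleleft> ru x)) \<cdot> (A \<triangleleft> ?Q)"
    using T_lact(4)[of x "regular m"] by (simp add: ru_rules)
  then have "ru x \<cdot> lact (T x (regular m)) = lact x \<cdot> (A \<triangleleft> ru x)"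
    by (rule epiD[rotated]) simp_all
  then show "ru x \<cdot> lact (bdom (bimod_runit M q m x)) = lact (bcod (bimod_runit M q m x)) \<cdot> (A \<triangleleft> ru x)"
    by simp
  have "(ru x \<cdot> ract (T x (regular m))) \<cdot> (?Q \<triangleright> A) \<cdot> \<alpha> (carr x) A A
    = (ract x \<cdot> (ru x \<triangleright> A)) \<cdot> (?Q \<triangleright> A) \<cdot> \<alpha> (carr x) A A"
    using T_ract(4)[of x "regular m"] by (simp add: ru_rules)
  then have "ru x \<cdot> ract (T x (regular m)) = ract x \<cdot> (ru x \<triangleright> A)"
    by (rule epiD[rotated]) simp_all
  then show "ru x \<cdot> ract (bdom (bimod_runit M q m x)) = ract (bcod (bimod_runit M q m x)) \<cdot> (ru x \<triangleright> A)"
    by simp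
qed (simp_all add: ru_T)

declare hom_ru [unfolded bdom_bcod_unit, simp]
declare ru_T(1-3) [simp]

text \<open>The inverse inserts the unit of the monoid on the left and projects to the tensor
  product. One composite is the unit law of the action; the other moves the action across the
  coequalizer and then uses the unit law of the monoid.\<close>

lemma lu_inverse:
  assumes [simp]: "bim x"
  shows "\<exists>b. b \<in> Hom M (carr x) (carr (T (regular m) x)) \<and>
    b \<cdot> lu x = Ident M (carr (T (regular m) x)) \<and> lu x \<cdot> b = Ident M (carr x)"
proof -
  let ?X = "carr x" and ?Q = "Q (regular m) x"
  let ?b = "?Q \<cdot> (\<eta> \<triangleright> ?X) \<cdot> inv_arr (LUnit M ?X)"
  \<comment> \<open>The appended unit constraint turns, by naturality, into one at \<open>?X\<close>
    that cancels the inverse inside \<open>?b\<close>.\<close>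
  have "((?b \<cdot> lu x) \<cdot> ?Q) \<cdot> LUnit M (A \<otimes>\<^sub>o ?X)
      = ?Q \<cdot> (\<eta> \<triangleright> ?X) \<cdot> inv_arr (LUnit M ?X) \<cdot> LUnit M ?X \<cdot> (I \<triangleleft> lact x)"
    by (simp add: lu_rules del: inv_arr_comp inv_arr(4))
  also have "\<dots> = ?Q \<cdot> (A \<triangleleft> lact x) \<cdot> (\<eta> \<triangleright> (A \<otimes>\<^sub>o ?X))"
    by (simp del: unit_natural_tail lunit_natural)
  also have "\<dots> = ?Q \<cdot> (\<mu> \<triangleright> ?X) \<cdot> \<alpha> A A ?X \<cdot> (\<eta> \<triangleright> (A \<otimes>\<^sub>o ?X))"
    using Q_balanced[of "regular m" x, THEN comp2_tail] by (simp del: exch assoc_nat)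
  also have "\<dots> = (Ident M (carr (T (regular m) x)) \<cdot> ?Q) \<cdot> LUnit M (A \<otimes>\<^sub>o ?X)"
    by simp
  finally have "(?b \<cdot> lu x) \<cdot> ?Q = Ident M (carr (T (regular m) x)) \<cdot> ?Q"
    by (rule epiD[rotated]) simp_all
  then have "?b \<cdot> lu x = Ident M (carr (T (regular m) x))"
    by (rule epiD[rotated]) simp_all
  moreover have "lu x \<cdot> ?b = Ident M ?X"
    by (simp add: lu_rules)
  moreover have "?b \<in> Hom M ?X (carr (T (regular m) x))"
    by (rule HomI) simp_all
  ultimately show ?thesis
    by blast
qed

lemma ru_inverse:
  assumes [simp]: "bim x"
  shows "\<exists>b. b \<in> Hom M (carr x) (carr (T x (regular m))) \<and>
    b \<cdot> ru x = Ident M (carr (T x (regular m))) \<and> ru x \<cdot> b = Ident M (carr x)"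
proof -
  let ?X = "carr x" and ?Q = "Q x (regular m)"
  let ?b = "?Q \<cdot> (?X \<triangleleft> \<eta>) \<cdot> inv_arr (RUnit M ?X)"
  \<comment> \<open>The additional associator turns the unit constraint of the product into
    \<open>?X \<triangleleft> RUnit M A\<close>, the form in which the right unit law of the monoid
    produces it.\<close>
  have "((?b \<cdot> ru x) \<cdot> ?Q) \<cdot> RUnit M (?X \<otimes>\<^sub>o A) \<cdot> \<alpha> ?X A I
      = ?Q \<cdot> (?X \<triangleleft> \<eta>) \<cdot> inv_arr (RUnit M ?X) \<cdot> RUnit M ?X \<cdot> (ract x \<triangleright> I) \<cdot> \<alpha> ?X A I"
    by (simp add: ru_rules del: inv_arr_comp inv_arr(4))
  also have "\<dots> = ?Q \<cdot> (ract x \<triangleright> A) \<cdot> \<alpha> ?X A A \<cdot> (?X \<triangleleft> (A \<triangleleft> \<eta>))"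
    by (simp del: unit_natural_tail runit_natural)
  also have "\<dots> = ?Q \<cdot> (?X \<triangleleft> \<mu>) \<cdot> (?X \<triangleleft> (A \<triangleleft> \<eta>))"
    using Q_balanced[of x "regular m", THEN comp2_tail] by (simp del: exch assoc_nat mult_unit_rules)
  also have "\<dots> = (Ident M (carr (T x (regular m))) \<cdot> ?Q) \<cdot> RUnit M (?X \<otimes>\<^sub>o A) \<cdot> \<alpha> ?X A I"
    by simp
  finally have "(?b \<cdot> ru x) \<cdot> ?Q = Ident M (carr (T x (regular m))) \<cdot> ?Q"
    by (rule epiD[rotated]) simp_all
  then have "?b \<cdot> ru x = Ident M (carr (T x (regular m)))"
    by (rule epiD[rotated]) simp_all
  moreover have "ru x \<cdot> ?b = Ident M ?X"
    by (simp add: ru_rules)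
  moreover have "?b \<in> Hom M ?X (carr (T x (regular m)))"
    by (rule HomI) simp_all
  ultimately show ?thesis
    by blast
qed

lemma lu_natural:
  assumes [simp]: "hom f"
  shows "lu (bcod f) \<cdot> barr (TA (bident (regular m)) f) = barr f \<cdot> lu (bdom f)"
proof -
  have "(lu (bcod f) \<cdot> barr (TA (bident (regular m)) f)) \<cdot> Q (regular m) (bdom f)
     = (barr f \<cdot> lu (bdom f)) \<cdot> Q (regular m) (bdom f)"
    by (simp add: TA_rules lu_rules)
  then show ?thesis
    by (rule epiD[rotated]) simp_all
qed

lemma ru_natural:
  assumes [simp]: "hom f"
  shows "ru (bcod f) \<cdot> barr (TA f (bident (regular m))) = barr f \<cdot> ru (bdom f)"
proof -
  have "(ru (bcod f) \<cdot> barr (TA f (bident (regular m)))) \<cdot> Q (bdom f) (regular m)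
     = (barr f \<cdot> ru (bdom f)) \<cdot> Q (bdom f) (regular m)"
    by (simp add: TA_rules ru_rules)
  then show ?thesis
    by (rule epiD[rotated]) simp_all
qed

text \<open>On the threefold coequalizer the two unit constraints become the right action on
  \<open>x\<close> and the left action on \<open>y\<close>, so the triangle is the balancing of
  \<open>Q x y\<close>.\<close>

lemma T_triangle:
  assumes [simp]: "bim x" "bim y"
  shows "barr (TA (bimod_runit M q m x) (bident y)) \<cdot> assoc x (regular m) y
    = barr (TA (bident x) (bimod_lunit M q m y))"
proof -
  let ?e = "Q x (T (regular m) y) \<cdot> (carr x \<triangleleft> Q (regular m) y)"
  have "(barr (TA (bimod_runit M q m x) (bident y)) \<cdot> assoc x (regular m) y) \<cdot> ?e
    = barr (TA (bident x) (bimod_lunit M q m y)) \<cdot> ?e"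
    by (simp add: TA_rules assoc_T(4) ru_rules lu_rules Q_balanced)
  then show ?thesis
    by (rule epiD[rotated]) simp_all
qed

section \<open>Assembling the monoidal category of bimodules\<close>

lemma TA_ident:
  assumes [simp]: "bim x" "bim y"
  shows "barr (TA (bident x) (bident y)) = Ident M (carr (T x y))"
proof -
  have "barr (TA (bident x) (bident y)) \<cdot> Q x y = Ident M (carr (T x y)) \<cdot> Q x y"
    by (simp add: TA_rules)
  then show ?thesis
    by (rule epiD[rotated]) (simp_all add: TA_arr)
qed

lemma TA_comp:
  assumes hom: "hom f" "hom g" and [simp]: "hom f'" "hom g'" "bcod f = bdom f'" "bcod g = bdom g'"
  shows "barr (TA (BArr (bdom f) (barr f' \<cdot> barr f) (bcod f')) (BArr (bdom g) (barr g' \<cdot> barr g) (bcod g')))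
    = barr (TA f' g') \<cdot> barr (TA f g)"
proof -
  note [simp] = hom[unfolded assms(5,6)] hom_arr[OF hom(1), unfolded assms(5)] hom_arr[OF hom(2), unfolded assms(6)]
  have [simp]: "bimodule_hom M m (bdom f) (barr f' \<cdot> barr f) (bcod f')"
      "bimodule_hom M m (bdom g) (barr g' \<cdot> barr g) (bcod g')"
    using bimodule_hom_comp[OF hom(1)[unfolded assms(5)] assms(3)]
      bimodule_hom_comp[OF hom(2)[unfolded assms(6)] assms(4)] by simp_all
  have "barr (TA (BArr (bdom f) (barr f' \<cdot> barr f) (bcod f')) (BArr (bdom g) (barr g' \<cdot> barr g) (bcod g'))) \<cdot>
      Q (bdom f) (bdom g) = (barr (TA f' g') \<cdot> barr (TA f g)) \<cdot> Q (bdom f) (bdom g)"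
    by (simp add: TA_rules)
  then show ?thesis
    by (rule epiD[rotated]) (simp_all add: TA_arr)
qed

abbreviation bcat :: "(('o, 'a) bimod, ('o, 'a) bimod_arr) moncat" where
  "bcat \<equiv> bimod_cat M q m"

lemma bimod_cat_simps:
  "Obj bcat = {x. bim x}" "Arr bcat = {f. hom f}" "Dom bcat = bdom" "Cod bcat = bcod"
  "Ident bcat x = bident x" "Comp bcat g f = BArr (bdom f) (barr g \<cdot> barr f) (bcod g)"
  "TensO bcat = T" "TensA bcat = TA" "Unit bcat = regular m"
  "Assoc bcat = bimod_assoc M q m" "LUnit bcat = bimod_lunit M q m" "RUnit bcat = bimod_runit M q m"
  by (simp_all add: bimod_cat_def)

lemma Hom_bimod_cat: "f \<in> Hom bcat x y \<longleftrightarrow> hom f \<and> bdom f = x \<and> bcod f = y"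
  by (simp add: Hom_def bimod_cat_simps)

lemma bimod_iso:
  assumes f: "hom f"
    and "\<exists>b. b \<in> Hom M (carr (bcod f)) (carr (bdom f)) \<and>
      b \<cdot> barr f = Ident M (carr (bdom f)) \<and> barr f \<cdot> b = Ident M (carr (bcod f))"
  shows "iso bcat f"
proof -
  obtain b where b: "b \<in> Hom M (carr (bcod f)) (carr (bdom f))"
    and bf: "b \<cdot> barr f = Ident M (carr (bdom f))" "barr f \<cdot> b = Ident M (carr (bcod f))"
    using assms(2) by blast
  then have "bimodule_hom M m (bcod f) b (bdom f)"
    using bimodule_hom_inverse[OF f arrI[OF b] bf] by simp
  then show ?thesis
    using f bf unfolding iso_def
    by (intro conjI bexI[of _ "BArr (bcod f) b (bdom f)"])
      (simp_all add: bimod_cat_simps Hom_bimod_cat)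
qed

lemma hom_comp:
  "\<lbrakk>hom f; hom g; bcod f = bdom g\<rbrakk> \<Longrightarrow> bimodule_hom M m (bdom f) (barr g \<cdot> barr f) (bcod g)"
  using bimodule_hom_comp[of m "bdom f" "barr f" "bcod f" "barr g" "bcod g"] by simp

lemma category_bimod_cat: "category bcat"
proof (rule category.intro)
  fix f g h x y z w
  show "Dom bcat f \<in> Obj bcat" "Cod bcat f \<in> Obj bcat" if "f \<in> Arr bcat"
    using that by (simp_all add: bimod_cat_simps)
  show "Ident bcat x \<in> Hom bcat x x" if "x \<in> Obj bcat"
    using that by (simp add: bimod_cat_simps Hom_bimod_cat)
  show "g \<cdot>\<^bsub>bcat\<^esub> f \<in> Hom bcat x z" if "f \<in> Hom bcat x y" "g \<in> Hom bcat y z"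
    using that hom_comp[of f g] by (auto simp: bimod_cat_simps Hom_bimod_cat)
  \<comment> \<open>Arrows are triples, so equality is checked by components; sources and targets
    agree by rewriting, and the underlying arrow carries the content.\<close>
  show "f \<cdot>\<^bsub>bcat\<^esub> Ident bcat x = f" if "f \<in> Hom bcat x y"
    using that by (auto simp: bimod_cat_simps Hom_bimod_cat intro!: bimod_arr.expand)
  show "Ident bcat y \<cdot>\<^bsub>bcat\<^esub> f = f" if "f \<in> Hom bcat x y"
    using that by (auto simp: bimod_cat_simps Hom_bimod_cat intro!: bimod_arr.expand)
  show "(h \<cdot>\<^bsub>bcat\<^esub> g) \<cdot>\<^bsub>bcat\<^esub> f = h \<cdot>\<^bsub>bcat\<^esub> (g \<cdot>\<^bsub>bcat\<^esub> f)"
    if "f \<in> Hom bcat x y" "g \<in> Hom bcat y z" "h \<in> Hom bcat z w"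
    using that hom_arr[of f] hom_arr[of g] hom_arr[of h] by (auto simp: bimod_cat_simps Hom_bimod_cat)
qed

lemma monoidal_category_bimod_cat: "monoidal_category bcat"
proof (intro monoidal_category.intro category_bimod_cat monoidal_category_axioms.intro)
  note simps = bimod_cat_simps Hom_bimod_cat
  fix f f' g g' h x x' x'' y y' y'' z z' w
  show "x \<otimes>\<^sub>o\<^bsub>bcat\<^esub> y \<in> Obj bcat" if "x \<in> Obj bcat" "y \<in> Obj bcat"
    using that by (simp add: simps)
  show "f \<otimes>\<^sub>a\<^bsub>bcat\<^esub> g \<in> Hom bcat (x \<otimes>\<^sub>o\<^bsub>bcat\<^esub> y) (x' \<otimes>\<^sub>o\<^bsub>bcat\<^esub> y')"
    if "f \<in> Hom bcat x x'" "g \<in> Hom bcat y y'"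
    using that by (auto simp: simps)
  show "Ident bcat x \<otimes>\<^sub>a\<^bsub>bcat\<^esub> Ident bcat y = Ident bcat (x \<otimes>\<^sub>o\<^bsub>bcat\<^esub> y)"
    if "x \<in> Obj bcat" "y \<in> Obj bcat"
    using that by (intro bimod_arr.expand) (simp add: simps TA_ident)
  show "(f' \<cdot>\<^bsub>bcat\<^esub> f) \<otimes>\<^sub>a\<^bsub>bcat\<^esub> (g' \<cdot>\<^bsub>bcat\<^esub> g) = (f' \<otimes>\<^sub>a\<^bsub>bcat\<^esub> g') \<cdot>\<^bsub>bcat\<^esub> (f \<otimes>\<^sub>a\<^bsub>bcat\<^esub> g)"
    if "f \<in> Hom bcat x x'" "f' \<in> Hom bcat x' x''" "g \<in> Hom bcat y y'" "g' \<in> Hom bcat y' y''"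
    using that TA_comp[of f g f' g'] by (intro bimod_arr.expand) (auto simp: simps)
  show "Unit bcat \<in> Obj bcat"
    by (simp add: simps)
  show "Assoc bcat x y z \<in> Hom bcat (x \<otimes>\<^sub>o\<^bsub>bcat\<^esub> (y \<otimes>\<^sub>o\<^bsub>bcat\<^esub> z)) ((x \<otimes>\<^sub>o\<^bsub>bcat\<^esub> y) \<otimes>\<^sub>o\<^bsub>bcat\<^esub> z)"
    and "iso bcat (Assoc bcat x y z)"
    if "x \<in> Obj bcat" "y \<in> Obj bcat" "z \<in> Obj bcat"
    using that assoc_T_inverse[of x y z] by (auto simp: simps intro!: bimod_iso)
  show "Assoc bcat x' y' z' \<cdot>\<^bsub>bcat\<^esub> (f \<otimes>\<^sub>a\<^bsub>bcat\<^esub> (g \<otimes>\<^sub>a\<^bsub>bcat\<^esub> h))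
      = ((f \<otimes>\<^sub>a\<^bsub>bcat\<^esub> g) \<otimes>\<^sub>a\<^bsub>bcat\<^esub> h) \<cdot>\<^bsub>bcat\<^esub> Assoc bcat x y z"
    if "f \<in> Hom bcat x x'" "g \<in> Hom bcat y y'" "h \<in> Hom bcat z z'"
    using that assoc_T_natural[of f g h] by (intro bimod_arr.expand) (auto simp: simps)
  show "LUnit bcat x \<in> Hom bcat (Unit bcat \<otimes>\<^sub>o\<^bsub>bcat\<^esub> x) x" and "iso bcat (LUnit bcat x)"
    and "RUnit bcat x \<in> Hom bcat (x \<otimes>\<^sub>o\<^bsub>bcat\<^esub> Unit bcat) x" and "iso bcat (RUnit bcat x)"
    if "x \<in> Obj bcat"
    using that lu_inverse[of x] ru_inverse[of x] by (auto simp: simps intro!: bimod_iso)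
  show "LUnit bcat y \<cdot>\<^bsub>bcat\<^esub> (Ident bcat (Unit bcat) \<otimes>\<^sub>a\<^bsub>bcat\<^esub> f) = f \<cdot>\<^bsub>bcat\<^esub> LUnit bcat x"
    and "RUnit bcat y \<cdot>\<^bsub>bcat\<^esub> (f \<otimes>\<^sub>a\<^bsub>bcat\<^esub> Ident bcat (Unit bcat)) = f \<cdot>\<^bsub>bcat\<^esub> RUnit bcat x"
    if "f \<in> Hom bcat x y"
    using that lu_natural[of f] ru_natural[of f] by (auto simp: simps intro!: bimod_arr.expand)
  show "Assoc bcat (x \<otimes>\<^sub>o\<^bsub>bcat\<^esub> y) z w \<cdot>\<^bsub>bcat\<^esub> Assoc bcat x y (z \<otimes>\<^sub>o\<^bsub>bcat\<^esub> w)
      = (Assoc bcat x y z \<otimes>\<^sub>a\<^bsub>bcat\<^esub> Ident bcat w) \<cdot>\<^bsub>bcat\<^esub> Assoc bcat x (y \<otimes>\<^sub>o\<^bsub>bcat\<^esub> z) w \<cdot>\<^bsub>bcat\<^esub>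
        (Ident bcat x \<otimes>\<^sub>a\<^bsub>bcat\<^esub> Assoc bcat y z w)"
    if "x \<in> Obj bcat" "y \<in> Obj bcat" "z \<in> Obj bcat" "w \<in> Obj bcat"
    using that assoc_T_pentagon[of x y z w] by (intro bimod_arr.expand) (simp add: simps)
  show "(RUnit bcat x \<otimes>\<^sub>a\<^bsub>bcat\<^esub> Ident bcat y) \<cdot>\<^bsub>bcat\<^esub> Assoc bcat x (Unit bcat) y
      = Ident bcat x \<otimes>\<^sub>a\<^bsub>bcat\<^esub> LUnit bcat y"
    if "x \<in> Obj bcat" "y \<in> Obj bcat"
    using that T_triangle[of x y] by (intro bimod_arr.expand) (simp add: simps)
qed

end

section \<open>Calculating with lax monoidal functors\<close>

locale lax_functor_bimodules = monoidal_functor C M G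
  for C :: "('c, 'd) moncat" and M :: "('o, 'a) moncat" (structure)
    and G :: "('c, 'd, 'o, 'a) mfun" +
  fixes q :: "('o, 'a) mon \<Rightarrow> ('o, 'a) bimod \<Rightarrow> ('o, 'a) bimod \<Rightarrow> 'a"
  assumes preserve: "tensor_preserves_coequalizers M"
    and choice: "coequalizer_choice M q"
begin

abbreviation GO :: "'c \<Rightarrow> 'o" where "GO \<equiv> FunO G"
abbreviation GA :: "'d \<Rightarrow> 'a" where "GA \<equiv> FunA G"
abbreviation G2 :: "'c \<Rightarrow> 'c \<Rightarrow> 'a" where "G2 \<equiv> Fun2 G"
abbreviation e :: 'c where "e \<equiv> Unit C"

lemma functor_arr [simp]:
  "x \<in> Obj C \<Longrightarrow> GO x \<in> Obj M"
  "f \<in> Arr C \<Longrightarrow> GA f \<in> Arr M"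
  "f \<in> Arr C \<Longrightarrow> Dom M (GA f) = GO (Dom C f)"
  "f \<in> Arr C \<Longrightarrow> Cod M (GA f) = GO (Cod C f)"
  "\<lbrakk>x \<in> Obj C; y \<in> Obj C\<rbrakk> \<Longrightarrow> G2 x y \<in> Arr M"
  "\<lbrakk>x \<in> Obj C; y \<in> Obj C\<rbrakk> \<Longrightarrow> Dom M (G2 x y) = GO x \<otimes>\<^sub>o GO y"
  "\<lbrakk>x \<in> Obj C; y \<in> Obj C\<rbrakk> \<Longrightarrow> Cod M (G2 x y) = GO (x \<otimes>\<^sub>o\<^bsub>C\<^esub> y)"
  "Fun0 G \<in> Arr M" "Dom M (Fun0 G) = Unit M" "Cod M (Fun0 G) = GO e"
  using FunO_in[of x] FunA_in[of f "Dom C f" "Cod C f"] Fun2_in[of x y] Fun0_in by (auto simp: Hom_def)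

lemma functor_ident [simp]: "x \<in> Obj C \<Longrightarrow> GA (Ident C x) = Ident M (GO x)"
  by (rule Fun_Ident)

text \<open>Oriented so that images under \<open>G\<close> merge into one. Together with the next
  rules, which push the structure arrows to the right, this reduces a law about \<open>G\<close> to
  an equation in \<open>C\<close> under \<open>GA\<close>.\<close>

lemma functor_comp [simp]:
  "\<lbrakk>f \<in> Arr C; g \<in> Arr C; Cod C f = Dom C g\<rbrakk> \<Longrightarrow> GA g \<cdot> GA f = GA (g \<cdot>\<^bsub>C\<^esub> f)"
  using Fun_Comp[of f "Dom C f" "Cod C f" g "Cod C g"] by (simp add: Hom_def)

lemma functor2_natural:
  "\<lbrakk>f \<in> Arr C; g \<in> Arr C\<rbrakk> \<Longrightarrow> G2 (Cod C f) (Cod C g) \<cdot> (GA f \<otimes>\<^sub>a GA g)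
    = GA (f \<otimes>\<^sub>a\<^bsub>C\<^esub> g) \<cdot> G2 (Dom C f) (Dom C g)"
  using Fun2_natural[of f "Dom C f" "Cod C f" g "Dom C g" "Cod C g"] by (simp add: Hom_def)

lemma functor2_natural_right [simp]:
  "\<lbrakk>x \<in> Obj C; g \<in> Arr C; Cod C g = y\<rbrakk>
    \<Longrightarrow> G2 x y \<cdot> (GO x \<triangleleft> GA g) = GA (x \<triangleleft>\<^bsub>C\<^esub> g) \<cdot> G2 x (Dom C g)"
  using functor2_natural[of "Ident C x" g] by simp

lemma functor2_natural_left [simp]:
  "\<lbrakk>y \<in> Obj C; f \<in> Arr C; Cod C f = x\<rbrakk>
    \<Longrightarrow> G2 x y \<cdot> (GA f \<triangleright> GO y) = GA (f \<triangleright>\<^bsub>C\<^esub> y) \<cdot> G2 (Dom C f) y"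
  using functor2_natural[of f "Ident C y"] by simp

lemma functor_assoc [simp]:
  "\<lbrakk>x \<in> Obj C; y \<in> Obj C; z \<in> Obj C\<rbrakk>
    \<Longrightarrow> G2 (x \<otimes>\<^sub>o\<^bsub>C\<^esub> y) z \<cdot> (G2 x y \<triangleright> GO z) \<cdot> Assoc M (GO x) (GO y) (GO z)
      = GA (Assoc C x y z) \<cdot> G2 x (y \<otimes>\<^sub>o\<^bsub>C\<^esub> z) \<cdot> (GO x \<triangleleft> G2 y z)"
  by (simp add: Fun_Assoc)

lemma functor_unit [simp]:
  "x \<in> Obj C \<Longrightarrow> GA (LUnit C x) \<cdot> G2 e x \<cdot> (Fun0 G \<triangleright> GO x) = LUnit M (GO x)"
  "x \<in> Obj C \<Longrightarrow> GA (RUnit C x) \<cdot> G2 x e \<cdot> (GO x \<triangleleft> Fun0 G) = RUnit M (GO x)"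
  by (simp_all add: Fun_LUnit Fun_RUnit)

lemmas functor_tail [simp] =
  functor_comp[THEN target.comp2_tail]
  functor2_natural_right[THEN target.comp2_tail] functor2_natural_left[THEN target.comp2_tail]
  functor_assoc[THEN target.comp3_tail] functor_unit[THEN target.comp3_tail]


section \<open>The canonical monoid and the factorization\<close>

definition R :: "('o, 'a) mon" where
  "R = Mon (GO e) (GA (LUnit C e) \<cdot> G2 e e) (Fun0 G)"

definition UO :: "'c \<Rightarrow> ('o, 'a) bimod" where
  "UO x = Bimod (GO x) (GA (LUnit C x) \<cdot> G2 e x) (GA (RUnit C x) \<cdot> G2 x e)"

lemma R_simps: "mobj R = GO e" "mult R = GA (LUnit C e) \<cdot> G2 e e" "unt R = Fun0 G"
  by (simp_all add: R_def)

lemma UO_simps [simp]: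
  "carr (UO x) = GO x" "lact (UO x) = GA (LUnit C x) \<cdot> G2 e x" "ract (UO x) = GA (RUnit C x) \<cdot> G2 x e"
  by (simp_all add: UO_def)

text \<open>The right action on \<open>UO e\<close> is built from \<open>RUnit C e\<close> but the
  multiplication from \<open>LUnit C e\<close>; the two constraints coincide at the unit
  object.\<close>

lemma regular_R: "regular R = UO e"
  by (simp add: regular_def R_def UO_def source.lunit_eq_runit)

text \<open>Each associativity law reduces to an equation between unit constraints and associators
  in \<open>C\<close>, supplied by the triangle, naturality and the derived coherence laws; the unit
  laws are the unit coherence of \<open>G\<close>.\<close>

lemma bimodule_UO [simp]:
  assumes [simp]: "x \<in> Obj C"
  shows "bimodule M R (UO x)"
  unfolding bimodule_def R_simps by (simp add: Hom_def)

text \<open>The monoid laws are the bimodule laws of \<open>UO e\<close>, read with equal left and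
  right unit constraints at \<open>e\<close>.\<close>

lemma monoid_R: "monoid_in M R"
  using bimodule_UO[of e] Fun0_in unfolding bimodule_def monoid_in_def
  by (simp add: R_simps source.lunit_eq_runit)

sublocale R: bimodules M q R
  using preserve choice monoid_R by unfold_locales

lemmas R_T_lact_rules = R.T_lact_rules[unfolded R_simps]

section \<open>The functor into bimodules over the canonical monoid\<close>

lemma u2_ex1:
  assumes [simp]: "x \<in> Obj C" "y \<in> Obj C"
  shows "\<exists>!k. k \<in> Hom M (carr (R.T (UO x) (UO y))) (GO (x \<otimes>\<^sub>o\<^bsub>C\<^esub> y)) \<and> k \<cdot> q R (UO x) (UO y) = G2 x y"
  by (rule R.Q_desc) (simp_all add: R_simps)

definition U2 :: "'c \<Rightarrow> 'c \<Rightarrow> ('o, 'a) bimod_arr" where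
  "U2 x y = BArr (R.T (UO x) (UO y))
    (THE k. k \<in> Hom M (carr (R.T (UO x) (UO y))) (GO (x \<otimes>\<^sub>o\<^bsub>C\<^esub> y)) \<and> k \<cdot> q R (UO x) (UO y) = G2 x y)
    (UO (x \<otimes>\<^sub>o\<^bsub>C\<^esub> y))"

text \<open>An identity is available as unit constraint because the regular bimodule of
  \<open>R\<close> is the value of the functor at \<open>e\<close>.\<close>

definition U :: "('c, 'd, ('o, 'a) bimod, ('o, 'a) bimod_arr) mfun" where
  "U = \<lparr>FunO = UO, FunA = (\<lambda>f. BArr (UO (Dom C f)) (GA f) (UO (Cod C f))),
    Fun2 = U2, Fun0 = R.bident (regular R)\<rparr>"

lemma U2_bdom_bcod [simp]:
  "bdom (U2 x y) = R.T (UO x) (UO y)" "bcod (U2 x y) = UO (x \<otimes>\<^sub>o\<^bsub>C\<^esub> y)"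
  by (simp_all add: U2_def)

lemma U2:
  assumes [simp]: "x \<in> Obj C" "y \<in> Obj C"
  shows "barr (U2 x y) \<in> Arr M" and "Dom M (barr (U2 x y)) = carr (R.T (UO x) (UO y))"
    and "Cod M (barr (U2 x y)) = GO (x \<otimes>\<^sub>o\<^bsub>C\<^esub> y)"
    and "barr (U2 x y) \<cdot> q R (UO x) (UO y) = G2 x y"
  using theI'[OF u2_ex1[OF assms]] by (auto simp: U2_def Hom_def)

declare U2(1-3) [simp]

lemmas U2_rules [simp] =
  U2(4) U2(4)[THEN target.comp2_tail]
  U2(4)[THEN target.lwhisker2] U2(4)[THEN target.lwhisker2_tail]
  U2(4)[THEN target.rwhisker2] U2(4)[THEN target.rwhisker2_tail]

text \<open>Linearity of \<open>GA f\<close> is naturality of the structure arrows of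
  \<open>G\<close> and of the unit constraints of \<open>C\<close>.\<close>

lemma hom_UA [simp]:
  "f \<in> Arr C \<Longrightarrow> bimodule_hom M R (UO (Dom C f)) (GA f) (UO (Cod C f))"
  by (simp add: bimodule_hom_def Hom_def R_simps)

lemma hom_U2 [simp]:
  assumes [simp]: "x \<in> Obj C" "y \<in> Obj C"
  shows "bimodule_hom M R (R.T (UO x) (UO y)) (barr (U2 x y)) (UO (x \<otimes>\<^sub>o\<^bsub>C\<^esub> y))"
proof -
  let ?k = "barr (U2 x y)" and ?Q = "q R (UO x) (UO y)" and ?T = "R.T (UO x) (UO y)"
  \<comment> \<open>Typing facts are restated with \<open>GO e\<close> in place of
    \<open>mobj R\<close>, the form that occurs in the equations below.\<close>
  have [simp]: "lact ?T \<in> Arr M" "Dom M (lact ?T) = GO e \<otimes>\<^sub>o carr ?T" "Cod M (lact ?T) = carr ?T"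
    "ract ?T \<in> Arr M" "Dom M (ract ?T) = carr ?T \<otimes>\<^sub>o GO e" "Cod M (ract ?T) = carr ?T"
    by (simp_all add: R_simps)
  have "(?k \<cdot> lact ?T) \<cdot> (GO e \<triangleleft> ?Q) = (lact (UO (x \<otimes>\<^sub>o\<^bsub>C\<^esub> y)) \<cdot> (GO e \<triangleleft> ?k)) \<cdot> (GO e \<triangleleft> ?Q)"
    by (simp add: R_T_lact_rules)
  then have l: "?k \<cdot> lact ?T = lact (UO (x \<otimes>\<^sub>o\<^bsub>C\<^esub> y)) \<cdot> (GO e \<triangleleft> ?k)"
    by (rule target.epiD[rotated]) simp_all
  have "(?k \<cdot> ract ?T) \<cdot> (?Q \<triangleright> GO e) \<cdot> Assoc M (GO x) (GO y) (GO e)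
      = (ract (UO (x \<otimes>\<^sub>o\<^bsub>C\<^esub> y)) \<cdot> (?k \<triangleright> GO e)) \<cdot> (?Q \<triangleright> GO e) \<cdot> Assoc M (GO x) (GO y) (GO e)"
    using R.T_ract(4)[of "UO x" "UO y"] by (simp add: R_simps)
  then have r: "?k \<cdot> ract ?T = ract (UO (x \<otimes>\<^sub>o\<^bsub>C\<^esub> y)) \<cdot> (?k \<triangleright> GO e)"
    by (rule target.epiD[rotated]) simp_all
  show ?thesis
    unfolding bimodule_hom_def R_simps by (intro conjI target.HomI l r) simp_all
qed

lemma U2_natural:
  assumes [simp]: "f \<in> Arr C" "g \<in> Arr C"
  shows "GA (f \<otimes>\<^sub>a\<^bsub>C\<^esub> g) \<cdot> barr (U2 (Dom C f) (Dom C g))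
    = barr (U2 (Cod C f) (Cod C g)) \<cdot>
      barr (R.TA (BArr (UO (Dom C f)) (GA f) (UO (Cod C f))) (BArr (UO (Dom C g)) (GA g) (UO (Cod C g))))"
    (is "?l = ?r")
proof -
  have "?l \<cdot> q R (UO (Dom C f)) (UO (Dom C g)) = ?r \<cdot> q R (UO (Dom C f)) (UO (Dom C g))"
    using source.tens_whisker[of f g] by (simp add: R.TA_rules)
  then show ?thesis
    by (rule target.epiD[rotated]) simp_all
qed

lemma bident_UO_hom [simp]: "x \<in> Obj C \<Longrightarrow> bimodule_hom M R (UO x) (Ident M (GO x)) (UO x)"
  using R.bident_hom[of "UO x"] by simp

text \<open>On the threefold coequalizer every \<open>U2\<close> becomes the corresponding
  \<open>G2\<close>, and the equation is the associativity coherence of \<open>G\<close>.\<close>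

lemma U2_assoc:
  assumes [simp]: "x \<in> Obj C" "y \<in> Obj C" "z \<in> Obj C"
  shows "GA (Assoc C x y z) \<cdot> barr (U2 x (y \<otimes>\<^sub>o\<^bsub>C\<^esub> z)) \<cdot>
      barr (R.TA (BArr (UO x) (Ident M (GO x)) (UO x)) (U2 y z))
    = barr (U2 (x \<otimes>\<^sub>o\<^bsub>C\<^esub> y) z) \<cdot> barr (R.TA (U2 x y) (BArr (UO z) (Ident M (GO z)) (UO z))) \<cdot>
      R.assoc (UO x) (UO y) (UO z)"
    (is "?l = ?r")
proof -
  let ?e = "q R (UO x) (R.T (UO y) (UO z)) \<cdot> (GO x \<triangleleft> q R (UO y) (UO z))"
  have "?l \<cdot> ?e = ?r \<cdot> ?e"
    using R.assoc_T(4)[of "UO x" "UO y" "UO z"] by (simp add: R.TA_rules)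
  then show ?thesis
    by (rule target.epiD[rotated]) simp_all
qed

text \<open>The actions on \<open>UO x\<close> were defined as the composites of \<open>G2\<close>
  with the image of a unit constraint, so the left-hand sides satisfy the equations that
  characterise the unit constraints of bimodules.\<close>

lemma U2_unit:
  assumes [simp]: "x \<in> Obj C"
  shows "GA (LUnit C x) \<cdot> barr (U2 e x) = R.lu (UO x)"
    and "GA (RUnit C x) \<cdot> barr (U2 x e) = R.ru (UO x)"
proof -
  note [simp] = R.lu_T(2) [unfolded regular_R] R.ru_T(2) [unfolded regular_R]
  have "(GA (LUnit C x) \<cdot> barr (U2 e x)) \<cdot> q R (UO e) (UO x) = R.lu (UO x) \<cdot> q R (UO e) (UO x)"
    using R.lu_T(4)[of "UO x", unfolded regular_R] by simp
  then show "GA (LUnit C x) \<cdot> barr (U2 e x) = R.lu (UO x)"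
    by (rule target.epiD[rotated]) (simp_all add: regular_R)
  have "(GA (RUnit C x) \<cdot> barr (U2 x e)) \<cdot> q R (UO x) (UO e) = R.ru (UO x) \<cdot> q R (UO x) (UO e)"
    using R.ru_T(4)[of "UO x", unfolded regular_R] by simp
  then show "GA (RUnit C x) \<cdot> barr (U2 x e) = R.ru (UO x)"
    by (rule target.epiD[rotated]) (simp_all add: regular_R)
qed

lemma U_simps:
  "FunO U x = UO x" "FunA U f = BArr (UO (Dom C f)) (GA f) (UO (Cod C f))" "Fun2 U x y = U2 x y"
  "Fun0 U = R.bident (UO e)"
  by (simp_all add: U_def regular_R)

lemma monoidal_functor_U: "monoidal_functor C R.bcat U"
proof (intro monoidal_functor.intro monoidal_functor_axioms.intro
    source.monoidal_category_axioms R.monoidal_category_bimod_cat)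
  note simps = R.bimod_cat_simps R.Hom_bimod_cat U_simps
  fix f g x x' y y' z
  show "FunO U x \<in> Obj R.bcat" if "x \<in> Obj C"
    using that by (simp add: simps)
  show "FunA U f \<in> Hom R.bcat (FunO U x) (FunO U y)" if "f \<in> Hom C x y"
    using that by (auto simp: simps Hom_def)
  show "FunA U (Ident C x) = Ident R.bcat (FunO U x)" if "x \<in> Obj C"
    using that by (simp add: simps)
  show "FunA U (g \<cdot>\<^bsub>C\<^esub> f) = FunA U g \<cdot>\<^bsub>R.bcat\<^esub> FunA U f" if "f \<in> Hom C x y" "g \<in> Hom C y z"
    using source.arrI[OF that(1)] source.arrI[OF that(2)] by (simp add: simps)
  show "Fun2 U x y \<in> Hom R.bcat (FunO U x \<otimes>\<^sub>o\<^bsub>R.bcat\<^esub> FunO U y) (FunO U (x \<otimes>\<^sub>o\<^bsub>C\<^esub> y))"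
    if "x \<in> Obj C" "y \<in> Obj C"
    using that by (simp add: simps)
  show "Fun0 U \<in> Hom R.bcat (Unit R.bcat) (FunO U (Unit C))"
    by (simp add: simps regular_R)
  show "FunA U (f \<otimes>\<^sub>a\<^bsub>C\<^esub> g) \<cdot>\<^bsub>R.bcat\<^esub> Fun2 U x y
      = Fun2 U x' y' \<cdot>\<^bsub>R.bcat\<^esub> (FunA U f \<otimes>\<^sub>a\<^bsub>R.bcat\<^esub> FunA U g)"
    if "f \<in> Hom C x x'" "g \<in> Hom C y y'"
    using source.arrI[OF that(1)] source.arrI[OF that(2)] U2_natural[of f g] by (simp add: simps)
  show "FunA U (Assoc C x y z) \<cdot>\<^bsub>R.bcat\<^esub> Fun2 U x (y \<otimes>\<^sub>o\<^bsub>C\<^esub> z) \<cdot>\<^bsub>R.bcat\<^esub>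
        (Ident R.bcat (FunO U x) \<otimes>\<^sub>a\<^bsub>R.bcat\<^esub> Fun2 U y z)
      = Fun2 U (x \<otimes>\<^sub>o\<^bsub>C\<^esub> y) z \<cdot>\<^bsub>R.bcat\<^esub> (Fun2 U x y \<otimes>\<^sub>a\<^bsub>R.bcat\<^esub> Ident R.bcat (FunO U z)) \<cdot>\<^bsub>R.bcat\<^esub>
        Assoc R.bcat (FunO U x) (FunO U y) (FunO U z)"
    if "x \<in> Obj C" "y \<in> Obj C" "z \<in> Obj C"
    using that U2_assoc[of x y z] by (simp add: simps)
  show "FunA U (LUnit C x) \<cdot>\<^bsub>R.bcat\<^esub> Fun2 U (Unit C) x \<cdot>\<^bsub>R.bcat\<^esub>
      (Fun0 U \<otimes>\<^sub>a\<^bsub>R.bcat\<^esub> Ident R.bcat (FunO U x)) = LUnit R.bcat (FunO U x)"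
    and "FunA U (RUnit C x) \<cdot>\<^bsub>R.bcat\<^esub> Fun2 U x (Unit C) \<cdot>\<^bsub>R.bcat\<^esub>
      (Ident R.bcat (FunO U x) \<otimes>\<^sub>a\<^bsub>R.bcat\<^esub> Fun0 U) = RUnit R.bcat (FunO U x)"
    if "x \<in> Obj C"
    using that U2_unit[of x] R.TA_ident[of "UO e" "UO x"] R.TA_ident[of "UO x" "UO e"]
    by (auto simp: simps regular_R intro!: bimod_arr.expand)
qed

lemma strictly_unital_U: "strictly_unital R.bcat U"
  unfolding strictly_unital_def by (intro bexI[of _ "UO e"]) (simp_all add: R.bimod_cat_simps U_simps)

lemma forget_U: "mfun_eq C G (mfun_comp M (forget q R) U)"
  by (simp add: mfun_eq_def mfun_comp_def forget_def U_simps R_simps)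

end

section \<open>Comparison with an arbitrary factorization\<close>

locale lax_factorization = lax_functor_bimodules C M G q + S: bimodules M q S +
    V: monoidal_functor C "bimod_cat M q S" V
  for C :: "('c, 'd) moncat" and M :: "('o, 'a) moncat" (structure)
    and G :: "('c, 'd, 'o, 'a) mfun"
    and q :: "('o, 'a) mon \<Rightarrow> ('o, 'a) bimod \<Rightarrow> ('o, 'a) bimod \<Rightarrow> 'a"
    and S :: "('o, 'a) mon" and V :: "('c, 'd, ('o, 'a) bimod, ('o, 'a) bimod_arr) mfun" +
  assumes factor: "mfun_eq C G (mfun_comp M (forget q S) V)"
begin

definition \<sigma> :: 'a where "\<sigma> = barr (Fun0 V)"

lemma V_simps [simp]:
  "x \<in> Obj C \<Longrightarrow> carr (FunO V x) = GO x"
  "f \<in> Arr C \<Longrightarrow> barr (FunA V f) = GA f"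
  "\<sigma> \<cdot> unt S = Fun0 G"
  using factor by (simp_all add: mfun_eq_def mfun_comp_def forget_def \<sigma>_def)

lemma V2:
  "\<lbrakk>x \<in> Obj C; y \<in> Obj C\<rbrakk> \<Longrightarrow> barr (Fun2 V x y) \<cdot> q S (FunO V x) (FunO V y) = G2 x y"
  using factor by (simp add: mfun_eq_def mfun_comp_def forget_def)

lemma V_hom [simp]:
  "x \<in> Obj C \<Longrightarrow> bimodule M S (FunO V x)"
  "f \<in> Arr C \<Longrightarrow> bdom (FunA V f) = FunO V (Dom C f)"
  "f \<in> Arr C \<Longrightarrow> bcod (FunA V f) = FunO V (Cod C f)"
  "\<lbrakk>x \<in> Obj C; y \<in> Obj C\<rbrakk> \<Longrightarrow> bdom (Fun2 V x y) = S.T (FunO V x) (FunO V y)"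
  "\<lbrakk>x \<in> Obj C; y \<in> Obj C\<rbrakk> \<Longrightarrow> bcod (Fun2 V x y) = FunO V (x \<otimes>\<^sub>o\<^bsub>C\<^esub> y)"
  "bdom (Fun0 V) = regular S" "bcod (Fun0 V) = FunO V e"
  using V.FunO_in[of x] V.FunA_in[of f "Dom C f" "Cod C f"] V.Fun2_in[of x y] V.Fun0_in
  by (auto simp: S.bimod_cat_simps S.Hom_bimod_cat Hom_def)

lemma V2_hom [simp]:
  "\<lbrakk>x \<in> Obj C; y \<in> Obj C\<rbrakk> \<Longrightarrow>
    bimodule_hom M S (S.T (FunO V x) (FunO V y)) (barr (Fun2 V x y)) (FunO V (x \<otimes>\<^sub>o\<^bsub>C\<^esub> y))"
  and V0_hom [simp]: "bimodule_hom M S (regular S) \<sigma> (FunO V e)"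
  using V.Fun2_in[of x y] V.Fun0_in
  by (auto simp: S.bimod_cat_simps S.Hom_bimod_cat \<sigma>_def)

lemma V0_eq: "Fun0 V = BArr (regular S) \<sigma> (FunO V e)"
  by (rule bimod_arr.expand) (simp add: \<sigma>_def)

lemma \<sigma>_arr [simp]: "\<sigma> \<in> Arr M" "Dom M \<sigma> = mobj S" "Cod M \<sigma> = GO e"
  using target.bimodule_hom_arr[OF V0_hom] by simp_all

lemma V2_arr [simp]:
  "\<lbrakk>x \<in> Obj C; y \<in> Obj C\<rbrakk> \<Longrightarrow> barr (Fun2 V x y) \<in> Arr M"
  "\<lbrakk>x \<in> Obj C; y \<in> Obj C\<rbrakk> \<Longrightarrow> Dom M (barr (Fun2 V x y)) = carr (S.T (FunO V x) (FunO V y))"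
  "\<lbrakk>x \<in> Obj C; y \<in> Obj C\<rbrakk> \<Longrightarrow> Cod M (barr (Fun2 V x y)) = GO (x \<otimes>\<^sub>o\<^bsub>C\<^esub> y)"
  using target.bimodule_hom_arr[OF V2_hom[of x y]] by simp_all

lemma V_act:
  assumes [simp]: "x \<in> Obj C"
  shows "lact (FunO V x) = lact (UO x) \<cdot> (\<sigma> \<triangleright> GO x)"
    and "ract (FunO V x) = ract (UO x) \<cdot> (GO x \<triangleleft> \<sigma>)"
proof -
  note [simp] = V2[THEN target.comp2_tail] V2
  have [simp]: "bimodule_hom M S (FunO V x) (Ident M (GO x)) (FunO V x)"
    using S.bident_hom[of "FunO V x"] by simp
  have l: "GA (LUnit C x) \<cdot> barr (Fun2 V e x) \<cdot> barr (S.TA (Fun0 V) (S.bident (FunO V x)))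
      = S.lu (FunO V x)"
    using arg_cong[OF V.Fun_LUnit[OF assms], of barr] by (simp add: S.bimod_cat_simps)
  have "lact (FunO V x) = S.lu (FunO V x) \<cdot> q S (regular S) (FunO V x)"
    by (simp add: S.lu_rules)
  \<comment> \<open>Unit coherence of \<open>V\<close> replaces the unit constraint; past the
    coequalizer, the tensor of \<open>Fun0 V\<close> with an identity becomes \<sigma> whiskered by
    \<open>GO x\<close>, and \<open>Fun2 V e x\<close> becomes \<open>G2 e x\<close>.\<close>
  also have "\<dots> = lact (UO x) \<cdot> (\<sigma> \<triangleright> GO x)"
    unfolding l[symmetric] V0_eq by (simp add: S.TA_rules)
  finally show "lact (FunO V x) = lact (UO x) \<cdot> (\<sigma> \<triangleright> GO x)" .
  have r: "GA (RUnit C x) \<cdot> barr (Fun2 V x e) \<cdot> barr (S.TA (S.bident (FunO V x)) (Fun0 V))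
      = S.ru (FunO V x)"
    using arg_cong[OF V.Fun_RUnit[OF assms], of barr] by (simp add: S.bimod_cat_simps)
  have "ract (FunO V x) = S.ru (FunO V x) \<cdot> q S (FunO V x) (regular S)"
    by (simp add: S.ru_rules)
  also have "\<dots> = ract (UO x) \<cdot> (GO x \<triangleleft> \<sigma>)"
    unfolding r[symmetric] V0_eq by (simp add: S.TA_rules)
  finally show "ract (FunO V x) = ract (UO x) \<cdot> (GO x \<triangleleft> \<sigma>)" .
qed

lemma V_restrict: "x \<in> Obj C \<Longrightarrow> FunO V x = restrict_bimod M \<sigma> (UO x)"
  by (rule bimod.expand) (simp add: restrict_bimod_def V_act)

text \<open>The unit constraint of \<open>V\<close> is linear for the left action out of the regular
  bimodule. Since \<open>S\<close> acts on its target through \<sigma>, this linearity is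
  multiplicativity; compatibility with the units is the factorization of
  \<open>Fun0 G\<close>.\<close>

lemma monoid_hom_\<sigma>: "monoid_hom M S R \<sigma>"
proof -
  have "\<sigma> \<cdot> mult S = lact (FunO V e) \<cdot> (mobj S \<triangleleft> \<sigma>)"
    using target.bimodule_hom_act(1)[OF V0_hom] by simp
  also have "\<dots> = mult R \<cdot> (\<sigma> \<otimes>\<^sub>a \<sigma>)"
    using target.tens_whisker[of \<sigma> \<sigma>] by (simp add: V_act R_simps)
  finally show ?thesis
    by (simp add: monoid_hom_def R_simps Hom_def)
qed

text \<open>The coequalizer over \<open>R\<close> is balanced for \<open>S\<close> too, because the
  actions of \<open>S\<close> come from those of \<open>R\<close> along \<sigma>. It therefore
  descends to the coequalizer over \<open>S\<close>, and the description of the structure arrow of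
  restriction denotes.\<close>

lemma restrict2:
  assumes [simp]: "x \<in> Obj C" "y \<in> Obj C"
  shows "barr (Fun2 (restrict M q S R \<sigma>) (UO x) (UO y))
      \<in> Hom M (carr (S.T (FunO V x) (FunO V y))) (carr (R.T (UO x) (UO y)))"
    and "barr (Fun2 (restrict M q S R \<sigma>) (UO x) (UO y)) \<cdot> q S (FunO V x) (FunO V y) = q R (UO x) (UO y)"
proof -
  let ?Q = "q R (UO x) (UO y)" and ?X = "GO x" and ?Y = "GO y"
  have b: "?Q \<cdot> (?X \<triangleleft> lact (UO y)) = ?Q \<cdot> (ract (UO x) \<triangleright> ?Y) \<cdot> Assoc M ?X (GO e) ?Y"
    using R.Q_balanced[of "UO x" "UO y"] by (simp add: R_simps)
  have "?Q \<cdot> (?X \<triangleleft> lact (FunO V y)) = (?Q \<cdot> (?X \<triangleleft> lact (UO y))) \<cdot> (?X \<triangleleft> (\<sigma> \<triangleright> ?Y))"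
    by (simp add: V_act del: functor2_natural_right functor_tail)
  also have "\<dots> = ?Q \<cdot> (ract (FunO V x) \<triangleright> ?Y) \<cdot> Assoc M ?X (mobj S) ?Y"
    unfolding b by (simp add: V_act)
  finally have "\<exists>!k. k \<in> Hom M (carr (S.T (FunO V x) (FunO V y))) (carr (R.T (UO x) (UO y))) \<and>
      k \<cdot> q S (FunO V x) (FunO V y) = ?Q"
    by (intro S.Q_desc) simp_all
  from theI'[OF this]
  show "barr (Fun2 (restrict M q S R \<sigma>) (UO x) (UO y))
      \<in> Hom M (carr (S.T (FunO V x) (FunO V y))) (carr (R.T (UO x) (UO y)))"
    and "barr (Fun2 (restrict M q S R \<sigma>) (UO x) (UO y)) \<cdot> q S (FunO V x) (FunO V y) = ?Q"
    by (simp_all add: restrict_def Let_def restrict_bimod_def[of M \<sigma> "R.T _ _"] flip: V_restrict)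
qed

lemma V_factor: "mfun_eq C V (mfun_comp S.bcat (restrict M q S R \<sigma>) U)"
  unfolding mfun_eq_def
proof (intro conjI ballI)
  let ?F = "mfun_comp S.bcat (restrict M q S R \<sigma>) U"
  fix x y assume [simp]: "x \<in> Obj C" "y \<in> Obj C"
  show "FunO V x = FunO ?F x"
    by (simp add: mfun_comp_def restrict_def U_simps V_restrict)
  let ?k = "barr (Fun2 (restrict M q S R \<sigma>) (UO x) (UO y))"
  note [simp] = target.arrI[OF restrict2(1)[of x y]]
  \<comment> \<open>Both arrows become \<open>G2 x y\<close> on the chosen coequalizer over
    \<open>S\<close>, which is epi.\<close>
  have "barr (Fun2 V x y) \<cdot> q S (FunO V x) (FunO V y)
      = (barr (U2 x y) \<cdot> ?k) \<cdot> q S (FunO V x) (FunO V y)"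
    by (simp add: V2 restrict2(2))
  then have "barr (Fun2 V x y) = barr (U2 x y) \<cdot> ?k"
    by (rule target.epiD[rotated]) simp_all
  moreover have "barr (Fun2 ?F x y) = barr (U2 x y) \<cdot> ?k"
    by (simp add: mfun_comp_def restrict_def U_simps S.bimod_cat_simps Let_def)
  moreover have "bdom (Fun2 ?F x y) = bdom (Fun2 V x y)" "bcod (Fun2 ?F x y) = bcod (Fun2 V x y)"
    by (simp_all add: mfun_comp_def restrict_def U_simps S.bimod_cat_simps Let_def V_restrict)
  ultimately show "Fun2 V x y = Fun2 ?F x y"
    by (intro bimod_arr.expand) simp
next
  fix f assume [simp]: "f \<in> Arr C"
  show "FunA V f = FunA (mfun_comp S.bcat (restrict M q S R \<sigma>) U) f"
    by (rule bimod_arr.expand) (simp add: mfun_comp_def restrict_def U_simps V_restrict)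
next
  show "Fun0 V = Fun0 (mfun_comp S.bcat (restrict M q S R \<sigma>) U)"
    by (simp add: mfun_comp_def restrict_def U_simps S.bimod_cat_simps V0_eq V_restrict)
qed

text \<open>Comparing unit constraints is enough: that of \<open>U\<close> is an identity, so the
  composite with restriction along \<tau> has underlying unit arrow \<tau>, while that of
  \<open>V\<close> is \<sigma>.\<close>

lemma \<sigma>_unique:
  assumes "monoid_hom M S R \<tau>" and "mfun_eq C V (mfun_comp S.bcat (restrict M q S R \<tau>) U)"
  shows "\<tau> = \<sigma>"
proof -
  have "\<sigma> = Ident M (GO e) \<cdot> \<tau>"
    using assms(2)
    by (simp add: \<sigma>_def mfun_eq_def mfun_comp_def restrict_def U_simps S.bimod_cat_simps)
  then show ?thesis
    using assms(1) by (simp add: monoid_hom_def R_simps Hom_def)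
qed

end

theorem theorem2p2:
  fixes M :: "('o, 'a) moncat"
    and C :: "('c, 'd) moncat"
    and G :: "('c, 'd, 'o, 'a) mfun"
    and q :: "('o, 'a) mon \<Rightarrow> ('o, 'a) bimod \<Rightarrow> ('o, 'a) bimod \<Rightarrow> 'a"
  assumes "monoidal_category M"
    and "has_coequalizers M"
    and "tensor_preserves_coequalizers M"
    and "coequalizer_choice M q"
    and "monoidal_category C"
    and "monoidal_functor C M G"
  shows "\<exists>R U. monoid_in M R \<and>
           monoidal_functor C (bimod_cat M q R) U \<and>
           strictly_unital (bimod_cat M q R) U \<and>
           mfun_eq C G (mfun_comp M (forget q R) U) \<and>
           (\<forall>S V. monoid_in M S \<and>
              monoidal_functor C (bimod_cat M q S) V \<and>
              mfun_eq C G (mfun_comp M (forget q S) V) \<longrightarrow>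
              (\<exists>!\<sigma>. monoid_hom M S R \<sigma> \<and>
                 mfun_eq C V (mfun_comp (bimod_cat M q S) (restrict M q S R \<sigma>) U)))"
proof -
  interpret G: lax_functor_bimodules C M G q
    using assms by (intro lax_functor_bimodules.intro lax_functor_bimodules_axioms.intro)
  have "\<exists>!\<sigma>. monoid_hom M S G.R \<sigma> \<and>
      mfun_eq C V (mfun_comp (bimod_cat M q S) (restrict M q S G.R \<sigma>) G.U)"
    if "monoid_in M S" "monoidal_functor C (bimod_cat M q S) V"
      "mfun_eq C G (mfun_comp M (forget q S) V)" for S V
  proof -
    interpret V: lax_factorization C M G q S V
      using that assms
      by (intro lax_factorization.intro lax_factorization_axioms.intro bimodules.intro
          bimodules_axioms.intro G.lax_functor_bimodules_axioms)
    show ?thesis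
      using V.monoid_hom_\<sigma> V.V_factor V.\<sigma>_unique by blast
  qed
  then show ?thesis
    using G.monoid_R G.monoidal_functor_U G.strictly_unital_U G.forget_U by blast
qed

end
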